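(* Let $k\in\{4,5\}$. There is $n_0$ such that for every $n\ge n_0$ the following holds. If $G\in{\rm SPEX}(n,W_{2k+1})$, then there are a number $s$ with $|s|\le 1$ and a partition $V(G)=L\cup R$ with $|L|=\frac n2+s$ and $|R|=\frac n2-s$ such that: \begin{itemize} \item every vertex of $L$ is adjacent to every vertex of $R$; \item $G[L]\in\mathcal U_{k,\frac n2+s}$; \item $G[R]$ has exactly one edge. \end{itemize}
   Context: For $k\ge 4$, the wheel $W_k=K_1\vee C_{k-1}$ is the graph obtained from a cycle on $k-1$ vertices by adding one new vertex adjacent to all vertices of the cycle. Thus $W_{2k+1}$ (with $k\ge2$) is the odd wheel obtained from $C_{2k}$ by adding a vertex adjacent to all its vertices. The spectral radius $\lambda_1(G)$ is the largest eigenvalue of the adjacency matrix of $G$. A graph is $F$-free if it contains no subgraph isomorphic to $F$. ${\rm SPEX}(n,F)$ denotes the set of $F$-free graphs on $n$ vertices with maximum spectral radius. A graph is nearly $(k-1)$-regular if every vertex has degree $k-1$ except exactly one vertex, which has degree $k-2$. For $k\ge3$ and integer $m$, $\mathcal U_{k,m}$ denotes the family of graphs on $m$ vertices that are $(k-1)$-regular or nearly $(k-1)$-regular and contain no path on $2k-1$ vertices. Equivalently, these are the $(k-1)$-regular or nearly $(k-1)$-regular graphs on $m$ vertices in which every connected component has at most $2k-2$ vertices. *)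

theory Defs
  imports Complex_Main
begin

definition graph_on :: "nat \<Rightarrow> (nat \<Rightarrow> nat \<Rightarrow> bool) \<Rightarrow> bool" where
  "graph_on n E \<longleftrightarrow> (\<forall>u v. E u v \<longrightarrow> u < n \<and> v < n \<and> u \<noteq> v \<and> E v u)"

definition adj_mat :: "(nat \<Rightarrow> nat \<Rightarrow> bool) \<Rightarrow> nat \<Rightarrow> nat \<Rightarrow> real" where
  "adj_mat E i j = (if E i j then 1 else 0)"

definition adj_eigenvalues :: "nat \<Rightarrow> (nat \<Rightarrow> nat \<Rightarrow> bool) \<Rightarrow> real set" where
  "adj_eigenvalues n E = {\<mu>. \<exists>x :: nat \<Rightarrow> real. (\<exists>i<n. x i \<noteq> 0) \<and>
      (\<forall>i<n. (\<Sum>j<n. adj_mat E i j * x j) = \<mu> * x i)}"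

definition spectral_radius :: "nat \<Rightarrow> (nat \<Rightarrow> nat \<Rightarrow> bool) \<Rightarrow> real" where
  "spectral_radius n E = Max (adj_eigenvalues n E)"

text \<open>G contains the wheel K_1 join C_m as a subgraph (m \<ge> 3): a hub c and an
  injective cycle f 0, ..., f (m-1) of vertices different from c, all adjacent to c.\<close>
definition contains_wheel :: "nat \<Rightarrow> (nat \<Rightarrow> nat \<Rightarrow> bool) \<Rightarrow> nat \<Rightarrow> bool" where
  "contains_wheel n E m \<longleftrightarrow> (\<exists>c f. c < n \<and> inj_on f {0..<m} \<and>
      (\<forall>i<m. f i < n \<and> f i \<noteq> c \<and> E c (f i) \<and> E (f i) (f ((i + 1) mod m))))"

text \<open>The odd wheel W_{2k+1} = K_1 join C_{2k}.\<close>
definition odd_wheel_free :: "nat \<Rightarrow> nat \<Rightarrow> (nat \<Rightarrow> nat \<Rightarrow> bool) \<Rightarrow> bool" where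
  "odd_wheel_free k n E \<longleftrightarrow> \<not> contains_wheel n E (2 * k)"

definition SPEX_wheel :: "nat \<Rightarrow> nat \<Rightarrow> (nat \<Rightarrow> nat \<Rightarrow> bool) \<Rightarrow> bool" where
  "SPEX_wheel k n E \<longleftrightarrow> graph_on n E \<and> odd_wheel_free k n E \<and>
     (\<forall>E'. graph_on n E' \<and> odd_wheel_free k n E' \<longrightarrow> spectral_radius n E' \<le> spectral_radius n E)"

definition deg_in :: "(nat \<Rightarrow> nat \<Rightarrow> bool) \<Rightarrow> nat set \<Rightarrow> nat \<Rightarrow> nat" where
  "deg_in E S v = card {u \<in> S. E v u}"

definition regular_on :: "(nat \<Rightarrow> nat \<Rightarrow> bool) \<Rightarrow> nat set \<Rightarrow> nat \<Rightarrow> bool" where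
  "regular_on E S d \<longleftrightarrow> (\<forall>v\<in>S. deg_in E S v = d)"

definition nearly_regular_on :: "(nat \<Rightarrow> nat \<Rightarrow> bool) \<Rightarrow> nat set \<Rightarrow> nat \<Rightarrow> bool" where
  "nearly_regular_on E S d \<longleftrightarrow> (\<exists>w\<in>S. deg_in E S w = d - 1 \<and> (\<forall>v\<in>S - {w}. deg_in E S v = d))"

definition has_path_on :: "(nat \<Rightarrow> nat \<Rightarrow> bool) \<Rightarrow> nat set \<Rightarrow> nat \<Rightarrow> bool" where
  "has_path_on E S p \<longleftrightarrow> (\<exists>f. inj_on f {0..<p} \<and> (\<forall>i<p. f i \<in> S) \<and>
      (\<forall>i. i + 1 < p \<longrightarrow> E (f i) (f (i + 1))))"

definition in_U_family :: "nat \<Rightarrow> (nat \<Rightarrow> nat \<Rightarrow> bool) \<Rightarrow> nat set \<Rightarrow> bool" where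
  "in_U_family k E S \<longleftrightarrow> (regular_on E S (k - 1) \<or> nearly_regular_on E S (k - 1)) \<and>
      \<not> has_path_on E S (2 * k - 1)"

definition edges_in :: "(nat \<Rightarrow> nat \<Rightarrow> bool) \<Rightarrow> nat set \<Rightarrow> nat set set" where
  "edges_in E S = {{u, v} | u v. u \<in> S \<and> v \<in> S \<and> E u v}"

end

theory Submission
  imports Defs "HOL-Analysis.Analysis"
begin

text \<open>
  Let \<open>x\<close> be the Perron vector with maximal entry 1 at \<open>z\<close> and \<open>r\<close> the spectral radius. A
  neighbourhood contains no \<open>C\<^sub>2\<^sub>k\<close>, so it spans \<open>o(n\<^sup>2)\<close> edges; expanding \<open>r\<^sup>2 x\<^sub>z\<close> over walks of length
  two and using \<open>r\<^sup>2 \<ge> n\<^sup>2 / 4 - 1\<close> then shows that the graph is almost complete bipartite between the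
  neighbourhood of \<open>z\<close> and its complement. Replacing the neighbourhood of a vertex by the typical
  vertices of one side creates no wheel, so by extremality all entries of \<open>x\<close> are close to 1.
  Hence every vertex sees almost the whole opposite side \<open>R\<close> or \<open>L\<close> and at most \<open>k - 1\<close> vertices on
  its own side.

  To first order the sum of the average inner degrees of the two sides must be \<open>k - 1\<close>. If no vertex has
  inner degree \<open>k - 1\<close>, then many disjoint paths on 3 or 4 vertices in one side produce a wheel,
  which leaves only maximal inner degrees \<open>a, b\<close> with \<open>a, b \<ge> 1\<close> and \<open>a + b = k - 1\<close>. This gives
  \<open>(r - a) (r - b) \<le> n\<^sup>2 / 4\<close>, contradicting \<open>r\<^sup>2 - (k - 1) r \<ge> n\<^sup>2 / 4 + 1 - o(1)\<close>. So some vertex, say in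
  \<open>L\<close>, has inner degree \<open>k - 1\<close> and \<open>R\<close> has few inner edges. With \<open>s = |L| - n / 2\<close>, with \<open>M\<close> missing
  cross edges and total degree deficiency \<open>D\<close> in \<open>L\<close>, a second order expansion yields
  \<open>s\<^sup>2 + 2 M + D + 1 \<le> 2 e(R) + o(1)\<close> up to constants close to 1. A vertex of full inner degree with no missing
  edges around it forces \<open>e(R) \<le> 1\<close>, so \<open>e(R) = 1\<close>, \<open>M = 0\<close>, \<open>D \<le> 1\<close> and \<open>|s| \<le> 1\<close>.
\<close>

section \<open>Rayleigh quotients and Perron vectors\<close>

lemma graph_onD:
  assumes "graph_on n E" "E u v"
  shows "u < n" "v < n" "u \<noteq> v" "E v u"
  using assms unfolding graph_on_def by blast+

lemma finite_nbrs: "graph_on n E \<Longrightarrow> finite {u. E v u}"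
  by (rule finite_subset[of _ "{..<n}"]) (auto dest: graph_onD)

lemma adj_sum:
  assumes "graph_on n E"
  shows "(\<Sum>j<n. adj_mat E i j * x j) = sum x {j. E i j}"
proof -
  have "(\<Sum>j<n. adj_mat E i j * x j) = (\<Sum>j\<in>{..<n} \<inter> {j. E i j}. x j)"
    unfolding sum.inter_restrict[OF finite_lessThan]
    by (rule sum.cong) (auto simp: adj_mat_def)
  also have "{..<n} \<inter> {j. E i j} = {j. E i j}" using assms by (auto dest: graph_onD)
  finally show ?thesis .
qed

lemma adj_mat_sym: "graph_on n E \<Longrightarrow> adj_mat E i j = adj_mat E j i"
  by (auto simp: adj_mat_def dest: graph_onD)

text \<open>By symmetry the bilinear form of the adjacency matrix at \<open>x\<close> and
  \<open>y\<close> is both \<mu> and \<nu> times their inner product.\<close>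

lemma eigvecs_orthogonal:
  assumes G: "graph_on n E" and "\<mu> \<noteq> \<nu>"
    and x: "\<And>i. i < n \<Longrightarrow> (\<Sum>j<n. adj_mat E i j * x j) = \<mu> * x i"
    and y: "\<And>i. i < n \<Longrightarrow> (\<Sum>j<n. adj_mat E i j * y j) = \<nu> * y i"
  shows "(\<Sum>i<n. x i * y i) = 0"
proof -
  have "\<mu> * (\<Sum>i<n. x i * y i) = (\<Sum>i<n. (\<Sum>j<n. adj_mat E i j * x j) * y i)"
    unfolding sum_distrib_left by (rule sum.cong) (auto simp: x)
  also have "\<dots> = (\<Sum>i<n. \<Sum>j<n. adj_mat E i j * x j * y i)"
    by (simp add: sum_distrib_right)
  also have "\<dots> = (\<Sum>j<n. \<Sum>i<n. adj_mat E i j * x j * y i)" by (rule sum.swap)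
  also have "\<dots> = (\<Sum>j<n. (\<Sum>i<n. adj_mat E j i * y i) * x j)"
    by (intro sum.cong refl, simp add: sum_distrib_right, intro sum.cong refl)
       (simp add: adj_mat_sym[OF G, of _ "_"] mult_ac)
  also have "\<dots> = \<nu> * (\<Sum>i<n. x i * y i)"
    unfolding sum_distrib_left by (rule sum.cong) (auto simp: y)
  finally show ?thesis using \<open>\<mu> \<noteq> \<nu>\<close> by auto
qed

text \<open>\<open>spectral_radius\<close> is a \<open>Max\<close>, which is meaningful only on a
  finite set. More than \<open>n\<close> eigenvalues would supply more than \<open>n\<close>
  orthonormal vectors in dimension \<open>n\<close>, against Bessel's inequality.\<close>

lemma finite_adj_eigenvalues:
  assumes G: "graph_on n E"
  shows "finite (adj_eigenvalues n E)"
proof (rule ccontr)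
  assume "infinite (adj_eigenvalues n E)"
  then obtain T where T: "T \<subseteq> adj_eigenvalues n E" "finite T" "card T = Suc n"
    using infinite_arbitrarily_large by blast
  have "\<exists>x. (\<Sum>i<n. x i * x i) = 1 \<and> (\<forall>i<n. (\<Sum>j<n. adj_mat E i j * x j) = \<mu> * x i)"
    if "\<mu> \<in> T" for \<mu>
  proof -
    obtain y where y: "\<exists>i<n. y i \<noteq> 0" "\<And>i. i<n \<Longrightarrow> (\<Sum>j<n. adj_mat E i j * y j) = \<mu> * y i"
      using subsetD[OF T(1) \<open>\<mu> \<in> T\<close>] unfolding adj_eigenvalues_def by blast
    define q where "q = (\<Sum>i<n. y i * y i)"
    have "q > 0" unfolding q_def using y(1) by (auto intro!: sum_pos2 simp: zero_less_mult_iff)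
    define x where "x i = y i / sqrt q" for i
    have "(\<Sum>i<n. x i * x i) = q / (sqrt q * sqrt q)"
      unfolding x_def q_def by (simp add: sum_divide_distrib)
    then have 1: "(\<Sum>i<n. x i * x i) = 1" using \<open>q > 0\<close> by simp
    have "\<forall>i<n. (\<Sum>j<n. adj_mat E i j * x j) = \<mu> * x i"
      using y(2) unfolding x_def by (simp add: sum_divide_distrib[symmetric])
    with 1 show ?thesis by blast
  qed
  then obtain X where X1: "\<And>\<mu>. \<mu> \<in> T \<Longrightarrow> (\<Sum>i<n. X \<mu> i * X \<mu> i) = (1::real)"
    and X2: "\<And>\<mu> i. \<mu> \<in> T \<Longrightarrow> i < n \<Longrightarrow> (\<Sum>j<n. adj_mat E i j * X \<mu> j) = \<mu> * X \<mu> i"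
    by metis
  have orth: "(\<Sum>j<n. X \<mu> j * X \<nu> j) = (if \<mu> = \<nu> then 1 else 0)" if "\<mu> \<in> T" "\<nu> \<in> T" for \<mu> \<nu>
    using eigvecs_orthogonal[OF G, of \<mu> \<nu> "X \<mu>" "X \<nu>"] X1 X2 that by auto
  have bessel: "(\<Sum>\<mu>\<in>T. X \<mu> i * X \<mu> i) \<le> 1" if i: "i < n" for i
  proof -
    define s where "s = (\<Sum>\<mu>\<in>T. X \<mu> i * X \<mu> i)"
    \<comment> \<open>\<open>c\<close> is the projection of the unit vector at \<open>i\<close> to
      the span of the eigenvectors. Both its squared length and \<open>c i\<close> equal
      \<open>s\<close>, so the squared distance to the unit vector is \<open>1 - s\<close>.\<close>
    define c where "c j = (\<Sum>\<mu>\<in>T. X \<mu> i * X \<mu> j)" for j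
    have "(\<Sum>j<n. c j * c j) = (\<Sum>j<n. \<Sum>\<mu>\<in>T. \<Sum>\<nu>\<in>T. (X \<mu> i * X \<nu> i) * (X \<mu> j * X \<nu> j))"
      unfolding c_def by (simp add: sum_product mult_ac)
    also have "\<dots> = (\<Sum>\<mu>\<in>T. \<Sum>j<n. \<Sum>\<nu>\<in>T. (X \<mu> i * X \<nu> i) * (X \<mu> j * X \<nu> j))" by (rule sum.swap)
    also have "\<dots> = (\<Sum>\<mu>\<in>T. \<Sum>\<nu>\<in>T. (\<Sum>j<n. (X \<mu> i * X \<nu> i) * (X \<mu> j * X \<nu> j)))"
      by (intro sum.cong refl sum.swap)
    also have "\<dots> = (\<Sum>\<mu>\<in>T. \<Sum>\<nu>\<in>T. (X \<mu> i * X \<nu> i) * (if \<mu> = \<nu> then 1 else 0))"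
      by (intro sum.cong refl) (simp add: sum_distrib_left[symmetric] orth)
    also have "\<dots> = (\<Sum>\<mu>\<in>T. \<Sum>\<nu>\<in>T. if \<mu> = \<nu> then X \<mu> i * X \<nu> i else 0)"
      by (intro sum.cong refl) auto
    also have "\<dots> = s" unfolding s_def using T(2) by (simp add: sum.delta')
    finally have cc: "(\<Sum>j<n. c j * c j) = s" .
    have "0 \<le> (\<Sum>j<n. ((if j = i then 1 else 0) - c j)\<^sup>2)" by (rule sum_nonneg) simp
    also have "\<dots> = (\<Sum>j<n. (if j = i then 1 - 2 * c j else 0) + c j * c j)"
      by (intro sum.cong) (auto simp: power2_eq_square algebra_simps)
    also have "\<dots> = 1 - 2 * c i + s" using i by (simp add: sum.distrib cc)
    finally show ?thesis unfolding c_def s_def by simp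
  qed
  have "real (card T) = (\<Sum>\<mu>\<in>T. \<Sum>i<n. X \<mu> i * X \<mu> i)" by (simp add: X1)
  also have "\<dots> = (\<Sum>i<n. \<Sum>\<mu>\<in>T. X \<mu> i * X \<mu> i)" by (rule sum.swap)
  also have "\<dots> \<le> (\<Sum>i<n. 1)" by (rule sum_mono) (use bessel in auto)
  finally show False using T(3) by simp
qed

lemma linear_term_zero:
  fixes a b :: real
  assumes "\<And>t. 2 * t * a + t\<^sup>2 * b \<le> 0"
  shows "a = 0"
proof (rule ccontr)
  assume "a \<noteq> 0"
  \<comment> \<open>\<open>t\<close> has the sign of \<open>a\<close> and is small enough for the
    linear term to dominate whatever the sign of \<open>b\<close>.\<close>
  define t where "t = a / (\<bar>b\<bar> + 1)"
  have t: "t * (\<bar>b\<bar> + 1) = a" unfolding t_def by auto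
  have "t \<noteq> 0" using t \<open>a \<noteq> 0\<close> by auto
  have "2 * t * a + t\<^sup>2 * b = t\<^sup>2 * (2 * \<bar>b\<bar> + 2 + b)"
    unfolding t[symmetric] by (simp add: power2_eq_square algebra_simps)
  also have "\<dots> > 0" using \<open>t \<noteq> 0\<close> by (intro mult_pos_pos) auto
  finally show False using assms[of t] by simp
qed

text \<open>Variational argument: the quadratic form attains its maximum on the unit sphere,
  absolute values do not lower it, and stationarity at the maximiser is the eigenvalue
  equation.\<close>

lemma rayleigh_maximiser:
  assumes G: "graph_on n E" and n: "0 < n"
  obtains x where "\<And>i. 0 \<le> x i" "(\<Sum>i<n. (x i)\<^sup>2) = 1"
    "\<And>i. i < n \<Longrightarrow> sum x {j. E i j} = spectral_radius n E * x i"
    "\<And>y. (\<Sum>i<n. y i * sum y {j. E i j}) \<le> spectral_radius n E * (\<Sum>i<n. (y i)\<^sup>2)"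
proof -
  define q :: "(nat \<Rightarrow> real) \<Rightarrow> real" where "q y = (\<Sum>i<n. \<Sum>j<n. adj_mat E i j * y i * y j)" for y
  have q_alt: "q y = (\<Sum>i<n. y i * sum y {j. E i j})" for y
    unfolding q_def adj_sum[OF G, symmetric] by (simp add: sum_distrib_left mult_ac)
  \<comment> \<open>Vectors are functions on all naturals, so the coordinates from \<open>n\<close>
    on are pinned to 0; the box is then compact by Tychonoff's theorem.\<close>
  define B :: "(nat \<Rightarrow> real) set" where "B = PiE UNIV (\<lambda>i. if i < n then {-1..1} else {0})"
  define S where "S = B \<inter> {y. (\<Sum>i<n. (y i)\<^sup>2) = 1}"
  have "compactin (product_topology (\<lambda>i::nat. euclidean) UNIV) B"
    unfolding B_def compactin_PiE by auto
  then have "compact B" by (simp add: euclidean_product_topology)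
  moreover have "closed {y :: nat \<Rightarrow> real. (\<Sum>i<n. (y i)\<^sup>2) = 1}"
    by (intro closed_Collect_eq continuous_intros continuous_on_product_coordinates)
  ultimately have "compact S" unfolding S_def by (rule compact_Int_closed)
  moreover have "(\<lambda>i. if i = 0 then 1 else 0) \<in> S"
    unfolding S_def B_def using n by (auto simp: if_distrib[of "\<lambda>a. a\<^sup>2"] cong: if_cong)
  then have "S \<noteq> {}" by blast
  moreover have "continuous_on S q"
    unfolding q_def
    by (intro continuous_intros continuous_on_subset[OF continuous_on_product_coordinates]) auto
  ultimately obtain x0 where x0: "x0 \<in> S" "\<And>y. y \<in> S \<Longrightarrow> q y \<le> q x0"
    using continuous_attains_sup by metis
  define \<mu> where "\<mu> = q x0"
  have ray: "q y \<le> \<mu> * (\<Sum>i<n. (y i)\<^sup>2)" for y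
  proof -
    define r where "r = (\<Sum>i<n. (y i)\<^sup>2)"
    have "r \<ge> 0" unfolding r_def by (rule sum_nonneg) simp
    show ?thesis
    proof (cases "r = 0")
      case True
      then have z: "y i = 0" if "i < n" for i
        using that unfolding r_def by (subst (asm) sum_nonneg_eq_0_iff) auto
      have "q y = 0" unfolding q_def by (intro sum.neutral ballI) (auto simp: z)
      then show ?thesis using True unfolding r_def by simp
    next
      case False
      then have "r > 0" using \<open>r \<ge> 0\<close> by simp
      define y' where "y' i = (if i < n then y i / sqrt r else 0)" for i
      have "(\<Sum>i<n. (y' i)\<^sup>2) = (\<Sum>i<n. (y i)\<^sup>2 / r)"
        unfolding y'_def using \<open>r > 0\<close> by (intro sum.cong) (auto simp: power_divide)
      also have "\<dots> = 1" using \<open>r > 0\<close> unfolding r_def by (simp add: sum_divide_distrib[symmetric])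
      finally have s1: "(\<Sum>i<n. (y' i)\<^sup>2) = 1" .
      have "y' i \<in> {-1..1}" if "i < n" for i
      proof -
        have "(y' i)\<^sup>2 \<le> (\<Sum>i<n. (y' i)\<^sup>2)" using that by (intro member_le_sum) auto
        then have "\<bar>y' i\<bar> \<le> 1" using s1 by (simp add: abs_square_le_1)
        then show ?thesis by auto
      qed
      then have "y' \<in> S" using s1 unfolding S_def B_def by (auto simp: y'_def)
      then have "q y' \<le> \<mu>" using x0 unfolding \<mu>_def by simp
      moreover have "q y' = q y / r"
      proof -
        have "q y' = (\<Sum>i<n. \<Sum>j<n. adj_mat E i j * y i * y j / (sqrt r * sqrt r))"
          unfolding q_def y'_def by (intro sum.cong) auto
        also have "\<dots> = q y / r" using \<open>r > 0\<close> unfolding q_def by (simp add: sum_divide_distrib)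
        finally show ?thesis .
      qed
      ultimately show ?thesis using \<open>r > 0\<close> unfolding r_def[symmetric] by (simp add: field_simps)
    qed
  qed
  define x where "x i = \<bar>x0 i\<bar>" for i
  have x1: "(\<Sum>i<n. (x i)\<^sup>2) = 1" using x0(1) unfolding S_def x_def by auto
  have "q x0 \<le> q x" unfolding q_def
  proof (intro sum_mono)
    fix i j
    have "x0 i * x0 j \<le> x i * x j" unfolding x_def by (metis abs_ge_self abs_mult)
    then show "adj_mat E i j * x0 i * x0 j \<le> adj_mat E i j * x i * x j"
      by (auto simp: adj_mat_def)
  qed
  then have qx: "q x = \<mu>" using ray[of x] x1 unfolding \<mu>_def by simp
  have eig: "sum x {j. E i j} = \<mu> * x i" if i: "i < n" for i
  proof -
    \<comment> \<open>Moving coordinate \<open>i\<close> alone by \<open>t\<close> changes the form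
      minus \<mu> times the squared norm by this polynomial. It is nonpositive by
      \<open>ray\<close>, so its linear coefficient vanishes.\<close>
    have "2 * t * (sum x {j. E i j} - \<mu> * x i) + t\<^sup>2 * (- \<mu>) \<le> 0" for t
    proof -
      define d :: "nat \<Rightarrow> real" where "d j = (if j = i then t else 0)" for j
      define y where "y j = x j + d j" for j
      have y2: "(\<Sum>j<n. (y j)\<^sup>2) = 1 + 2 * t * x i + t\<^sup>2"
      proof -
        have "(\<Sum>j<n. (y j)\<^sup>2) = (\<Sum>j<n. (x j)\<^sup>2 + (if j = i then 2 * t * x j + t\<^sup>2 else 0))"
          unfolding y_def d_def by (intro sum.cong) (auto simp: power2_eq_square algebra_simps)
        then show ?thesis using i x1 by (simp add: sum.distrib)
      qed
      have aii: "adj_mat E i i = 0" using G by (auto simp: adj_mat_def dest: graph_onD)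
      have xd: "(\<Sum>a<n. \<Sum>b<n. adj_mat E a b * x a * d b) = t * sum x {j. E i j}"
      proof -
        have "(\<Sum>a<n. \<Sum>b<n. adj_mat E a b * x a * d b) = (\<Sum>a<n. \<Sum>b<n. if b = i then adj_mat E a b * x a * t else 0)"
          unfolding d_def by (intro sum.cong) auto
        also have "\<dots> = (\<Sum>a<n. adj_mat E i a * x a * t)" using i by (simp add: adj_mat_sym[OF G, of _ i])
        also have "\<dots> = t * sum x {j. E i j}"
          unfolding adj_sum[OF G, symmetric] by (simp add: sum_distrib_left mult_ac)
        finally show ?thesis .
      qed
      have dx: "(\<Sum>a<n. \<Sum>b<n. adj_mat E a b * d a * x b) = t * sum x {j. E i j}"
      proof -
        have "(\<Sum>a<n. \<Sum>b<n. adj_mat E a b * d a * x b) = (\<Sum>b<n. \<Sum>a<n. adj_mat E b a * x b * d a)"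
          by (subst sum.swap) (simp add: adj_mat_sym[OF G] mult_ac)
        then show ?thesis using xd by simp
      qed
      have dd: "(\<Sum>a<n. \<Sum>b<n. adj_mat E a b * d a * d b) = 0"
        unfolding d_def using aii by (intro sum.neutral ballI) auto
      have "q y = (\<Sum>a<n. \<Sum>b<n. adj_mat E a b * x a * x b + adj_mat E a b * x a * d b
         + adj_mat E a b * d a * x b + adj_mat E a b * d a * d b)"
        unfolding q_def y_def by (intro sum.cong) (auto simp: algebra_simps)
      also have "\<dots> = q x + t * sum x {j. E i j} + t * sum x {j. E i j} + 0"
        unfolding sum.distrib xd dx dd q_def by simp
      finally have "q y = \<mu> + 2 * t * sum x {j. E i j}" by (simp add: qx)
      with ray[of y] y2 show ?thesis by (simp add: algebra_simps)
    qed
    then have "sum x {j. E i j} - \<mu> * x i = 0" by (rule linear_term_zero)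
    then show ?thesis by simp
  qed
  have mem: "\<mu> \<in> adj_eigenvalues n E"
  proof -
    have "\<exists>i<n. x i \<noteq> 0"
    proof (rule ccontr)
      assume "\<not> (\<exists>i<n. x i \<noteq> 0)"
      then have "(\<Sum>i<n. (x i)\<^sup>2) = 0" by simp
      then show False using x1 by simp
    qed
    then show ?thesis unfolding adj_eigenvalues_def using eig adj_sum[OF G] by auto
  qed
  have le: "\<nu> \<le> \<mu>" if nu: "\<nu> \<in> adj_eigenvalues n E" for \<nu>
  proof -
    obtain y where y: "\<exists>i<n. y i \<noteq> 0" "\<And>i. i<n \<Longrightarrow> (\<Sum>j<n. adj_mat E i j * y j) = \<nu> * y i"
      using nu unfolding adj_eigenvalues_def by blast
    have "q y = (\<Sum>i<n. \<nu> * (y i)\<^sup>2)"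
      unfolding q_alt adj_sum[OF G, symmetric] by (intro sum.cong) (auto simp: y(2) power2_eq_square)
    then have "\<nu> * (\<Sum>i<n. (y i)\<^sup>2) \<le> \<mu> * (\<Sum>i<n. (y i)\<^sup>2)" using ray[of y]
      by (simp add: sum_distrib_left)
    moreover have "(\<Sum>i<n. (y i)\<^sup>2) > 0" using y(1) by (auto intro!: sum_pos2)
    ultimately show ?thesis by simp
  qed
  have "spectral_radius n E = \<mu>" unfolding spectral_radius_def
    using Max_eqI[OF finite_adj_eigenvalues[OF G] le mem] .
  then show thesis using that[of x] x1 eig ray unfolding q_alt x_def by simp
qed

lemma rayleigh:
  assumes "graph_on n E" "0 < n"
  shows "(\<Sum>i<n. y i * sum y {j. E i j}) \<le> spectral_radius n E * (\<Sum>i<n. (y i)\<^sup>2)"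
  using rayleigh_maximiser[OF assms] by metis

text \<open>The scaling measures all entries against the largest one. Entries may still vanish, as
  connectedness is not assumed.\<close>

lemma perron_vector:
  assumes G: "graph_on n E" and n: "0 < n"
  obtains x z where "\<And>i. 0 \<le> x i" "\<And>i. i < n \<Longrightarrow> x i \<le> (1::real)" "z < n" "x z = 1"
    "\<And>i. i < n \<Longrightarrow> sum x {j. E i j} = spectral_radius n E * x i"
proof -
  obtain x where x: "\<And>i. 0 \<le> x i" "(\<Sum>i<n. (x i)\<^sup>2) = 1"
    "\<And>i. i < n \<Longrightarrow> sum x {j. E i j} = spectral_radius n E * x i"
    using rayleigh_maximiser[OF assms] by metis
  define m where "m = Max (x ` {..<n})"
  have m: "x i \<le> m" if "i < n" for i using that unfolding m_def by auto
  have "m \<in> x ` {..<n}" unfolding m_def using n by (intro Max_in) auto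
  then obtain z where z: "z < n" "x z = m" by auto
  have "m \<noteq> 0"
  proof
    assume "m = 0"
    then have "x i = 0" if "i < n" for i using m[OF that] x(1)[of i] by simp
    then have "(\<Sum>i<n. (x i)\<^sup>2) = 0" by simp
    then show False using x by simp
  qed
  then have "m > 0" using x(1)[of z] z by simp
  show thesis
  proof (rule that[of "\<lambda>i. x i / m" z])
    show "sum (\<lambda>i. x i / m) {j. E i j} = spectral_radius n E * (x i / m)" if "i < n" for i
      using x(3)[OF that] by (simp add: sum_divide_distrib[symmetric])
  qed (use x m z \<open>m > 0\<close> in auto)
qed

section \<open>Finding wheels and reconnecting a vertex\<close>

text \<open>With the rim written as a list and its head repeated at the end, each wheel below is
  checked by simplification on an explicit list.\<close>

lemma contains_wheelI:
  assumes G: "graph_on n E" and "distinct xs" "xs \<noteq> []"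
    and succ: "successively E (xs @ [hd xs])" and hub: "\<forall>y\<in>set xs. E c y"
  shows "contains_wheel n E (length xs)"
  unfolding contains_wheel_def
proof (intro exI[of _ c] exI[of _ "\<lambda>i. xs ! i"] conjI allI impI)
  show "c < n" using hub \<open>xs \<noteq> []\<close> graph_onD(1)[OF G] by (metis hd_in_set)
  show "inj_on ((!) xs) {0..<length xs}" using \<open>distinct xs\<close> by (auto intro: inj_on_nth)
  fix i assume i: "i < length xs"
  then have c: "E c (xs ! i)" using hub by simp
  then show "xs ! i < n" "xs ! i \<noteq> c" "E c (xs ! i)" using graph_onD[OF G] by blast+
  have s: "E ((xs @ [hd xs]) ! i) ((xs @ [hd xs]) ! Suc i)"
    using succ i unfolding successively_conv_nth by auto
  show "E (xs ! i) (xs ! ((i + 1) mod length xs))"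
  proof (cases "Suc i = length xs")
    case True
    then show ?thesis using s i \<open>xs \<noteq> []\<close> by (simp add: nth_append hd_conv_nth)
  next
    case False
    then show ?thesis using s i by (simp add: nth_append)
  qed
qed

lemma distinct_list_in:
  assumes "m \<le> card S"
  obtains xs where "distinct xs" "length xs = m" "set xs \<subseteq> S"
proof -
  obtain T where T: "T \<subseteq> S" "card T = m" "finite T"
    using obtain_subset_with_card_n[OF assms] by metis
  then obtain xs where "set xs = T" "distinct xs" using finite_distinct_list by blast
  then show thesis using that[of xs] T distinct_card by fastforce
qed

lemma distinct_list_avoiding:
  assumes "m + length ys \<le> card S" "distinct ys"
  obtains xs where "distinct (xs @ ys)" "length xs = m" "set xs \<subseteq> S"
proof -
  have "card S - card (set ys) \<le> card (S - set ys)" by (rule diff_card_le_card_Diff) simp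
  then have "m \<le> card (S - set ys)" using assms card_length[of ys] by linarith
  then obtain xs where "distinct xs" "length xs = m" "set xs \<subseteq> S - set ys"
    by (rule distinct_list_in)
  then show thesis using that[of xs] \<open>distinct ys\<close> by auto
qed

text \<open>The rim alternates between \<open>k\<close> vertices of \<open>A\<close> and
  \<open>k\<close> vertices of \<open>B\<close>.\<close>

lemma complete_bipartite_nbhd_wheel:
  assumes G: "graph_on n E" and k: "k \<in> {4, 5}" and cA: "k \<le> card A" and cB: "k \<le> card B"
    and AB: "\<And>a b. a \<in> A \<Longrightarrow> b \<in> B \<Longrightarrow> E a b"
    and c: "\<And>a. a \<in> A \<union> B \<Longrightarrow> E c a"
  shows "contains_wheel n E (2 * k)"
proof -
  obtain as where as: "distinct as" "length as = k" "set as \<subseteq> A" using cA by (rule distinct_list_in)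
  obtain bs where bs: "distinct bs" "length bs = k" "set bs \<subseteq> B" using cB by (rule distinct_list_in)
  have "A \<inter> B = {}" using AB graph_onD(3)[OF G] by blast
  have ab: "E a b" "E b a" if "a \<in> set as" "b \<in> set bs" for a b
  proof -
    have "a \<in> A" "b \<in> B" using that as bs by auto
    then show "E a b" "E b a" using AB[of a b] graph_onD(4)[OF G, of a b] by auto
  qed
  have dist: "distinct (as @ bs)" using as bs \<open>A \<inter> B = {}\<close> by auto
  have hub: "E c y" if "y \<in> set as \<or> y \<in> set bs" for y using that as bs c by auto
  from k consider "k = 4" | "k = 5" by auto
  then show ?thesis
  proof cases
    case 1
    obtain a1 a2 a3 a4 where [simp]: "as = [a1,a2,a3,a4]"
      using as(2) 1 by (auto simp: length_Suc_conv numeral_eq_Suc)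
    obtain b1 b2 b3 b4 where [simp]: "bs = [b1,b2,b3,b4]"
      using bs(2) 1 by (auto simp: length_Suc_conv numeral_eq_Suc)
    have "contains_wheel n E (length [a1,b1,a2,b2,a3,b3,a4,b4])"
      using dist by - (rule contains_wheelI[OF G, of _ c]; auto simp: ab hub)
    then show ?thesis using 1 by (simp add: numeral_eq_Suc)
  next
    case 2
    obtain a1 a2 a3 a4 a5 where [simp]: "as = [a1,a2,a3,a4,a5]"
      using as(2) 2 by (auto simp: length_Suc_conv numeral_eq_Suc)
    obtain b1 b2 b3 b4 b5 where [simp]: "bs = [b1,b2,b3,b4,b5]"
      using bs(2) 2 by (auto simp: length_Suc_conv numeral_eq_Suc)
    have "contains_wheel n E (length [a1,b1,a2,b2,a3,b3,a4,b4,a5,b5])"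
      using dist by - (rule contains_wheelI[OF G, of _ c]; auto simp: ab hub)
    then show ?thesis using 2 by (simp add: numeral_eq_Suc)
  qed
qed

text \<open>The \<open>k - 1\<close> vertices of \<open>T\<close> cut the rim into
  \<open>k - 1\<close> segments inside \<open>B\<close>, which must hold \<open>k + 1\<close>
  vertices. The two surplus vertices come from the two edges: one segment on three vertices if the
  edges meet, two segments on two vertices otherwise.\<close>

lemma two_edges_wheel:
  assumes G: "graph_on n E" and k: "k \<in> {4, 5}" and cT: "card T = k - 1" and cB: "k + 1 \<le> card B"
    and TB: "\<And>t b. t \<in> T \<Longrightarrow> b \<in> B \<Longrightarrow> E t b"
    and c: "\<And>a. a \<in> T \<union> B \<Longrightarrow> E c a"
    and e: "a \<in> B" "b \<in> B" "E a b" "a' \<in> B" "b' \<in> B" "E a' b'" "{a, b} \<noteq> {a', b'}"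
  shows "contains_wheel n E (2 * k)"
proof -
  obtain ts where ts: "distinct ts" "length ts = k - 1" "set ts \<subseteq> T"
    using cT by (metis distinct_list_in order_refl)
  have "T \<inter> B = {}" using TB graph_onD(3)[OF G] by blast
  have tb: "E t b" "E b t" if "t \<in> set ts" "b \<in> B" for t b
  proof -
    have "t \<in> T" "b \<in> B" using that ts by auto
    then show "E t b" "E b t" using TB[of t b] graph_onD(4)[OF G, of t b] by auto
  qed
  have dist: "distinct (ts @ ps)" if "distinct ps" "set ps \<subseteq> B" for ps
    using that ts \<open>T \<inter> B = {}\<close> by auto
  have hub: "E c y" if "y \<in> set ts \<or> y \<in> B" for y using that ts c by auto
  have sym: "E y x" if "E x y" for x y using G that by (rule graph_onD)
  have ne: "x \<noteq> y" if "E x y" for x y using G that by (rule graph_onD)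
  \<comment> \<open>The case of two edges meeting in \<open>q\<close>.\<close>
  have path3: "contains_wheel n E (2 * k)" if p: "E p q" "E q r" "p \<noteq> r" "p \<in> B" "q \<in> B" "r \<in> B" for p q r
  proof -
    have "distinct [p,q,r]" using p ne by auto
    moreover have "k - 2 + length [p,q,r] \<le> card B" using cB k by auto
    ultimately obtain es where es: "distinct (es @ [p,q,r])" "length es = k - 2" "set es \<subseteq> B"
      by (metis distinct_list_avoiding)
    from k consider "k = 4" | "k = 5" by auto
    then show ?thesis
    proof cases
      case 1
      obtain t1 t2 t3 where [simp]: "ts = [t1,t2,t3]"
        using ts(2) 1 by (auto simp: length_Suc_conv numeral_eq_Suc)
      obtain e1 e2 where [simp]: "es = [e1,e2]"
        using es(2) 1 by (auto simp: length_Suc_conv numeral_eq_Suc)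
      have "contains_wheel n E (length [t1,p,q,r,t2,e1,t3,e2])"
        using dist[OF es(1)] es p by - (rule contains_wheelI[OF G, of _ c]; auto simp: tb hub)
      then show ?thesis using 1 by (simp add: numeral_eq_Suc)
    next
      case 2
      obtain t1 t2 t3 t4 where [simp]: "ts = [t1,t2,t3,t4]"
        using ts(2) 2 by (auto simp: length_Suc_conv numeral_eq_Suc)
      obtain e1 e2 e3 where [simp]: "es = [e1,e2,e3]"
        using es(2) 2 by (auto simp: length_Suc_conv numeral_eq_Suc)
      have "contains_wheel n E (length [t1,p,q,r,t2,e1,t3,e2,t4,e3])"
        using dist[OF es(1)] es p by - (rule contains_wheelI[OF G, of _ c]; auto simp: tb hub)
      then show ?thesis using 2 by (simp add: numeral_eq_Suc)
    qed
  qed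
  show ?thesis
  proof (cases "distinct [a,b,a',b']")
    case False
    then consider "a = a'" | "a = b'" | "b = a'" | "b = b'" using e ne by auto
    then show ?thesis
      by cases (use path3[of b a b'] path3[of b a a'] path3[of a b b'] path3[of a b a'] e sym in auto)
  next
    case True
    moreover have "k - 3 + length [a,b,a',b'] \<le> card B" using cB k by auto
    ultimately obtain es where es: "distinct (es @ [a,b,a',b'])" "length es = k - 3" "set es \<subseteq> B"
      by (metis distinct_list_avoiding)
    from k consider "k = 4" | "k = 5" by auto
    then show ?thesis
    proof cases
      case 1
      obtain t1 t2 t3 where [simp]: "ts = [t1,t2,t3]"
        using ts(2) 1 by (auto simp: length_Suc_conv numeral_eq_Suc)
      obtain e1 where [simp]: "es = [e1]"
        using es(2) 1 by (auto simp: length_Suc_conv numeral_eq_Suc)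
      have "contains_wheel n E (length [t1,a,b,t2,a',b',t3,e1])"
        using dist[OF es(1)] es e by - (rule contains_wheelI[OF G, of _ c]; auto simp: tb hub)
      then show ?thesis using 1 by (simp add: numeral_eq_Suc)
    next
      case 2
      obtain t1 t2 t3 t4 where [simp]: "ts = [t1,t2,t3,t4]"
        using ts(2) 2 by (auto simp: length_Suc_conv numeral_eq_Suc)
      obtain e1 e2 where [simp]: "es = [e1,e2]"
        using es(2) 2 by (auto simp: length_Suc_conv numeral_eq_Suc)
      have "contains_wheel n E (length [t1,a,b,t2,a',b',t3,e1,t4,e2])"
        using dist[OF es(1)] es e by - (rule contains_wheelI[OF G, of _ c]; auto simp: tb hub)
      then show ?thesis using 2 by (simp add: numeral_eq_Suc)
    qed
  qed
qed

text \<open>With \<open>k - 2\<close> separating vertices the segments must hold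
  \<open>k + 2\<close> vertices: two paths on three vertices and \<open>k - 4\<close> single
  vertices. For \<open>k = 5\<close> this takes a seventh vertex of \<open>B\<close>.\<close>

lemma two_paths3_wheel:
  assumes G: "graph_on n E" and k: "k \<in> {4, 5}" and cT: "card T = k - 2" and cB: "7 \<le> card B"
    and TB: "\<And>t b. t \<in> T \<Longrightarrow> b \<in> B \<Longrightarrow> E t b"
    and c: "\<And>a. a \<in> T \<union> B \<Longrightarrow> E c a"
    and d: "distinct [p1, p2, p3, q1, q2, q3]" and sub: "{p1, p2, p3, q1, q2, q3} \<subseteq> B"
    and e: "E p1 p2" "E p2 p3" "E q1 q2" "E q2 q3"
  shows "contains_wheel n E (2 * k)"
proof -
  obtain ts where ts: "distinct ts" "length ts = k - 2" "set ts \<subseteq> T"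
    using cT by (metis distinct_list_in order_refl)
  have "T \<inter> B = {}" using TB graph_onD(3)[OF G] by blast
  have tb: "E t b" "E b t" if "t \<in> set ts" "b \<in> B" for t b
  proof -
    have "t \<in> T" "b \<in> B" using that ts by auto
    then show "E t b" "E b t" using TB[of t b] graph_onD(4)[OF G, of t b] by auto
  qed
  have dist: "distinct (ts @ ps)" if "distinct ps" "set ps \<subseteq> B" for ps
    using that ts \<open>T \<inter> B = {}\<close> by auto
  have hub: "E c y" if "y \<in> set ts \<or> y \<in> B" for y using that ts c by auto
  from k consider "k = 4" | "k = 5" by auto
  then show ?thesis
  proof cases
    case 1
    obtain t1 t2 where [simp]: "ts = [t1,t2]"
      using ts(2) 1 by (auto simp: length_Suc_conv numeral_eq_Suc)
    have "contains_wheel n E (length [t1,p1,p2,p3,t2,q1,q2,q3])"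
      using dist[OF d] sub e by - (rule contains_wheelI[OF G, of _ c]; auto simp: tb hub)
    then show ?thesis using 1 by (simp add: numeral_eq_Suc)
  next
    case 2
    have "1 + length [p1, p2, p3, q1, q2, q3] \<le> card B" using cB by simp
    then obtain es where es: "distinct (es @ [p1, p2, p3, q1, q2, q3])" "length es = 1" "set es \<subseteq> B"
      using d by (metis distinct_list_avoiding)
    obtain t1 t2 t3 where [simp]: "ts = [t1,t2,t3]"
      using ts(2) 2 by (auto simp: length_Suc_conv numeral_eq_Suc)
    obtain r where [simp]: "es = [r]"
      using es(2) by (auto simp: length_Suc_conv)
    have "contains_wheel n E (length [t1,p1,p2,p3,t2,q1,q2,q3,t3,r])"
      using dist[OF es(1)] es sub e by - (rule contains_wheelI[OF G, of _ c]; auto simp: tb hub)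
    then show ?thesis using 2 by (simp add: numeral_eq_Suc)
  qed
qed

text \<open>Serves \<open>k = 5\<close>: two separating vertices and two segments on four vertices
  make a rim of length 10.\<close>

lemma two_paths4_wheel:
  assumes G: "graph_on n E" and cT: "card T = 2"
    and TB: "\<And>t b. t \<in> T \<Longrightarrow> b \<in> B \<Longrightarrow> E t b"
    and c: "\<And>a. a \<in> T \<union> B \<Longrightarrow> E c a"
    and d: "distinct [p1, p2, p3, p4, q1, q2, q3, q4]" and sub: "{p1, p2, p3, p4, q1, q2, q3, q4} \<subseteq> B"
    and e: "E p1 p2" "E p2 p3" "E p3 p4" "E q1 q2" "E q2 q3" "E q3 q4"
  shows "contains_wheel n E 10"
proof -
  obtain ts where ts: "distinct ts" "length ts = 2" "set ts \<subseteq> T"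
    using cT by (metis distinct_list_in order_refl)
  have "T \<inter> B = {}" using TB graph_onD(3)[OF G] by blast
  have tb: "E t b" "E b t" if "t \<in> set ts" "b \<in> B" for t b
  proof -
    have "t \<in> T" "b \<in> B" using that ts by auto
    then show "E t b" "E b t" using TB[of t b] graph_onD(4)[OF G, of t b] by auto
  qed
  have dist: "distinct (ts @ ps)" if "distinct ps" "set ps \<subseteq> B" for ps
    using that ts \<open>T \<inter> B = {}\<close> by auto
  have hub: "E c y" if "y \<in> set ts \<or> y \<in> B" for y using that ts c by auto
  obtain t1 t2 where [simp]: "ts = [t1,t2]"
    using ts(2) by (auto simp: length_Suc_conv numeral_eq_Suc)
  have "contains_wheel n E (length [t1,p1,p2,p3,p4,t2,q1,q2,q3,q4])"
    using dist[OF d] sub e by - (rule contains_wheelI[OF G, of _ c]; auto simp: tb hub)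
  then show ?thesis by (simp add: numeral_eq_Suc)
qed

text \<open>\<open>u\<close> closes the path to a cycle and \<open>c\<close> is the hub. In the
  application \<open>u\<close> and \<open>c\<close> are the ends of the edge inside
  \<open>R\<close>.\<close>

lemma path_plus_vertex_wheel:
  assumes G: "graph_on n E" and p: "has_path_on E S p" "0 < p"
    and u: "u \<notin> S" "\<And>s. s \<in> S \<Longrightarrow> E u s" and c: "E c u" "\<And>s. s \<in> S \<Longrightarrow> E c s"
  shows "contains_wheel n E (p + 1)"
proof -
  obtain f where f: "inj_on f {0..<p}" "\<forall>i<p. f i \<in> S" "\<forall>i. i + 1 < p \<longrightarrow> E (f i) (f (i + 1))"
    using p(1) unfolding has_path_on_def by blast
  define xs where "xs = map f [0..<p] @ [u]"
  have "successively E (xs @ [hd xs])"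
    unfolding successively_conv_nth
  proof (intro allI impI)
    fix i assume "Suc i < length (xs @ [hd xs])"
    then have i: "i < p + 1" unfolding xs_def by simp
    have hd: "hd xs = f 0" unfolding xs_def using p(2) by (simp add: hd_append hd_map)
    consider "Suc i < p" | "Suc i = p" | "i = p" using i by linarith
    then show "E ((xs @ [hd xs]) ! i) ((xs @ [hd xs]) ! Suc i)"
    proof cases
      case 1 then show ?thesis using f unfolding xs_def by (simp add: nth_append)
    next
      case 2 then show ?thesis using f u graph_onD(4)[OF G] unfolding xs_def by (simp add: nth_append)
    next
      case 3 then show ?thesis unfolding hd using f u p unfolding xs_def by (simp add: nth_append)
    qed
  qed
  moreover have "distinct xs" unfolding xs_def using f u by (auto simp: distinct_map)
  ultimately have "contains_wheel n E (length xs)"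
    using f c by (intro contains_wheelI[OF G, of _ c]) (auto simp: xs_def)
  then show ?thesis unfolding xs_def by simp
qed

section \<open>Replacing the neighbourhood of one vertex\<close>

definition reconnect :: "(nat \<Rightarrow> nat \<Rightarrow> bool) \<Rightarrow> nat \<Rightarrow> nat set \<Rightarrow> nat \<Rightarrow> nat \<Rightarrow> bool" where
  "reconnect E v S a b = (if a = v then b \<in> S else if b = v then a \<in> S else E a b)"

lemma graph_on_reconnect:
  "graph_on n E \<Longrightarrow> v < n \<Longrightarrow> S \<subseteq> {..<n} \<Longrightarrow> v \<notin> S \<Longrightarrow> graph_on n (reconnect E v S)"
  unfolding graph_on_def reconnect_def by (auto split: if_splits)

text \<open>A wheel has \<open>m + 1\<close> vertices. If it uses \<open>v\<close>, some
  \<open>v'\<close> off the wheel that sees all members of \<open>S\<close> on it can take the place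
  of \<open>v\<close>, which yields a wheel in the original graph.\<close>

lemma reconnect_wheel_free:
  assumes G: "graph_on n E" and free: "\<not> contains_wheel n E m" and v: "v \<notin> S" and m: "0 < m"
    and repl: "\<And>U. finite U \<Longrightarrow> card U \<le> m + 1 \<Longrightarrow> \<exists>v'. v' \<notin> insert v U \<and> v' < n \<and> (\<forall>t\<in>U \<inter> S. E v' t)"
  shows "\<not> contains_wheel n (reconnect E v S) m"
proof
  assume "contains_wheel n (reconnect E v S) m"
  then obtain c f where w: "c < n" "inj_on f {0..<m}"
    "\<And>i. i < m \<Longrightarrow> f i < n \<and> f i \<noteq> c \<and> reconnect E v S c (f i) \<and> reconnect E v S (f i) (f ((i + 1) mod m))"
    unfolding contains_wheel_def by blast
  define U where "U = insert c (f ` {0..<m})"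
  have "card (f ` {0..<m}) \<le> m" using card_image_le[of "{0..<m}" f] by simp
  then have "card U \<le> m + 1" unfolding U_def using card_insert_le_m1 by (auto simp: card_insert_if)
  moreover have "finite U" unfolding U_def by simp
  ultimately obtain v' where v': "v' \<notin> insert v U" "v' < n" "\<forall>t\<in>U \<inter> S. E v' t" using repl by blast
  define g where "g a = (if a = v then v' else a)" for a
  have inj: "inj_on g U" unfolding g_def inj_on_def using v' by auto
  have gE: "E (g a) (g b)" if "reconnect E v S a b" "a \<in> U" "b \<in> U" for a b
    using that v' v graph_onD(4)[OF G] unfolding reconnect_def g_def by (auto split: if_splits)
  have fU: "f i \<in> U" if "i < m" for i using that unfolding U_def by auto
  have cU: "c \<in> U" unfolding U_def by auto
  have "contains_wheel n E m" unfolding contains_wheel_def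
  proof (intro exI[of _ "g c"] exI[of _ "g \<circ> f"] conjI allI impI)
    show "g c < n" using w v' unfolding g_def by auto
    show "inj_on (g \<circ> f) {0..<m}"
      using w(2) inj by (intro comp_inj_on) (auto intro: inj_on_subset simp: U_def)
    fix i assume i: "i < m"
    have "(i + 1) mod m < m" using m by simp
    then show "E ((g \<circ> f) i) ((g \<circ> f) ((i + 1) mod m))" using gE w(3)[OF i] fU i by simp
    show *: "E (g c) ((g \<circ> f) i)" using gE w(3)[OF i] fU i cU by simp
    show "(g \<circ> f) i < n" "(g \<circ> f) i \<noteq> g c" using graph_onD[OF G *] by auto
  qed
  then show False using free by simp
qed

text \<open>Optimising the test vector at \<open>v\<close> alone makes the comparison meaningful even if
  the entry at \<open>v\<close> vanishes.\<close>

lemma reconnect_spectral: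
  assumes G: "graph_on n E" and v: "v < n" "v \<notin> S" "S \<subseteq> {..<n}"
    and x0: "\<And>i. 0 \<le> x i" and lam: "0 < \<rho>"
    and eig: "\<And>i. i < n \<Longrightarrow> sum x {j. E i j} = \<rho> * x i"
    and le: "spectral_radius n (reconnect E v S) \<le> \<rho>"
  shows "sum x S \<le> \<rho> * x v"
proof -
  let ?E = "reconnect E v S"
  have G': "graph_on n ?E" using G v by (intro graph_on_reconnect)
  have fin: "finite S" using v(3) finite_subset by blast
  define s where "s = sum x S"
  \<comment> \<open>This value maximises \<open>2 * t * s - \<rho> * t\<^sup>2\<close>, the part of
    the comparison that depends on the new entry at \<open>v\<close>.\<close>
  define t where "t = s / \<rho>"
  define y where "y = x(v := t)"
  define X where "X = (\<Sum>i\<in>{..<n}-{v}. (x i)\<^sup>2)"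
  have nv: "sum y {j. ?E i j} = sum x {j. E i j} - (if E i v then x v else 0) + (if i \<in> S then t else 0)"
    if i: "i \<noteq> v" for i
  proof -
    have fE: "finite {j. E i j}" "finite {j. ?E i j}" using G G' by (auto intro: finite_nbrs)
    have mem: "v \<in> {j. ?E i j} \<longleftrightarrow> i \<in> S" "y v = t" using i by (auto simp: reconnect_def y_def)
    have "sum y {j. ?E i j} = sum y ({j. ?E i j} - {v}) + (if i \<in> S then t else 0)"
      using sum.remove[OF fE(2), of v y] mem by (cases "i \<in> S") auto
    also have "{j. ?E i j} - {v} = {j. E i j} - {v}" using i by (auto simp: reconnect_def)
    also have "sum y ({j. E i j} - {v}) = sum x ({j. E i j} - {v})"
      unfolding y_def by (intro sum.cong) auto
    also have "\<dots> = sum x {j. E i j} - (if E i v then x v else 0)"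
      using fE by (auto simp: sum_diff1)
    finally show ?thesis .
  qed
  have sv: "sum y {j. ?E v j} = s"
  proof -
    have "{j. ?E v j} = S" by (auto simp: reconnect_def)
    moreover have "sum y S = s" unfolding y_def s_def using v by (intro sum.cong) auto
    ultimately show ?thesis by simp
  qed
  have I: "{..<n} = insert v ({..<n} - {v})" using v by auto
  have split: "(\<Sum>i<n. h i) = h v + (\<Sum>i\<in>{..<n}-{v}. h i)" for h :: "nat \<Rightarrow> real"
    using v by (subst I, subst sum.insert) auto
  have sym: "E i v \<longleftrightarrow> E v i" for i using graph_onD(4)[OF G] by blast
  have e1: "(\<Sum>i\<in>{..<n}-{v}. x i * (if E i v then x v else 0)) = \<rho> * (x v)\<^sup>2"
  proof -
    have "(\<Sum>i\<in>{..<n}-{v}. x i * (if E i v then x v else 0)) = (\<Sum>i\<in>({..<n}-{v}) \<inter> {i. E v i}. x i * x v)"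
      by (subst sum.inter_restrict) (auto intro!: sum.cong simp: sym split: if_splits)
    also have "({..<n}-{v}) \<inter> {i. E v i} = {i. E v i}" by (auto dest: graph_onD[OF G])
    finally show ?thesis using eig[OF v(1)]
      by (simp add: sum_distrib_right[symmetric] power2_eq_square)
  qed
  have e2: "(\<Sum>i\<in>{..<n}-{v}. x i * (if i \<in> S then t else 0)) = t * s"
  proof -
    have "(\<Sum>i\<in>{..<n}-{v}. x i * (if i \<in> S then t else 0)) = (\<Sum>i\<in>({..<n}-{v}) \<inter> S. x i * t)"
      by (subst sum.inter_restrict) (auto intro!: sum.cong split: if_splits)
    also have "({..<n}-{v}) \<inter> S = S" using v by auto
    finally show ?thesis by (simp add: sum_distrib_right[symmetric] s_def)
  qed
  have "(\<Sum>i<n. y i * sum y {j. ?E i j}) = t * s + (\<Sum>i\<in>{..<n}-{v}. x i * sum y {j. ?E i j})"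
    by (subst split) (simp add: sv, simp add: y_def)
  also have "(\<Sum>i\<in>{..<n}-{v}. x i * sum y {j. ?E i j}) =
     (\<Sum>i\<in>{..<n}-{v}. \<rho> * (x i)\<^sup>2 - x i * (if E i v then x v else 0) + x i * (if i \<in> S then t else 0))"
    by (intro sum.cong) (auto simp: nv eig power2_eq_square algebra_simps)
  also have "\<dots> = \<rho> * X - \<rho> * (x v)\<^sup>2 + t * s"
    unfolding sum.distrib sum_subtractf e1 e2 X_def by (simp add: sum_distrib_left)
  finally have q: "(\<Sum>i<n. y i * sum y {j. ?E i j}) = 2 * t * s + \<rho> * X - \<rho> * (x v)\<^sup>2" by simp
  have y2: "(\<Sum>i<n. (y i)\<^sup>2) = t\<^sup>2 + X"
    by (subst split) (simp add: X_def y_def)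
  have "X \<ge> 0" unfolding X_def by (rule sum_nonneg) simp
  have "2 * t * s + \<rho> * X - \<rho> * (x v)\<^sup>2 \<le> spectral_radius n ?E * (t\<^sup>2 + X)"
    using rayleigh[OF G', of y] v unfolding q y2 by auto
  also have "\<dots> \<le> \<rho> * (t\<^sup>2 + X)" using le \<open>X \<ge> 0\<close> by (intro mult_right_mono) auto
  finally have "2 * t * s - \<rho> * (x v)\<^sup>2 \<le> \<rho> * t\<^sup>2" by (simp add: algebra_simps)
  moreover have "s = \<rho> * t" unfolding t_def using lam by simp
  ultimately have "\<rho> * t\<^sup>2 \<le> \<rho> * (x v)\<^sup>2" by (simp add: power2_eq_square algebra_simps)
  then have "t\<^sup>2 \<le> (x v)\<^sup>2" using lam by simp
  then have "t \<le> x v" using x0[of v] by (rule power2_le_imp_le)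
  then show ?thesis unfolding t_def s_def[symmetric] using lam by (simp add: field_simps)
qed

text \<open>Extremality forbids any gain from giving \<open>v\<close> the neighbourhood
  \<open>S\<close>, and this bounds the entry at \<open>v\<close> from below by the weight of
  \<open>S\<close>.\<close>

lemma spex_reconnect:
  assumes S: "SPEX_wheel k n E" and k: "0 < k" and v: "v < n" "v \<notin> S" "S \<subseteq> {..<n}"
    and x0: "\<And>i. 0 \<le> x i" and lam: "0 < spectral_radius n E"
    and eig: "\<And>i. i < n \<Longrightarrow> sum x {j. E i j} = spectral_radius n E * x i"
    and repl: "\<And>U. finite U \<Longrightarrow> card U \<le> 2 * k + 1 \<Longrightarrow>
      \<exists>v'. v' \<notin> insert v U \<and> v' < n \<and> (\<forall>t\<in>U \<inter> S. E v' t)"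
  shows "sum x S \<le> spectral_radius n E * x v"
proof -
  have G: "graph_on n E" and F: "\<not> contains_wheel n E (2 * k)"
    and M: "\<And>E'. graph_on n E' \<Longrightarrow> \<not> contains_wheel n E' (2 * k) \<Longrightarrow> spectral_radius n E' \<le> spectral_radius n E"
    using S unfolding SPEX_wheel_def odd_wheel_free_def by auto
  have "\<not> contains_wheel n (reconnect E v S) (2 * k)"
    using reconnect_wheel_free[OF G F v(2) _ repl] k by simp
  then have "spectral_radius n (reconnect E v S) \<le> spectral_radius n E"
    using M graph_on_reconnect[OF G v(1) v(3) v(2)] by blast
  then show ?thesis using reconnect_spectral[OF G v x0 lam eig] by blast
qed

section \<open>A lower bound for the extremal spectral radius\<close>

text \<open>The labelling \<open>c\<close> is constant along edges, so every component lies in one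
  label class; bounding the classes bounds the components without a notion of connectivity.\<close>

definition small_component_regular :: "nat \<Rightarrow> nat \<Rightarrow> nat \<Rightarrow> bool" where
  "small_component_regular d m l \<longleftrightarrow> (\<exists>H c. (\<forall>u v. H u v \<longrightarrow> u < l \<and> v < l \<and> u \<noteq> v \<and> H v u \<and> c u = c v) \<and>
     (\<forall>u<l. card {v. H u v} = d) \<and> (\<forall>u<l. card {v. v < l \<and> c v = (c u :: nat)} \<le> m))"

lemma small_component_regular_0: "small_component_regular d m 0"
  unfolding small_component_regular_def by (intro exI[of _ "\<lambda>_ _. False"]) auto

text \<open>The new block is the complete multipartite graph on \<open>b\<close> vertices whose
  parts are the residue classes mod \<open>p\<close>. Its regularity is phrased with lists so that
  it can be evaluated for each concrete block.\<close>

lemma small_component_regular_add: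
  assumes "small_component_regular d m l" and b: "b \<le> m"
    and deg: "list_all (\<lambda>i. length (filter (\<lambda>w. w mod p \<noteq> i mod p) [0..<b]) = d) [0..<b]"
  shows "small_component_regular d m (l + b)"
proof -
  obtain H c where H: "\<And>u v. H u v \<Longrightarrow> u < l \<and> v < l \<and> u \<noteq> v \<and> H v u \<and> c u = c v"
    and d: "\<And>u. u < l \<Longrightarrow> card {v. H u v} = d"
    and m: "\<And>u. u < l \<Longrightarrow> card {v. v < l \<and> c v = (c u :: nat)} \<le> m"
    using assms(1) unfolding small_component_regular_def by blast
  define H' where "H' u v \<longleftrightarrow> H u v \<or> (l \<le> u \<and> u < l + b \<and> l \<le> v \<and> v < l + b \<and> (u - l) mod p \<noteq> (v - l) mod p)" for u v
  \<comment> \<open>Old labels move up by one, which frees 0 for the new block.\<close>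
  define c' where "c' u = (if u < l then Suc (c u) else 0)" for u
  have 1: "u < l + b \<and> v < l + b \<and> u \<noteq> v \<and> H' v u \<and> c' u = c' v" if "H' u v" for u v
    using that unfolding H'_def c'_def by (auto dest: H)
  have 2: "card {v. H' u v} = d" if u: "u < l + b" for u
  proof (cases "u < l")
    case True
    then have "{v. H' u v} = {v. H u v}" unfolding H'_def by auto
    then show ?thesis using d True by simp
  next
    case False
    have "{v. H' u v} = (+) l ` set (filter (\<lambda>w. w mod p \<noteq> (u - l) mod p) [0..<b])"
    proof (intro equalityI subsetI)
      fix v assume "v \<in> {v. H' u v}"
      then have v: "l \<le> v" "v < l + b" "(u - l) mod p \<noteq> (v - l) mod p"
        using False unfolding H'_def by (auto dest: H)
      then show "v \<in> (+) l ` set (filter (\<lambda>w. w mod p \<noteq> (u - l) mod p) [0..<b])"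
        by (intro image_eqI[of _ _ "v - l"]) auto
    qed (use u False in \<open>auto simp: H'_def\<close>)
    then have "card {v. H' u v} = card (set (filter (\<lambda>w. w mod p \<noteq> (u - l) mod p) [0..<b]))"
      by (simp add: card_image)
    also have "\<dots> = length (filter (\<lambda>w. w mod p \<noteq> (u - l) mod p) [0..<b])"
      by (rule distinct_card) simp
    also have "\<dots> = d" using deg u False by (auto simp: list_all_iff)
    finally show ?thesis .
  qed
  have 3: "card {v. v < l + b \<and> c' v = c' u} \<le> m" if u: "u < l + b" for u
  proof (cases "u < l")
    case True
    then have "{v. v < l + b \<and> c' v = c' u} = {v. v < l \<and> c v = c u}" unfolding c'_def by auto
    then show ?thesis using m True by simp
  next
    case False
    then have "{v. v < l + b \<and> c' v = c' u} = {l..<l + b}" unfolding c'_def by auto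
    then show ?thesis using b by simp
  qed
  show ?thesis unfolding small_component_regular_def using 1 2 3 by blast
qed

text \<open>The blocks are \<open>K\<^sub>4\<close> and \<open>K\<^sub>3\<^sub>,\<^sub>3\<close> for degree 3, and the octahedron and \<open>K\<^sub>4\<^sub>,\<^sub>4\<close> for degree 4.\<close>

lemma small_component_regular_even:
  assumes k: "k \<in> {4, 5}" and "even l" "12 \<le> l"
  shows "small_component_regular (k - 1) (2 * k - 2) l"
proof -
  let ?P = "small_component_regular (k - 1) (2 * k - 2)"
  have 6: "?P (l + 6)" if "?P l" for l
  proof -
    from k consider "k = 4" | "k = 5" by auto
    then show ?thesis
    proof cases
      case 1
      have "list_all (\<lambda>i. length (filter (\<lambda>w. w mod 2 \<noteq> i mod 2) [0..<6]) = 3) [0..<6]" by (simp add: upt_rec)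
      then show ?thesis using small_component_regular_add[OF that, of 6 2] 1 by simp
    next
      case 2
      have "list_all (\<lambda>i. length (filter (\<lambda>w. w mod 3 \<noteq> i mod 3) [0..<6]) = 4) [0..<6]" by (simp add: upt_rec)
      then show ?thesis using small_component_regular_add[OF that, of 6 3] 2 by simp
    qed
  qed
  have P12: "?P 12" using 6[OF 6[OF small_component_regular_0]] by simp
  \<comment> \<open>For \<open>k = 4\<close>, 14 = 6 + 4 + 4 and 16 = 12 + 4; for
    \<open>k = 5\<close>, 14 = 6 + 8 and 16 = 8 + 8. Together with 12 = 6 + 6 these start an
    induction in steps of 6.\<close>
  have P1416: "?P 14 \<and> ?P 16"
  proof -
    from k consider "k = 4" | "k = 5" by auto
    then show ?thesis
    proof cases
      case 1
      have "list_all (\<lambda>i. length (filter (\<lambda>w. w mod 4 \<noteq> i mod 4) [0..<4]) = 3) [0..<4]" by (simp add: upt_rec)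
      then have 4: "?P (l + 4)" if "?P l" for l using small_component_regular_add[OF that, of 4 4] 1 by simp
      show ?thesis using 4[OF 4[OF 6[OF small_component_regular_0]]] 4[OF P12] by simp
    next
      case 2
      have "list_all (\<lambda>i. length (filter (\<lambda>w. w mod 2 \<noteq> i mod 2) [0..<8]) = 4) [0..<8]" by (simp add: upt_rec)
      then have 8: "?P (l + 8)" if "?P l" for l using small_component_regular_add[OF that, of 8 2] 2 by simp
      show ?thesis using 8[OF 6[OF small_component_regular_0]] 8[OF 8[OF small_component_regular_0]] by simp
    qed
  qed
  show ?thesis using \<open>even l\<close> \<open>12 \<le> l\<close>
  proof (induction l rule: less_induct)
    case (less l)
    show ?case
    proof (cases "18 \<le> l")
      case True
      then have "?P (l - 6)" using less by (intro less.IH) auto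
      from 6[OF this] True show ?thesis by simp
    next
      case False
      then have "l = 12 \<or> l = 14 \<or> l = 16" using less.prems by presburger
      then show ?thesis using P12 P1416 by blast
    qed
  qed
qed

section \<open>The comparison graph: a join with one additional edge\<close>

definition join_one_edge :: "(nat \<Rightarrow> nat \<Rightarrow> bool) \<Rightarrow> nat \<Rightarrow> nat \<Rightarrow> nat \<Rightarrow> nat \<Rightarrow> bool" where
  "join_one_edge H l n u v \<longleftrightarrow> H u v \<or> (u < l \<and> l \<le> v \<and> v < n) \<or> (v < l \<and> l \<le> u \<and> u < n) \<or>
     (u = l \<and> v = l + 1) \<or> (u = l + 1 \<and> v = l)"

lemma graph_on_join_one_edge:
  assumes "\<And>u v. H u v \<Longrightarrow> u < l \<and> v < l \<and> u \<noteq> v \<and> H v u" "l + 2 \<le> n"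
  shows "graph_on n (join_one_edge H l n)"
  using assms unfolding graph_on_def join_one_edge_def by fastforce

text \<open>If the hub is at least \<open>l\<close>, at most one rim vertex is, and the remaining
  ones contain a path on \<open>2 * k - 1\<close> vertices inside a class of size at most
  \<open>2 * k - 2\<close>. If the hub is below \<open>l\<close>, at most \<open>k - 1\<close> rim
  vertices are, and they meet at most \<open>2 * k - 2\<close> rim edges; the other two or more
  would all have to be the single additional edge.\<close>

lemma join_one_edge_wheel_free:
  assumes H: "\<And>u v. H u v \<Longrightarrow> u < l \<and> v < l \<and> u \<noteq> v \<and> H v u \<and> c u = c v"
    and k: "2 \<le> k"
    and d: "\<And>u. u < l \<Longrightarrow> card {v. H u v} \<le> k - 1"
    and m: "\<And>u. u < l \<Longrightarrow> card {v. v < l \<and> c v = (c u :: nat)} \<le> 2 * k - 2"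
  shows "\<not> contains_wheel n (join_one_edge H l n) (2 * k)"
proof
  let ?E = "join_one_edge H l n" and ?m = "2 * k"
  assume "contains_wheel n ?E ?m"
  then obtain h f where w: "h < n" "inj_on f {0..<?m}"
    "\<And>i. i < ?m \<Longrightarrow> f i < n \<and> f i \<noteq> h \<and> ?E h (f i) \<and> ?E (f i) (f ((i + 1) mod ?m))"
    unfolding contains_wheel_def by blast
  have m0: "0 < ?m" using k by simp
  have Hl: "u < l" "v < l" if "H u v" for u v using H that by blast+
  show False
  proof (cases "l \<le> h")
    case True
    \<comment> \<open>Indexing the rim periodically by all naturals allows reading it from any
      starting point.\<close>
    define g where "g i = f (i mod ?m)" for i
    have gh: "?E h (g i)" for i unfolding g_def using w(3) m0 by simp
    have gg: "?E (g i) (g (Suc i))" for i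
    proof -
      have "?E (f (i mod ?m)) (f ((i mod ?m + 1) mod ?m))" using w(3)[of "i mod ?m"] m0 by simp
      then show ?thesis unfolding g_def by (simp add: mod_Suc_eq)
    qed
    have ginj: "i mod ?m = j mod ?m" if "g i = g j" for i j
      using inj_onD[OF w(2), of "i mod ?m" "j mod ?m"] that m0 unfolding g_def by simp
    \<comment> \<open>The only possible rim vertex from \<open>l\<close> on is the partner of
      \<open>h\<close> on the additional edge; \<open>l\<close> is a default when \<open>h\<close>
      is not on that edge.\<close>
    define z where "z = (if h = l then l + 1 else l)"
    have gz: "g i < l \<or> g i = z" for i
      using gh[of i] True unfolding join_one_edge_def z_def by (auto dest: Hl)
    have window: "i = i'" if "j < i" "i < j + ?m" "j < i'" "i' < j + ?m" "i mod ?m = i' mod ?m" for i i' j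
    proof (rule ccontr)
      assume "i \<noteq> i'"
      have *: False if "a < b" "b < a + ?m" "b mod ?m = a mod ?m" for a b
      proof -
        have "?m dvd b - a" using that mod_eq_dvd_iff_nat[of a b ?m] by simp
        then show False using that by (auto dest: dvd_imp_le)
      qed
      show False using *[of i i'] *[of i' i] that \<open>i \<noteq> i'\<close> by linarith
    qed
    \<comment> \<open>\<open>j\<close> is a position of \<open>z\<close> if \<open>z\<close> is on
      the rim, so that the next \<open>2 * k - 1\<close> positions avoid it; otherwise any
      \<open>j\<close> will do.\<close>
    obtain j where j: "\<And>i. j < i \<Longrightarrow> i < j + ?m \<Longrightarrow> g i < l"
    proof (cases "\<exists>j. g j = z")
      case True
      then obtain j where j: "g j = z" by blast
      have "g i < l" if "j < i" "i < j + ?m" for i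
      proof (rule ccontr)
        assume "\<not> g i < l"
        then have "i mod ?m = j mod ?m" using gz[of i] j ginj[of i j] by simp
        then have "?m dvd i - j" using that mod_eq_dvd_iff_nat[of j i ?m] by simp
        then show False using that by (auto dest: dvd_imp_le)
      qed
      then show thesis using that by blast
    next
      case False
      then show thesis using gz that by metis
    qed
    have cg: "c (g (Suc j + i)) = c (g (Suc j))" if "i < ?m - 1" for i
      using that
    proof (induction i)
      case (Suc i)
      have "g (Suc j + i) < l" "g (Suc (Suc j + i)) < l" using Suc.prems by (auto intro!: j)
      then have "H (g (Suc j + i)) (g (Suc (Suc j + i)))"
        using gg[of "Suc j + i"] unfolding join_one_edge_def by auto
      then show ?case using Suc H by simp
    qed simp
    have "g ` {j<..<j + ?m} \<subseteq> {v. v < l \<and> c v = c (g (Suc j))}"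
    proof safe
      fix i assume i: "i \<in> {j<..<j + ?m}"
      then show "g i < l" using j by simp
      show "c (g i) = c (g (Suc j))" using cg[of "i - Suc j"] i by fastforce
    qed
    then have "card (g ` {j<..<j + ?m}) \<le> card {v. v < l \<and> c v = c (g (Suc j))}"
      by (intro card_mono) auto
    moreover have "inj_on g {j<..<j + ?m}"
      using ginj window by (intro inj_onI) (metis greaterThanLessThan_iff)
    moreover have "g (Suc j) < l" using j k by simp
    ultimately show False using m[of "g (Suc j)"] k by (simp add: card_image)
  next
    case False
    \<comment> \<open>Rim edges are indexed by their first end: \<open>I\<close> and
      \<open>I'\<close> collect those with first, respectively second, end below \<open>l\<close>,
      and \<open>J\<close> the rest. The first two have at most \<open>k - 1\<close> members
      each.\<close>
    define I where "I = {i. i < ?m \<and> f i < l}"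
    define I' where "I' = {i. i < ?m \<and> f ((i + 1) mod ?m) < l}"
    define J where "J = {i. i < ?m \<and> l \<le> f i \<and> l \<le> f ((i + 1) mod ?m)}"
    have fin: "finite I" "finite I'" "finite J" unfolding I_def I'_def J_def by auto
    have "H h (f i)" if "i \<in> I" for i
      using w(3)[of i] False that unfolding I_def join_one_edge_def by auto
    then have "f ` I \<subseteq> {v. H h v}" by blast
    moreover have "finite {v. H h v}" by (rule finite_subset[of _ "{..<l}"]) (auto dest: Hl)
    moreover have "inj_on f I" using w(2) by (rule inj_on_subset) (auto simp: I_def)
    ultimately have "card I \<le> card {v. H h v}" by (metis card_inj_on_le)
    then have cI: "card I \<le> k - 1" using d[of h] False by simp
    have "inj_on (\<lambda>i. (i + 1) mod ?m) I'"
      unfolding inj_on_def I'_def by (auto simp: mod_Suc split: if_splits)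
    moreover have "(\<lambda>i. (i + 1) mod ?m) ` I' \<subseteq> I" using m0 unfolding I_def I'_def by auto
    ultimately have cI': "card I' \<le> card I" using fin by (metis card_inj_on_le)
    have "{..<?m} = I \<union> I' \<union> J" unfolding I_def I'_def J_def by auto
    then have "?m \<le> card I + card I' + card J"
      by (metis (no_types, lifting) card_Un_le card_lessThan le_trans add_le_mono1)
    then have "2 \<le> card J" using cI cI' k by linarith
    then obtain i j where ij: "i \<in> J" "j \<in> J" "i \<noteq> j"
      by (metis card_le_Suc0_iff_eq fin(3) not_less_eq_eq numeral_2_eq_2)
    have edge: "(f i = l \<and> f ((i + 1) mod ?m) = l + 1) \<or> (f i = l + 1 \<and> f ((i + 1) mod ?m) = l)" if "i \<in> J" for i
      using that w(3)[of i] Hl[of "f i" "f ((i + 1) mod ?m)"] unfolding J_def join_one_edge_def by auto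
    have feq: "a = b" if "f a = f b" "a < ?m" "b < ?m" for a b
      using inj_onD[OF w(2), of a b] that by simp
    have lt: "i < ?m" "j < ?m" "(i + 1) mod ?m < ?m" "(j + 1) mod ?m < ?m"
      using ij m0 unfolding J_def by auto
    have "f i \<noteq> f j" using feq[of i j] ij lt by blast
    then have "f j = f ((i + 1) mod ?m) \<and> f i = f ((j + 1) mod ?m)"
      using edge[OF ij(1)] edge[OF ij(2)] by auto
    then have "j = (i + 1) mod ?m" "i = (j + 1) mod ?m"
      using feq[of j "(i + 1) mod ?m"] feq[of i "(j + 1) mod ?m"] lt by auto
    then show False using lt k by (auto simp: mod_Suc split: if_splits)
  qed
qed

text \<open>The test vector is constant on each side; the summand \<open>2 * \<beta>\<^sup>2\<close>
  is the contribution of the additional edge.\<close>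

lemma join_one_edge_rayleigh:
  fixes \<alpha> \<beta> :: real
  assumes H: "\<And>u v. H u v \<Longrightarrow> u < l \<and> v < l \<and> u \<noteq> v \<and> H v u"
    and d: "\<And>u. u < l \<Longrightarrow> card {v. H u v} = d" and n: "l + 2 \<le> n"
  shows "d * l * \<alpha>\<^sup>2 + 2 * l * (real n - l) * \<alpha> * \<beta> + 2 * \<beta>\<^sup>2
     \<le> spectral_radius n (join_one_edge H l n) * (l * \<alpha>\<^sup>2 + (real n - l) * \<beta>\<^sup>2)"
proof -
  let ?E = "join_one_edge H l n"
  define y where "y i = (if i < l then \<alpha> else \<beta>)" for i
  have G: "graph_on n ?E" using H n by (intro graph_on_join_one_edge) blast+
  have split: "(\<Sum>i<n. h i) = (\<Sum>i<l. h i) + h l + h (l + 1) + (\<Sum>i\<in>{l + 2..<n}. h i)" for h :: "nat \<Rightarrow> real"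
  proof -
    have "{..<n} = {..<l} \<union> {l, l + 1} \<union> {l + 2..<n}" using n by auto
    then have "(\<Sum>i<n. h i) = sum h ({..<l} \<union> {l, l + 1} \<union> {l + 2..<n})" by simp
    also have "\<dots> = sum h ({..<l} \<union> {l, l + 1}) + sum h {l + 2..<n}"
      by (rule sum.union_disjoint) auto
    also have "sum h ({..<l} \<union> {l, l + 1}) = sum h {..<l} + sum h {l, l + 1}"
      by (rule sum.union_disjoint) auto
    finally show ?thesis by simp
  qed
  have sL: "sum y {j. ?E i j} = d * \<alpha> + (real n - l) * \<beta>" if "i < l" for i
  proof -
    have fin: "finite {j. H i j}" by (rule finite_subset[of _ "{..<l}"]) (auto dest: H)
    have "{j. ?E i j} = {j. H i j} \<union> {l..<n}" using that unfolding join_one_edge_def by (auto dest: H)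
    moreover have "{j. H i j} \<inter> {l..<n} = {}" by (auto dest: H)
    ultimately have "sum y {j. ?E i j} = sum y {j. H i j} + sum y {l..<n}"
      using fin by (simp add: sum.union_disjoint)
    also have "sum y {j. H i j} = sum (\<lambda>_. \<alpha>) {j. H i j}"
      unfolding y_def by (intro sum.cong) (auto dest: H)
    also have "sum y {l..<n} = sum (\<lambda>_. \<beta>) {l..<n}" unfolding y_def by (intro sum.cong) auto
    finally show ?thesis using d[OF that] n by (simp add: of_nat_diff)
  qed
  have sLs: "sum y {..<l} = l * \<alpha>" unfolding y_def by simp
  have s1: "sum y {j. ?E l j} = l * \<alpha> + \<beta>"
  proof -
    have "{j. ?E l j} = insert (l + 1) {..<l}" using n unfolding join_one_edge_def by (auto dest: H)
    then show ?thesis using sLs by (simp add: y_def)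
  qed
  have s2: "sum y {j. ?E (l + 1) j} = l * \<alpha> + \<beta>"
  proof -
    have "{j. ?E (l + 1) j} = insert l {..<l}" using n unfolding join_one_edge_def by (auto dest: H)
    then show ?thesis using sLs by (simp add: y_def)
  qed
  have s3: "sum y {j. ?E i j} = l * \<alpha>" if "i \<in> {l + 2..<n}" for i
  proof -
    have "{j. ?E i j} = {..<l}" using n that unfolding join_one_edge_def by (auto dest: H)
    then show ?thesis using sLs by simp
  qed
  have "(\<Sum>i<n. y i * sum y {j. ?E i j}) = l * (\<alpha> * (d * \<alpha> + (real n - l) * \<beta>)) +
     \<beta> * (l * \<alpha> + \<beta>) + \<beta> * (l * \<alpha> + \<beta>) + (real n - l - 2) * (\<beta> * (l * \<alpha>))"
    unfolding split s1 s2 using n by (simp add: sL s3 of_nat_diff) (simp add: y_def)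
  also have "\<dots> = d * l * \<alpha>\<^sup>2 + 2 * l * (real n - l) * \<alpha> * \<beta> + 2 * \<beta>\<^sup>2"
    by (simp add: algebra_simps power2_eq_square)
  finally have 1: "(\<Sum>i<n. y i * sum y {j. ?E i j}) = \<dots>" .
  have "(\<Sum>i<n. (y i)\<^sup>2) = l * \<alpha>\<^sup>2 + \<beta>\<^sup>2 + \<beta>\<^sup>2 + (real n - l - 2) * \<beta>\<^sup>2"
    unfolding split using n by (simp add: y_def of_nat_diff)
  also have "\<dots> = l * \<alpha>\<^sup>2 + (real n - l) * \<beta>\<^sup>2" by (simp add: algebra_simps)
  finally have 2: "(\<Sum>i<n. (y i)\<^sup>2) = \<dots>" .
  show ?thesis using rayleigh[OF G, of y] n unfolding 1 2 by simp
qed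

text \<open>The loss of 1 pays for making the regular side even, and the term
  \<open>(real n - 2) / r\<close>, which is close to 2, comes from the additional edge. The
  remaining margin of about 1 drives all later contradictions.\<close>

lemma spex_spectral_lower:
  assumes S: "SPEX_wheel k n E" and k: "k \<in> {4, 5}" and n: "26 \<le> n"
  defines "r \<equiv> spectral_radius n E"
  shows "0 < r" "(real n)\<^sup>2 / 4 - 1 + (real n - 2) / r \<le> r\<^sup>2 - (real k - 1) * r"
proof -
  \<comment> \<open>An even number within 1 of \<open>n / 2\<close>, as the block construction needs
    an even order.\<close>
  define l where "l = 2 * ((n + 2) div 4)"
  have "even l" unfolding l_def by simp
  have "12 \<le> l" "l + 2 \<le> n" unfolding l_def using n by presburger+
  have l1: "2 * real l \<le> n + 2" "n \<le> 2 * real l + 2"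
  proof -
    have "2 * l \<le> n + 2" "n \<le> 2 * l + 2" unfolding l_def by presburger+
    then show "2 * real l \<le> n + 2" "n \<le> 2 * real l + 2" by linarith+
  qed
  have l2: "(real n)\<^sup>2 / 4 - 1 \<le> l * (real n - l)"
  proof -
    have "(2 * real l - n)\<^sup>2 \<le> 2\<^sup>2" by (rule power2_le_iff_abs_le[THEN iffD2]) (use l1 in auto)
    then show ?thesis by (simp add: power2_eq_square field_simps)
  qed
  obtain H c where H: "\<And>u v. H u v \<Longrightarrow> u < l \<and> v < l \<and> u \<noteq> v \<and> H v u \<and> c u = c v"
    and d: "\<And>u. u < l \<Longrightarrow> card {v. H u v} = k - 1"
    and m: "\<And>u. u < l \<Longrightarrow> card {v. v < l \<and> c v = (c u :: nat)} \<le> 2 * k - 2"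
    using small_component_regular_even[OF k \<open>even l\<close> \<open>12 \<le> l\<close>]
    unfolding small_component_regular_def by blast
  let ?E = "join_one_edge H l n"
  have "graph_on n ?E" using H \<open>l + 2 \<le> n\<close> by (intro graph_on_join_one_edge) blast+
  moreover have "\<not> contains_wheel n ?E (2 * k)"
    by (rule join_one_edge_wheel_free[of H l c]) (use H k d m in auto)
  ultimately have le: "spectral_radius n ?E \<le> r"
    using S unfolding SPEX_wheel_def odd_wheel_free_def r_def by blast
  have ray: "real (k - 1) * l * \<alpha>\<^sup>2 + 2 * l * (real n - l) * \<alpha> * \<beta> + 2 * \<beta>\<^sup>2
     \<le> r * (l * \<alpha>\<^sup>2 + (real n - l) * \<beta>\<^sup>2)" for \<alpha> \<beta> :: real
  proof -
    have "0 \<le> l * \<alpha>\<^sup>2 + (real n - l) * \<beta>\<^sup>2" using \<open>l + 2 \<le> n\<close> by simp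
    from mult_right_mono[OF le this] show ?thesis
      using join_one_edge_rayleigh[of H l "k - 1" n \<alpha> \<beta>] H d \<open>l + 2 \<le> n\<close> by force
  qed
  have "0 < real (k - 1) * l + 2 * l * (real n - l) + 2"
    using \<open>l + 2 \<le> n\<close> by (intro add_nonneg_pos add_nonneg_nonneg mult_nonneg_nonneg) auto
  also have "\<dots> \<le> r * (l + (real n - l))" using ray[of 1 1] by simp
  finally have "0 < r * (l + (real n - l))" .
  then show r: "0 < r" using n by (simp add: zero_less_mult_iff)
  have km: "real (k - 1) * r = (real k - 1) * r" using k by auto
  \<comment> \<open>The test entries \<open>r\<close> and \<open>l\<close> obey
    \<open>r * \<beta> = l * \<alpha>\<close>, the eigenvalue equation at a vertex of the second
    side off the additional edge.\<close>
  have "(real (k - 1) * r + l * (real n - l) + 2 * l / r) * (l * r) \<le> r\<^sup>2 * (l * r)"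
    using ray[of r l] r by (simp add: algebra_simps power2_eq_square)
  then have "real (k - 1) * r + l * (real n - l) + 2 * l / r \<le> r\<^sup>2"
    using r \<open>12 \<le> l\<close> by (simp add: mult_le_cancel_right)
  moreover have "(real n - 2) / r \<le> 2 * l / r" using r l1 by (intro divide_right_mono) auto
  ultimately show "(real n)\<^sup>2 / 4 - 1 + (real n - 2) / r \<le> r\<^sup>2 - (real k - 1) * r"
    using l2 km by linarith
qed

section \<open>Stability\<close>

lemma sum_card_swap:
  assumes "finite A" "finite B"
  shows "(\<Sum>a\<in>A. card {b \<in> B. P a b}) = (\<Sum>b\<in>B. card {a \<in> A. P a b})"
proof -
  have "(\<Sum>a\<in>A. card {b \<in> B. P a b}) = (\<Sum>a\<in>A. \<Sum>b\<in>B. if P a b then 1 else 0)"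
    using assms by (simp add: sum.If_cases Int_def)
  also have "\<dots> = (\<Sum>b\<in>B. \<Sum>a\<in>A. if P a b then 1 else 0)" by (rule sum.swap)
  also have "\<dots> = (\<Sum>b\<in>B. card {a \<in> A. P a b})"
    using assms by (simp add: sum.If_cases Int_def)
  finally show ?thesis .
qed

text \<open>A qualitative Kovari--Sos--Turan theorem. Among boundedly many vertices of linear degree,
  linearly many vertices see at least \<open>k\<close> of them, and many of those see the same subset.\<close>

lemma dense_contains_complete_bipartite:
  fixes \<epsilon> :: real
  assumes eps: "0 < \<epsilon>" and k: "0 < k"
  shows "\<exists>n0. \<forall>n\<ge>n0. \<forall>E H. graph_on n E \<and> H \<subseteq> {..<n} \<and>
     \<epsilon> * (real n)\<^sup>2 \<le> (\<Sum>u\<in>H. real (card {w \<in> H. E u w})) \<longrightarrow>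
     (\<exists>A\<subseteq>H. \<exists>B\<subseteq>H. card A = k \<and> card B = k \<and> (\<forall>a\<in>A. \<forall>b\<in>B. E a b))"
proof -
  \<comment> \<open>\<open>M\<close> vertices of degree at least \<open>\<epsilon> / 2 * n\<close>
    send out at least \<open>2 * k * n\<close> edges, twice what can end in vertices receiving fewer
    than \<open>k\<close> of them.\<close>
  define M where "M = nat \<lceil>4 * k / \<epsilon>\<rceil>"
  have M: "4 * k / \<epsilon> \<le> M" unfolding M_def by linarith
  then have M4: "4 * k \<le> M * \<epsilon>" using eps by (simp add: field_simps)
  have M0: "0 < M"
  proof -
    have "0 < 4 * k / \<epsilon>" using eps k by simp
    then show ?thesis using M by linarith
  qed
  \<comment> \<open>The first bound provides \<open>M\<close> vertices of large degree; the second
    makes \<open>W\<close> large enough for a pigeonhole over the \<open>2 ^ M\<close> subsets of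
    \<open>U\<close>.\<close>
  define n0 where "n0 = max (nat \<lceil>2 * M / \<epsilon>\<rceil>) (M * 2 ^ M)"
  show ?thesis
  proof (intro exI[of _ n0] allI impI, elim conjE)
    fix n E H
    assume n: "n0 \<le> n" and G: "graph_on n E" and H: "H \<subseteq> {..<n}"
      and dense: "\<epsilon> * (real n)\<^sup>2 \<le> (\<Sum>u\<in>H. real (card {w \<in> H. E u w}))"
    have n1: "2 * M \<le> \<epsilon> * n"
    proof -
      have "2 * M / \<epsilon> \<le> n" using n unfolding n0_def by linarith
      then show ?thesis using eps by (simp add: field_simps)
    qed
    have n2: "M * 2 ^ M \<le> n" using n unfolding n0_def by simp
    have "0 < n" using n2 M0 by (metis less_le_trans nat_0_less_mult_iff zero_less_numeral zero_less_power)
    have fH: "finite H" using H finite_subset by blast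
    have cH: "card H \<le> n" using card_mono[OF _ H] by simp
    define H' where "H' = {u \<in> H. \<epsilon> / 2 * n \<le> card {w \<in> H. E u w}}"
    have fH': "finite H'" unfolding H'_def using fH by simp
    have "(\<Sum>u\<in>H. real (card {w \<in> H. E u w})) \<le> (\<Sum>u\<in>H. (if u \<in> H' then real n else 0) + \<epsilon> / 2 * n)"
    proof (rule sum_mono)
      fix u assume u: "u \<in> H"
      have "card {w \<in> H. E u w} \<le> card H" using fH by (intro card_mono) auto
      then have "real (card {w \<in> H. E u w}) \<le> n" using cH by simp
      moreover have "0 \<le> \<epsilon> / 2 * n" using eps by simp
      ultimately show "real (card {w \<in> H. E u w}) \<le> (if u \<in> H' then real n else 0) + \<epsilon> / 2 * n"
        using u unfolding H'_def by (auto simp del: times_divide_eq_left)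
    qed
    also have "\<dots> = card H' * real n + card H * (\<epsilon> / 2 * n)"
    proof -
      have "H \<inter> H' = H'" unfolding H'_def by auto
      then show ?thesis using fH by (simp add: sum.distrib sum.If_cases)
    qed
    also have "\<dots> \<le> card H' * real n + n * (\<epsilon> / 2 * n)"
      using cH eps by (intro add_left_mono mult_right_mono) auto
    finally have "(\<epsilon> / 2 * n) * n \<le> card H' * real n"
      using dense by (simp add: power2_eq_square mult_ac)
    then have "\<epsilon> / 2 * n \<le> card H'" using \<open>0 < n\<close> by simp
    then have "M \<le> card H'" using n1 by linarith
    then obtain U where U: "U \<subseteq> H'" "card U = M" "finite U"
      using obtain_subset_with_card_n by metis
    define g where "g w = {u \<in> U. E u w}" for w
    define W where "W = {w \<in> H. k \<le> card (g w)}"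
    have fW: "finite W" unfolding W_def using fH by simp
    have "M * (\<epsilon> / 2 * n) \<le> (\<Sum>u\<in>U. real (card {w \<in> H. E u w}))"
      using sum_bounded_below[of U "\<epsilon> / 2 * n" "\<lambda>u. real (card {w \<in> H. E u w})"] U
      unfolding H'_def by auto
    also have "\<dots> = (\<Sum>w\<in>H. real (card (g w)))"
      using sum_card_swap[OF U(3) fH, of E] unfolding g_def of_nat_sum[symmetric] by simp
    also have "\<dots> \<le> (\<Sum>w\<in>H. (if w \<in> W then real M else 0) + k)"
    proof (rule sum_mono)
      fix w assume w: "w \<in> H"
      have "card (g w) \<le> M" using U card_mono[OF U(3), of "g w"] unfolding g_def by auto
      then show "real (card (g w)) \<le> (if w \<in> W then real M else 0) + k"
        using w unfolding W_def by auto
    qed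
    also have "\<dots> = card W * real M + card H * real k"
    proof -
      have "H \<inter> W = W" unfolding W_def by auto
      then show ?thesis using fH by (simp add: sum.distrib sum.If_cases)
    qed
    also have "\<dots> \<le> card W * real M + n * real k"
      using cH by (intro add_left_mono mult_right_mono) auto
    finally have "M * (\<epsilon> / 2 * n) \<le> card W * real M + n * real k" .
    moreover have "real n * real k + real n * real k \<le> M * (\<epsilon> / 2 * n)"
      using mult_right_mono[OF M4, of "real n"] by (simp add: mult_ac)
    ultimately have "n * real k \<le> card W * real M" by linarith
    then have "n * k \<le> card W * M" by (metis of_nat_le_iff of_nat_mult)
    moreover have "(M * 2 ^ M) * k \<le> n * k" using n2 by (rule mult_right_mono) simp
    ultimately have "(M * 2 ^ M) * k \<le> card W * M" by (rule order_trans[rotated])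
    then have "(2 ^ M * k) * M \<le> card W * M" by (simp only: mult_ac)
    then have cW: "2 ^ M * k \<le> card W" using M0 by simp
    have "\<exists>S\<in>Pow U. k \<le> card {w \<in> W. g w = S}"
    proof (rule ccontr)
      assume none: "\<not> ?thesis"
      have lt: "card {w \<in> W. g w = S} \<le> k - 1" if "S \<in> Pow U" for S
      proof -
        have "\<not> k \<le> card {w \<in> W. g w = S}" using none that by blast
        then show ?thesis using k by linarith
      qed
      have "card W = card (\<Union>S\<in>Pow U. {w \<in> W. g w = S})"
      proof (rule arg_cong[of _ _ card])
        have "g w \<in> Pow U" for w unfolding g_def by blast
        then show "W = (\<Union>S\<in>Pow U. {w \<in> W. g w = S})" by blast
      qed
      also have "\<dots> \<le> (\<Sum>S\<in>Pow U. card {w \<in> W. g w = S})"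
        using U(3) by (intro card_UN_le finite_Pow_iff[THEN iffD2])
      also have "\<dots> \<le> (\<Sum>S\<in>Pow U. k - 1)" by (rule sum_mono) (rule lt)
      also have "\<dots> = 2 ^ M * (k - 1)" by (simp add: card_Pow U)
      also have "\<dots> < 2 ^ M * k" using k by simp
      finally show False using cW by simp
    qed
    then obtain S where S: "S \<subseteq> U" "k \<le> card {w \<in> W. g w = S}" by auto
    then obtain B where B: "B \<subseteq> {w \<in> W. g w = S}" "card B = k"
      using obtain_subset_with_card_n by metis
    then obtain b where "b \<in> B" using k by fastforce
    then have "k \<le> card S" using B unfolding W_def by auto
    then obtain A where A: "A \<subseteq> S" "card A = k" using obtain_subset_with_card_n by metis
    have "A \<subseteq> H" "B \<subseteq> H" using A S U B unfolding H'_def W_def by auto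
    moreover have "\<forall>a\<in>A. \<forall>b\<in>B. E a b" using A B unfolding g_def by blast
    ultimately show "\<exists>A\<subseteq>H. \<exists>B\<subseteq>H. card A = k \<and> card B = k \<and> (\<forall>a\<in>A. \<forall>b\<in>B. E a b)"
      using A B by blast
  qed
qed

lemma card_UN_le_mult:
  fixes c :: real
  assumes "finite A" "card A \<le> m" "\<And>a. a \<in> A \<Longrightarrow> card (F a) \<le> c" "0 \<le> c"
  shows "card (\<Union>a\<in>A. F a) \<le> m * c"
proof -
  have "real (card (\<Union>a\<in>A. F a)) \<le> (\<Sum>a\<in>A. real (card (F a)))"
    using card_UN_le[OF assms(1), of F] by (metis of_nat_le_iff of_nat_sum)
  also have "\<dots> \<le> card A * c" using sum_bounded_above[of A "\<lambda>a. real (card (F a))" c] assms(3) by simp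
  also have "\<dots> \<le> m * c" using assms(2,4) by (intro mult_right_mono) auto
  finally show ?thesis .
qed

lemma card_diff_ge: "finite B \<Longrightarrow> real (card A) - card B \<le> card (A - B)"
  using diff_card_le_card_Diff[of B A] by linarith

lemma card_split:
  assumes "finite A"
  shows "real (card {a \<in> A. P a}) + card {a \<in> A. \<not> P a} = card A"
proof -
  have "card A = card ({a \<in> A. P a} \<union> {a \<in> A. \<not> P a})" by (rule arg_cong[of _ _ card]) auto
  also have "\<dots> = card {a \<in> A. P a} + card {a \<in> A. \<not> P a}"
    using assms by (intro card_Un_disjoint) auto
  finally show ?thesis by simp
qed

text \<open>Markov's inequality for the counting measure.\<close>

lemma card_le_of_weight:
  fixes h :: "'a \<Rightarrow> real" and c t :: real
  assumes "finite A" "B \<subseteq> A" "\<And>a. a \<in> A \<Longrightarrow> 0 \<le> h a" "\<And>a. a \<in> B \<Longrightarrow> t \<le> h a"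
    "sum h A \<le> c * t" "0 < t"
  shows "card B \<le> c"
proof -
  have "card B * t \<le> sum h B" using sum_bounded_below[of B t h] assms(4) by simp
  also have "\<dots> \<le> sum h A" using assms(1-3) by (intro sum_mono2) auto
  finally have "card B * t \<le> c * t" using assms(5) by simp
  then show ?thesis using assms(6) by simp
qed

text \<open>Writing \<open>r\<^sup>2\<close> as a sum over walks of length two from a vertex \<open>z\<close> of maximum entry shows that the
  pairs between the neighbourhood of \<open>z\<close> and its complement are almost all edges, with almost all
  entries close to 1. Reconnecting a vertex to the typical vertices of one side then bounds every
  entry from below.\<close>

lemma spex_stability_aux:
  fixes \<gamma> :: real
  assumes S: "SPEX_wheel k n E" and k: "k \<in> {4, 5}" and n: "26 \<le> n"
    and g: "0 < \<gamma>" "\<gamma> \<le> 1 / 100" "12 \<le> \<gamma> * n"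
    and x0: "\<And>i. 0 \<le> x i" and x1: "\<And>i. i < n \<Longrightarrow> x i \<le> (1::real)" and z: "z < n" "x z = 1"
    and eig: "\<And>i. i < n \<Longrightarrow> sum x {j. E i j} = spectral_radius n E * x i"
    and sparse: "(\<Sum>u | E z u. real (card {w. E z w \<and> E u w})) \<le> \<gamma>\<^sup>2 * (real n)\<^sup>2"
  defines "r \<equiv> spectral_radius n E"
  obtains L R where "\<And>i. i < n \<Longrightarrow> 1 - 14 * \<gamma> \<le> x i" "\<bar>r - n / 2\<bar> \<le> \<gamma> * n"
    "L \<union> R = {..<n}" "L \<inter> R = {}" "\<bar>card L - n / 2\<bar> \<le> 4 * \<gamma> * n" "\<bar>card R - n / 2\<bar> \<le> 4 * \<gamma> * n"
    "\<And>v. v \<in> L \<Longrightarrow> card {u \<in> R. \<not> E v u} \<le> 19 * \<gamma> * n"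
    "\<And>v. v \<in> R \<Longrightarrow> card {u \<in> L. \<not> E v u} \<le> 19 * \<gamma> * n"
proof -
  have G: "graph_on n E" and free: "\<not> contains_wheel n E (2 * k)"
    using S unfolding SPEX_wheel_def odd_wheel_free_def by auto
  have sym: "E a b \<longleftrightarrow> E b a" for a b using graph_onD(4)[OF G] by blast
  define N where "N = real n"
  have gN: "12 \<le> \<gamma> * N" and N: "0 < N" using g n unfolding N_def by auto
  have gN2: "1 \<le> \<gamma>\<^sup>2 * N\<^sup>2"
    using gN by (simp add: power_mult_distrib[symmetric] one_le_power)
  have g2: "\<gamma>\<^sup>2 * N\<^sup>2 \<le> \<gamma> / 100 * N\<^sup>2"
    using g by (intro mult_right_mono) (auto simp: power2_eq_square)
  define Z where "Z = {u. E z u}"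
  define Z' where "Z' = {..<n} - Z"
  have Zn: "Z \<subseteq> {..<n}" unfolding Z_def using G by (auto dest: graph_onD)
  have fin: "finite Z" "finite Z'" using Zn finite_subset unfolding Z'_def by auto
  have dec: "{..<n} = Z \<union> Z'" "Z \<inter> Z' = {}" unfolding Z'_def using Zn by auto
  define d where "d = real (card Z)"
  have cZ': "card Z' = N - d"
    unfolding Z'_def N_def d_def using Zn fin card_mono[OF _ Zn] by (simp add: card_Diff_subset of_nat_diff)
  have r0: "0 < r" and low: "N\<^sup>2 / 4 - 1 + (N - 2) / r \<le> r\<^sup>2 - (real k - 1) * r"
    using spex_spectral_lower[OF S k n] unfolding r_def N_def by auto
  have "0 \<le> (N - 2) / r" using n r0 unfolding N_def by simp
  moreover have "0 \<le> (real k - 1) * r" using k r0 by auto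
  ultimately have low2: "N\<^sup>2 / 4 - 1 \<le> r\<^sup>2" using low by linarith
  \<comment> \<open>The loss of the pair against an edge whose end \<open>w\<close> has entry 1.
    Without loss, the walks of length two from \<open>z\<close> into \<open>Z'\<close> would weigh
    \<open>d * (N - d)\<close>.\<close>
  define gap where "gap u w = 1 - (if E u w then x w else 0)" for u w
  have gap0: "0 \<le> gap u w" if "w < n" for u w using x1 that unfolding gap_def by auto
  define GAP where "GAP = (\<Sum>u\<in>Z. \<Sum>w\<in>Z'. gap u w)"
  have lt: "u < n" if "u \<in> Z \<or> u \<in> Z'" for u using that dec by auto
  have inner: "(\<Sum>u\<in>Z. sum x {w. E u w \<and> E z w}) \<le> \<gamma>\<^sup>2 * N\<^sup>2"
  proof -
    have "(\<Sum>u\<in>Z. sum x {w. E u w \<and> E z w}) \<le> (\<Sum>u\<in>Z. real (card {w. E z w \<and> E u w}))"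
    proof (rule sum_mono)
      fix u
      have "sum x {w. E u w \<and> E z w} \<le> real (card {w. E u w \<and> E z w}) * 1"
        by (rule sum_bounded_above) (use x1 G in \<open>auto dest: graph_onD\<close>)
      then show "sum x {w. E u w \<and> E z w} \<le> real (card {w. E z w \<and> E u w})" by (simp add: conj_commute)
    qed
    then show ?thesis using sparse unfolding Z_def N_def by simp
  qed
  have rr: "r\<^sup>2 = (\<Sum>u\<in>Z. sum x {w. E u w \<and> E z w}) + (d * (N - d) - GAP)"
  proof -
    have "r\<^sup>2 = r * (r * x z)" using z by (simp add: power2_eq_square)
    also have "\<dots> = (\<Sum>u\<in>Z. r * x u)"
      using eig[OF z(1)] unfolding r_def Z_def by (simp add: sum_distrib_left[symmetric])
    also have "\<dots> = (\<Sum>u\<in>Z. sum x {w. E u w})" unfolding r_def by (rule sum.cong[OF refl]) (simp add: eig lt)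
    also have "\<dots> = (\<Sum>u\<in>Z. sum x {w. E u w \<and> E z w} + (\<Sum>w\<in>Z'. 1 - gap u w))"
    proof (rule sum.cong[OF refl])
      fix u assume "u \<in> Z"
      have "{w. E u w} = {w. E u w \<and> E z w} \<union> (Z' \<inter> {w. E u w})"
        unfolding Z'_def Z_def by (auto dest: graph_onD[OF G])
      then have "sum x {w. E u w} = sum x ({w. E u w \<and> E z w} \<union> (Z' \<inter> {w. E u w}))" by simp
      also have "\<dots> = sum x {w. E u w \<and> E z w} + sum x (Z' \<inter> {w. E u w})"
      proof (rule sum.union_disjoint)
        show "finite {w. E u w \<and> E z w}" using fin(1) unfolding Z_def by (rule rev_finite_subset) auto
        show "{w. E u w \<and> E z w} \<inter> (Z' \<inter> {w. E u w}) = {}" unfolding Z'_def Z_def by auto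
      qed (use fin in auto)
      also have "sum x (Z' \<inter> {w. E u w}) = (\<Sum>w\<in>Z'. 1 - gap u w)"
        unfolding gap_def using fin by (simp add: sum.inter_restrict)
      finally show "sum x {w. E u w} = sum x {w. E u w \<and> E z w} + (\<Sum>w\<in>Z'. 1 - gap u w)" .
    qed
    also have "\<dots> = (\<Sum>u\<in>Z. sum x {w. E u w \<and> E z w}) + (d * (N - d) - GAP)"
      unfolding GAP_def by (simp add: sum.distrib sum_subtractf d_def[symmetric] cZ')
    finally show ?thesis .
  qed
  have GAP0: "0 \<le> GAP" unfolding GAP_def using gap0 lt by (intro sum_nonneg) auto
  have quad: "d * (N - d) = N\<^sup>2 / 4 - (d - N / 2)\<^sup>2" by (simp add: power2_eq_square field_simps)
  \<comment> \<open>Comparing \<open>rr\<close> with \<open>low2\<close>, the two losses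
    \<open>GAP\<close> and \<open>(d - N / 2)\<^sup>2\<close> add up to at most
    \<open>\<gamma>\<^sup>2 * N\<^sup>2 + 1\<close>.\<close>
  have GAP: "GAP \<le> 2 * \<gamma>\<^sup>2 * N\<^sup>2" and dq: "(d - N / 2)\<^sup>2 \<le> 2 * \<gamma>\<^sup>2 * N\<^sup>2" and rup: "r\<^sup>2 \<le> N\<^sup>2 / 4 + \<gamma>\<^sup>2 * N\<^sup>2"
    using rr inner low2 GAP0 gN2 zero_le_power2[of "d - N / 2"] unfolding quad by linarith+
  have dd: "\<bar>d - N / 2\<bar> \<le> 2 * \<gamma> * N"
  proof -
    have "0 \<le> \<gamma>\<^sup>2 * N\<^sup>2" by simp
    moreover have "(2 * \<gamma> * N)\<^sup>2 = 4 * (\<gamma>\<^sup>2 * N\<^sup>2)" by (simp add: power_mult_distrib)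
    ultimately have "(d - N / 2)\<^sup>2 \<le> (2 * \<gamma> * N)\<^sup>2" using dq by linarith
    then have "\<bar>d - N / 2\<bar> \<le> \<bar>2 * \<gamma> * N\<bar>" by (simp only: abs_le_square_iff)
    moreover have "\<bar>2 * \<gamma> * N\<bar> = 2 * \<gamma> * N" using g N by simp
    ultimately show ?thesis by simp
  qed
  have g100: "\<gamma> * N \<le> N / 100" using mult_right_mono[OF g(2), of N] N by simp
  have d4: "N / 4 \<le> d" "N / 4 \<le> N - d" "d \<le> N" using dd g100 N unfolding abs_le_iff by linarith+
  have gN0: "0 \<le> \<gamma> * N" "0 \<le> \<gamma> * N\<^sup>2" using g N by simp_all
  have r_up: "r \<le> N / 2 + \<gamma> * N"
  proof (rule power2_le_imp_le)
    have "(N / 2 + \<gamma> * N)\<^sup>2 = N\<^sup>2 / 4 + \<gamma> * N\<^sup>2 + \<gamma>\<^sup>2 * N\<^sup>2"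
      by (simp add: power2_eq_square algebra_simps)
    then show "r\<^sup>2 \<le> (N / 2 + \<gamma> * N)\<^sup>2" using rup gN0 by linarith
    show "0 \<le> N / 2 + \<gamma> * N" using N gN0 by linarith
  qed
  have r_lo: "N / 2 - \<gamma> * N \<le> r"
  proof (rule power2_le_imp_le)
    have "(N / 2 - \<gamma> * N)\<^sup>2 = N\<^sup>2 / 4 - \<gamma> * N\<^sup>2 + \<gamma>\<^sup>2 * N\<^sup>2"
      by (simp add: power2_eq_square algebra_simps)
    moreover have "\<gamma> / 100 * N\<^sup>2 = \<gamma> * N\<^sup>2 / 100" by simp
    ultimately show "(N / 2 - \<gamma> * N)\<^sup>2 \<le> r\<^sup>2" using low2 g2 gN2 gN0 by linarith
    show "0 \<le> r" using r0 by simp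
  qed
  define nz where "nz w = {u \<in> Z. \<not> E w u}" for w
  \<comment> \<open>The typical vertices of \<open>Z'\<close>. Each other one loses at least
    \<open>\<gamma> * N\<close>, so Markov's inequality makes these few.\<close>
  define L0 where "L0 = {w \<in> Z'. card (nz w) \<le> \<gamma> * N}"
  have L0: "L0 \<subseteq> Z'" "finite L0" unfolding L0_def using fin by auto
  have GAP': "GAP = (\<Sum>w\<in>Z'. \<Sum>u\<in>Z. gap u w)" unfolding GAP_def by (rule sum.swap)
  have cw: "0 \<le> (\<Sum>u\<in>Z. gap u w)" if "w \<in> Z'" for w using gap0 lt that by (intro sum_nonneg) auto
  have bad: "card (Z' - L0) \<le> 2 * \<gamma> * N"
  proof (rule card_le_of_weight[where A = Z' and h = "\<lambda>w. \<Sum>u\<in>Z. gap u w" and t = "\<gamma> * N"])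
    fix w assume w: "w \<in> Z' - L0"
    then have "\<gamma> * N \<le> card (nz w)" unfolding L0_def by auto
    also have "\<dots> = (\<Sum>u\<in>nz w. gap u w)" unfolding gap_def nz_def using sym by simp
    also have "\<dots> \<le> (\<Sum>u\<in>Z. gap u w)"
      using fin gap0 lt w by (intro sum_mono2) (auto simp: nz_def)
    finally show "\<gamma> * N \<le> (\<Sum>u\<in>Z. gap u w)" .
  next
    show "(\<Sum>w\<in>Z'. \<Sum>u\<in>Z. gap u w) \<le> 2 * \<gamma> * N * (\<gamma> * N)"
      using GAP unfolding GAP' by (simp add: power2_eq_square mult_ac)
    show "0 < \<gamma> * N" using gN by simp
  qed (use cw fin in auto)
  have xdef: "(\<Sum>w\<in>Z'. 1 - x w) \<le> \<gamma> * N"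
  proof -
    \<comment> \<open>Each of the \<open>d\<close> pairs ending in \<open>w\<close> loses at least
      \<open>1 - x w\<close>.\<close>
    have "d * (\<Sum>w\<in>Z'. 1 - x w) = (\<Sum>w\<in>Z'. \<Sum>u\<in>Z. 1 - x w)"
      by (simp add: d_def sum_distrib_left)
    also have "\<dots> \<le> GAP" unfolding GAP' gap_def using x0 by (intro sum_mono) auto
    also have "\<dots> \<le> 2 * \<gamma>\<^sup>2 * N\<^sup>2" by (rule GAP)
    also have "\<dots> \<le> (N / 4) * (\<gamma> * N)"
      using g2 gN0 by (simp add: power2_eq_square algebra_simps)
    also have "\<dots> \<le> d * (\<gamma> * N)" using d4 gN by (intro mult_right_mono) auto
    finally show ?thesis by (rule mult_left_le_imp_le) (use d4 N in linarith)
  qed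
  have cL0: "N / 2 - 4 * \<gamma> * N \<le> card L0" "card L0 \<le> N / 2 + 2 * \<gamma> * N"
  proof -
    have "real (card Z') - card L0 = card (Z' - L0)"
      using L0 fin card_mono[OF fin(2) L0(1)] by (simp add: card_Diff_subset of_nat_diff)
    then show "N / 2 - 4 * \<gamma> * N \<le> card L0" "card L0 \<le> N / 2 + 2 * \<gamma> * N"
      using bad dd cZ' by (auto simp: abs_le_iff)
  qed
  have xL0: "N / 2 - 5 * \<gamma> * N \<le> sum x L0"
  proof -
    have "(\<Sum>w\<in>L0. 1 - x w) \<le> (\<Sum>w\<in>Z'. 1 - x w)"
      using L0 fin x1 lt by (intro sum_mono2) auto
    then have "card L0 - sum x L0 \<le> \<gamma> * N" using xdef by (simp add: sum_subtractf)
    then show ?thesis using cL0 by linarith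
  qed
  \<comment> \<open>\<open>v\<close> is reconnected to \<open>L0\<close>. The at most 11 vertices of
    a wheel rule out at most \<open>11 * \<gamma> * N + 12\<close> vertices of \<open>Z\<close>, so
    a substitute for \<open>v\<close> remains in \<open>Z\<close>.\<close>
  have rx: "N / 2 - 6 * \<gamma> * N \<le> r * x v" if v: "v < n" for v
  proof -
    have "sum x (L0 - {v}) \<le> spectral_radius n E * x v"
    proof (rule spex_reconnect[OF S _ v _ _ x0 _ eig])
      show "0 < k" using k by auto
      show "L0 - {v} \<subseteq> {..<n}" using L0 dec by auto
      show "0 < spectral_radius n E" using r0 unfolding r_def .
      fix U :: "nat set" assume U: "finite U" "card U \<le> 2 * k + 1"
      define B where "B = (\<Union>t\<in>U \<inter> L0. nz t) \<union> insert v U"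
      have "card (U \<inter> L0) \<le> 11" using U k card_mono[of U "U \<inter> L0"] by auto
      then have "real (card (\<Union>t\<in>U \<inter> L0. nz t)) \<le> real 11 * (\<gamma> * N)"
      proof (rule card_UN_le_mult[rotated])
        show "card (nz t) \<le> \<gamma> * N" if "t \<in> U \<inter> L0" for t using that unfolding L0_def by simp
        show "0 \<le> \<gamma> * N" using gN by linarith
        show "finite (U \<inter> L0)" using U by simp
      qed
      moreover have "card (insert v U) \<le> 12" using U k by (auto simp: card_insert_if)
      moreover have "card B \<le> card (\<Union>t\<in>U \<inter> L0. nz t) + card (insert v U)"
        unfolding B_def by (rule card_Un_le)
      ultimately have "card B \<le> real 11 * (\<gamma> * N) + 12" by linarith
      then have "card B < d" using gN g100 d4 by simp
      then have "card B < card Z" unfolding d_def by simp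
      moreover have "finite B" unfolding B_def nz_def using U fin by auto
      ultimately have "\<not> Z \<subseteq> B" by (meson card_mono leD)
      then obtain v' where "v' \<in> Z" "v' \<notin> B" by blast
      then show "\<exists>v'. v' \<notin> insert v U \<and> v' < n \<and> (\<forall>t\<in>U \<inter> (L0 - {v}). E v' t)"
      proof (intro exI[of _ v'] conjI ballI)
        show "v' \<notin> insert v U" using \<open>v' \<notin> B\<close> unfolding B_def by blast
        show "v' < n" using \<open>v' \<in> Z\<close> lt by blast
        fix t assume "t \<in> U \<inter> (L0 - {v})"
        then have "v' \<notin> nz t" using \<open>v' \<notin> B\<close> unfolding B_def by blast
        then have "E t v'" using \<open>v' \<in> Z\<close> unfolding nz_def by blast
        then show "E v' t" by (rule graph_onD(4)[OF G])
      qed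
    qed (use v in auto)
    moreover have "sum x L0 - 1 \<le> sum x (L0 - {v})"
      using L0 x1[OF v] by (auto simp: sum_diff1)
    ultimately show ?thesis using xL0 gN unfolding r_def by linarith
  qed
  have xlow: "1 - 14 * \<gamma> \<le> x v" if v: "v < n" for v
  proof -
    \<comment> \<open>The 14 is chosen so that multiplying the upper bound on \<open>r\<close> by
      \<open>1 - 14 * \<gamma>\<close> gives no more than the bound in \<open>rx\<close>.\<close>
    have "r * (1 - 14 * \<gamma>) \<le> (N / 2 + \<gamma> * N) * (1 - 14 * \<gamma>)"
      using r_up g by (intro mult_right_mono) auto
    also have "\<dots> = N / 2 - 6 * \<gamma> * N - 14 * (\<gamma>\<^sup>2 * N)"
      by (simp add: power2_eq_square algebra_simps)
    also have "\<dots> \<le> r * x v"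
    proof -
      have "0 \<le> \<gamma>\<^sup>2 * N" using N by simp
      then show ?thesis using rx[OF v] by linarith
    qed
    finally show ?thesis using r0 by simp
  qed
  have deg: "N / 2 - 6 * \<gamma> * N \<le> card {u. E v u}" if v: "v < n" for v
  proof -
    have "sum x {u. E v u} \<le> real (card {u. E v u}) * 1"
      by (rule sum_bounded_above) (use x1 G in \<open>auto dest: graph_onD\<close>)
    then show ?thesis using rx[OF v] eig[OF v] unfolding r_def by simp
  qed
  have fnz: "finite (nz w)" for w unfolding nz_def using fin by simp
  \<comment> \<open>Otherwise pick \<open>k\<close> neighbours in \<open>L0\<close>. Each misses at
    most \<open>\<gamma> * N\<close> of \<open>Z\<close>, so enough neighbours of \<open>v\<close>
    in \<open>Z\<close> see all of them, and a complete bipartite graph lies in the neighbourhood of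
    \<open>v\<close>.\<close>
  have not_both: "card {w \<in> L0. E v w} < 6 * \<gamma> * N \<or> card {u \<in> Z. E v u} < 6 * \<gamma> * N" for v
  proof (rule ccontr)
    assume "\<not> ?thesis"
    then have big: "6 * \<gamma> * N \<le> card {w \<in> L0. E v w}" "6 * \<gamma> * N \<le> card {u \<in> Z. E v u}" by auto
    then have "real k \<le> card {w \<in> L0. E v w}" using gN k by auto
    then have "k \<le> card {w \<in> L0. E v w}" by simp
    then obtain A where A: "A \<subseteq> {w \<in> L0. E v w}" "card A = k" "finite A"
      using obtain_subset_with_card_n by metis
    define B where "B = {u \<in> Z. E v u} - (\<Union>a\<in>A. nz a)"
    have "card A \<le> 5" using A k by auto
    then have "real (card (\<Union>a\<in>A. nz a)) \<le> real 5 * (\<gamma> * N)"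
    proof (rule card_UN_le_mult[rotated])
      show "card (nz a) \<le> \<gamma> * N" if "a \<in> A" for a using that A(1) unfolding L0_def by blast
      show "0 \<le> \<gamma> * N" using gN by linarith
    qed (rule A(3))
    moreover have "finite (\<Union>a\<in>A. nz a)" using A(3) fnz by blast
    ultimately have "\<gamma> * N \<le> card B"
      using card_diff_ge[of "\<Union>a\<in>A. nz a" "{u \<in> Z. E v u}"] big(2) unfolding B_def by simp
    then have "real k \<le> card B" using gN k by auto
    then have kB: "k \<le> card B" by simp
    have "contains_wheel n E (2 * k)"
    proof (rule complete_bipartite_nbhd_wheel[OF G k _ kB])
      show "k \<le> card A" using A by simp
    qed (use A in \<open>auto simp: B_def nz_def\<close>)
    then show False using free by simp
  qed
  \<comment> \<open>This sorts the exceptional vertices too. Every vertex has degree near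
    \<open>N / 2\<close> and cannot see much of both \<open>Z\<close> and \<open>L0\<close>, so it
    sees nearly all of one of them.\<close>
  define R where "R = {v. v < n \<and> card {u \<in> Z. E v u} < 6 * \<gamma> * N}"
  define L where "L = {..<n} - R"
  have finLR: "finite L" "finite R" unfolding L_def R_def by auto
  have Lsmall: "card {w \<in> L0. E v w} < 6 * \<gamma> * N" if "v \<in> L" for v
    using not_both[of v] that unfolding L_def R_def by auto
  have splitdeg: "card {u. E v u} \<le> card {u \<in> Z. E v u} + (card {w \<in> L0. E v w} + card (Z' - L0))" for v
  proof -
    have "{u. E v u} \<subseteq> {u \<in> Z. E v u} \<union> ({w \<in> L0. E v w} \<union> (Z' - L0))"
      using dec by (auto dest: graph_onD[OF G])
    then have "card {u. E v u} \<le> card ({u \<in> Z. E v u} \<union> ({w \<in> L0. E v w} \<union> (Z' - L0)))"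
      using fin L0 by (intro card_mono) auto
    also have "\<dots> \<le> card {u \<in> Z. E v u} + card ({w \<in> L0. E v w} \<union> (Z' - L0))" by (rule card_Un_le)
    also have "\<dots> \<le> card {u \<in> Z. E v u} + (card {w \<in> L0. E v w} + card (Z' - L0))"
      by (intro add_left_mono card_Un_le)
    finally show ?thesis .
  qed
  have RL0: "card {w \<in> L0. \<not> E v w} \<le> 16 * \<gamma> * N" if "v \<in> R" for v
  proof -
    have "card {u \<in> Z. E v u} < 6 * \<gamma> * N" "v < n" using that unfolding R_def by auto
    then show ?thesis using deg[of v] splitdeg[of v] bad cL0 card_split[OF L0(2), of "E v"] by linarith
  qed
  have LZ: "card {u \<in> Z. \<not> E v u} \<le> 16 * \<gamma> * N" if "v \<in> L" for v
  proof -
    have "v < n" using that unfolding L_def by auto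
    then show ?thesis using deg[of v] splitdeg[of v] bad dd Lsmall[OF that] card_split[OF fin(1), of "E v"]
      unfolding d_def abs_le_iff by linarith
  qed
  have L0L: "L0 \<subseteq> L"
  proof
    fix w assume w: "w \<in> L0"
    then have "card {u \<in> Z. \<not> E w u} \<le> \<gamma> * N" unfolding L0_def nz_def by auto
    then have "6 * \<gamma> * N \<le> card {u \<in> Z. E w u}"
      using card_split[OF fin(1), of "E w"] d4 g100 N unfolding d_def by linarith
    then show "w \<in> L" using w L0 dec unfolding L_def R_def by auto
  qed
  \<comment> \<open>A vertex of \<open>Z\<close> in \<open>L\<close> misses at least
    \<open>N / 4\<close> of \<open>L0\<close>, a loss that \<open>GAP\<close> leaves to few
    vertices.\<close>
  have ZR: "card (Z - R) \<le> \<gamma> * N"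
  proof (rule card_le_of_weight[where A = Z and h = "\<lambda>u. \<Sum>w\<in>Z'. gap u w" and t = "N / 4"])
    fix u assume u: "u \<in> Z - R"
    then have "u \<in> L" unfolding L_def using lt by auto
    then have "N / 4 \<le> card {w \<in> L0. \<not> E u w}"
      using Lsmall[of u] card_split[OF L0(2), of "E u"] cL0 g100 by linarith
    also have "\<dots> = (\<Sum>w\<in>{w \<in> L0. \<not> E u w}. gap u w)" unfolding gap_def by simp
    also have "\<dots> \<le> (\<Sum>w\<in>Z'. gap u w)"
      using fin gap0 lt u L0 by (intro sum_mono2) auto
    finally show "N / 4 \<le> (\<Sum>w\<in>Z'. gap u w)" .
  next
    show "(\<Sum>u\<in>Z. \<Sum>w\<in>Z'. gap u w) \<le> \<gamma> * N * (N / 4)"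
      using GAP g2 gN0 unfolding GAP_def by (simp add: power2_eq_square algebra_simps)
    show "0 \<le> (\<Sum>w\<in>Z'. gap u w)" for u using gap0 lt by (intro sum_nonneg) auto
  qed (use N fin in auto)
  have RZ: "R - Z \<subseteq> Z' - L0" using L0L dec unfolding L_def R_def by auto
  then have cRZ: "card (R - Z) \<le> 2 * \<gamma> * N" using bad fin card_mono[OF _ RZ] by fastforce
  have LL0: "L - L0 \<subseteq> (Z' - L0) \<union> (Z - R)" using dec unfolding L_def by auto
  have cLL0: "card (L - L0) \<le> 3 * \<gamma> * N"
    using bad ZR card_mono[OF _ LL0] card_Un_le[of "Z' - L0" "Z - R"] fin by fastforce
  have cR1: "card R \<le> d + 2 * \<gamma> * N"
  proof -
    have "card R \<le> card (Z \<union> (R - Z))" using finLR fin by (intro card_mono) auto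
    also have "\<dots> \<le> card Z + card (R - Z)" by (rule card_Un_le)
    finally show ?thesis using cRZ unfolding d_def by linarith
  qed
  have cR2: "d - \<gamma> * N \<le> card R"
  proof -
    have "card Z \<le> card (R \<union> (Z - R))" using finLR fin by (intro card_mono) auto
    also have "\<dots> \<le> card R + card (Z - R)" by (rule card_Un_le)
    finally show ?thesis using ZR unfolding d_def by linarith
  qed
  have cL: "card L = N - card R"
  proof -
    have "R \<subseteq> {..<n}" unfolding R_def by auto
    then show ?thesis unfolding L_def N_def using finLR card_mono[of "{..<n}" R]
      by (simp add: card_Diff_subset of_nat_diff)
  qed
  show thesis
  proof (rule that[of L R])
    show "\<bar>r - n / 2\<bar> \<le> \<gamma> * n" using r_lo r_up unfolding N_def by linarith
    show "L \<union> R = {..<n}" "L \<inter> R = {}" unfolding L_def R_def by auto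
    show "\<bar>card R - n / 2\<bar> \<le> 4 * \<gamma> * n" "\<bar>card L - n / 2\<bar> \<le> 4 * \<gamma> * n"
      using cR1 cR2 dd cL gN unfolding N_def abs_le_iff by linarith+
    fix v
    show "card {u \<in> R. \<not> E v u} \<le> 19 * \<gamma> * n" if "v \<in> L"
    proof -
      have "{u \<in> R. \<not> E v u} \<subseteq> {u \<in> Z. \<not> E v u} \<union> (R - Z)" by auto
      then have "card {u \<in> R. \<not> E v u} \<le> card ({u \<in> Z. \<not> E v u} \<union> (R - Z))"
        using fin finLR by (intro card_mono) auto
      also have "\<dots> \<le> card {u \<in> Z. \<not> E v u} + card (R - Z)" by (rule card_Un_le)
      finally show ?thesis using LZ[OF that] cRZ gN unfolding N_def by linarith
    qed
    show "card {u \<in> L. \<not> E v u} \<le> 19 * \<gamma> * n" if "v \<in> R"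
    proof -
      have "{u \<in> L. \<not> E v u} \<subseteq> {u \<in> L0. \<not> E v u} \<union> (L - L0)" by auto
      then have "card {u \<in> L. \<not> E v u} \<le> card ({u \<in> L0. \<not> E v u} \<union> (L - L0))"
        using L0 finLR by (intro card_mono) auto
      also have "\<dots> \<le> card {u \<in> L0. \<not> E v u} + card (L - L0)" by (rule card_Un_le)
      finally show ?thesis using RL0[OF that] cLL0 gN unfolding N_def by linarith
    qed
  qed (use xlow in auto)
qed

text \<open>The sparsity assumption of the previous lemma holds for large \<open>n\<close>, since a
  dense neighbourhood contains a complete bipartite graph and hence a rim for its hub.\<close>

lemma spex_stability:
  fixes \<delta> :: real
  assumes k: "k \<in> {4, 5}" and "0 < \<delta>"
  shows "\<exists>n0. \<forall>n\<ge>n0. \<forall>E. SPEX_wheel k n E \<longrightarrow> (\<exists>x L R.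
    (\<forall>i<n. 1 - \<delta> \<le> x i \<and> x i \<le> 1 \<and> sum x {j. E i j} = spectral_radius n E * x i) \<and>
    \<bar>spectral_radius n E - n / 2\<bar> \<le> \<delta> * n \<and> L \<union> R = {..<n} \<and> L \<inter> R = {} \<and>
    \<bar>card L - n / 2\<bar> \<le> \<delta> * n \<and> \<bar>card R - n / 2\<bar> \<le> \<delta> * n \<and>
    (\<forall>v\<in>L. card {u \<in> R. \<not> E v u} \<le> \<delta> * n) \<and> (\<forall>v\<in>R. card {u \<in> L. \<not> E v u} \<le> \<delta> * n))"
proof -
  \<comment> \<open>The 20 exceeds each of the factors 1, 4, 14 and 19 in front of \<gamma> in the
    previous bounds.\<close>
  define \<gamma> where "\<gamma> = min (\<delta> / 20) (1 / 100)"
  have g: "0 < \<gamma>" "\<gamma> \<le> 1 / 100" "20 * \<gamma> \<le> \<delta>" unfolding \<gamma>_def using \<open>0 < \<delta>\<close> by auto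
  have "0 < \<gamma>\<^sup>2" "0 < k" using g k by auto
  from dense_contains_complete_bipartite[OF this]
  obtain n1 where n1: "\<forall>n\<ge>n1. \<forall>E H. graph_on n E \<and> H \<subseteq> {..<n} \<and>
     \<gamma>\<^sup>2 * (real n)\<^sup>2 \<le> (\<Sum>u\<in>H. real (card {w \<in> H. E u w})) \<longrightarrow>
     (\<exists>A\<subseteq>H. \<exists>B\<subseteq>H. card A = k \<and> card B = k \<and> (\<forall>a\<in>A. \<forall>b\<in>B. E a b))" ..
  define n0 where "n0 = max n1 (max 26 (nat \<lceil>12 / \<gamma>\<rceil>))"
  show ?thesis
  proof (intro exI[of _ n0] allI impI)
    fix n E assume n: "n0 \<le> n" and S: "SPEX_wheel k n E"
    have "26 \<le> n" "n1 \<le> n" using n unfolding n0_def by auto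
    have "12 / \<gamma> \<le> n" using n unfolding n0_def by linarith
    then have g12: "12 \<le> \<gamma> * n" using g by (simp add: field_simps)
    have G: "graph_on n E" and free: "\<not> contains_wheel n E (2 * k)"
      using S unfolding SPEX_wheel_def odd_wheel_free_def by auto
    obtain x z where x: "\<And>i. 0 \<le> x i" "\<And>i. i < n \<Longrightarrow> x i \<le> (1::real)" "z < n" "x z = 1"
      "\<And>i. i < n \<Longrightarrow> sum x {j. E i j} = spectral_radius n E * x i"
      using perron_vector[OF G] \<open>26 \<le> n\<close> by (metis less_le_trans zero_less_numeral)
    have sparse: "(\<Sum>u | E z u. real (card {w. E z w \<and> E u w})) \<le> \<gamma>\<^sup>2 * (real n)\<^sup>2"
    proof (rule ccontr)
      assume "\<not> ?thesis"
      then have "\<gamma>\<^sup>2 * (real n)\<^sup>2 \<le> (\<Sum>u\<in>{u. E z u}. real (card {w \<in> {u. E z u}. E u w}))" by simp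
      moreover have "{u. E z u} \<subseteq> {..<n}" using G by (auto dest: graph_onD)
      ultimately have "\<exists>A\<subseteq>{u. E z u}. \<exists>B\<subseteq>{u. E z u}. card A = k \<and> card B = k \<and> (\<forall>a\<in>A. \<forall>b\<in>B. E a b)"
        using n1[rule_format, OF \<open>n1 \<le> n\<close>, of E "{u. E z u}"] G by blast
      then obtain A B where AB: "A \<subseteq> {u. E z u}" "B \<subseteq> {u. E z u}" "card A = k" "card B = k"
        "\<forall>a\<in>A. \<forall>b\<in>B. E a b" by blast
      have "contains_wheel n E (2 * k)"
        by (rule complete_bipartite_nbhd_wheel[OF G k, of A B]) (use AB in auto)
      then show False using free by simp
    qed
    have le: "a * (\<gamma> * n) \<le> \<delta> * n" if "a \<le> 20" for a :: real
    proof -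
      have "a * \<gamma> \<le> 20 * \<gamma>" using that g(1) by (intro mult_right_mono) auto
      then have "a * \<gamma> \<le> \<delta>" using g(3) by linarith
      then have "a * \<gamma> * n \<le> \<delta> * n" by (rule mult_right_mono) simp
      then show ?thesis by (simp add: mult.assoc)
    qed
    obtain L R where LR: "\<And>i. i < n \<Longrightarrow> 1 - 14 * \<gamma> \<le> x i" "\<bar>spectral_radius n E - n / 2\<bar> \<le> \<gamma> * n"
      "L \<union> R = {..<n}" "L \<inter> R = {}" "\<bar>card L - n / 2\<bar> \<le> 4 * \<gamma> * n" "\<bar>card R - n / 2\<bar> \<le> 4 * \<gamma> * n"
      "\<And>v. v \<in> L \<Longrightarrow> card {u \<in> R. \<not> E v u} \<le> 19 * \<gamma> * n"
      "\<And>v. v \<in> R \<Longrightarrow> card {u \<in> L. \<not> E v u} \<le> 19 * \<gamma> * n"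
      by (rule spex_stability_aux[OF S k \<open>26 \<le> n\<close> g(1,2) g12 x sparse]; (assumption | (rule that; assumption)))
    show "\<exists>x L R. (\<forall>i<n. 1 - \<delta> \<le> x i \<and> x i \<le> 1 \<and> sum x {j. E i j} = spectral_radius n E * x i) \<and>
      \<bar>spectral_radius n E - n / 2\<bar> \<le> \<delta> * n \<and> L \<union> R = {..<n} \<and> L \<inter> R = {} \<and>
      \<bar>card L - n / 2\<bar> \<le> \<delta> * n \<and> \<bar>card R - n / 2\<bar> \<le> \<delta> * n \<and>
      (\<forall>v\<in>L. card {u \<in> R. \<not> E v u} \<le> \<delta> * n) \<and> (\<forall>v\<in>R. card {u \<in> L. \<not> E v u} \<le> \<delta> * n)"
    proof (rule exI[of _ x], rule exI[of _ L], rule exI[of _ R], intro conjI allI impI ballI)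
      fix i assume i: "i < n"
      have "0 \<le> \<gamma>" using g by simp
      then show "1 - \<delta> \<le> x i" using LR(1)[OF i] g(3) by linarith
    next
      show "\<bar>spectral_radius n E - n / 2\<bar> \<le> \<delta> * n" using LR(2) le[of 1] by linarith
      show "\<bar>card L - n / 2\<bar> \<le> \<delta> * n" "\<bar>card R - n / 2\<bar> \<le> \<delta> * n" using LR(5,6) le[of 4] by linarith+
    next
      fix v assume "v \<in> L"
      then show "card {u \<in> R. \<not> E v u} \<le> \<delta> * n" using LR(7)[of v] le[of 19] by linarith
    next
      fix v assume "v \<in> R"
      then show "card {u \<in> L. \<not> E v u} \<le> \<delta> * n" using LR(8)[of v] le[of 19] by linarith
    qed (use x LR in auto)
  qed
qed

section \<open>Graphs close to a complete bipartite graph\<close>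

lemma deg_in_sum_swap:
  assumes "finite A" "finite B" and sym: "\<And>u v. E u v \<longleftrightarrow> E v u"
  shows "(\<Sum>a\<in>A. deg_in E B a) = (\<Sum>b\<in>B. deg_in E A b)"
  unfolding deg_in_def using sum_card_swap[OF assms(1,2), of E] sym by simp

text \<open>Each vertex outside \<open>B\<close> costs at most \<open>d\<close> for its own degree
  and at most \<open>d\<close> for the edges it sends into \<open>B\<close>.\<close>

lemma deg_sum_le:
  assumes fin: "finite S" and sub: "B \<subseteq> S" and sym: "\<And>u v. E u v \<longleftrightarrow> E v u"
    and d: "\<And>u. u \<in> S \<Longrightarrow> deg_in E S u \<le> d"
  shows "(\<Sum>u\<in>S. deg_in E S u) \<le> (\<Sum>u\<in>B. deg_in E B u) + 2 * d * card (S - B)"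
proof -
  have fB: "finite B" using fin sub finite_subset by blast
  have split: "deg_in E S u \<le> deg_in E B u + deg_in E (S - B) u" for u
  proof -
    have "{w \<in> S. E u w} = {w \<in> B. E u w} \<union> {w \<in> S - B. E u w}" using sub by blast
    then show ?thesis unfolding deg_in_def by (metis card_Un_le)
  qed
  have out: "(\<Sum>u\<in>S - B. deg_in E S u) \<le> d * card (S - B)"
    using sum_bounded_above[of "S - B" "deg_in E S" d] d by (simp add: mult.commute)
  have "(\<Sum>u\<in>S. deg_in E S u) = (\<Sum>u\<in>B. deg_in E S u) + (\<Sum>u\<in>S - B. deg_in E S u)"
    using sum.subset_diff[OF sub fin] by (simp add: add.commute)
  also have "(\<Sum>u\<in>B. deg_in E S u) \<le> (\<Sum>u\<in>B. deg_in E B u + deg_in E (S - B) u)"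
    by (rule sum_mono) (rule split)
  also have "\<dots> = (\<Sum>u\<in>B. deg_in E B u) + (\<Sum>u\<in>S - B. deg_in E B u)"
    using deg_in_sum_swap[of B "S - B" E] fin fB sym by (simp add: sum.distrib)
  also have "(\<Sum>u\<in>S - B. deg_in E B u) \<le> (\<Sum>u\<in>S - B. deg_in E S u)"
    unfolding deg_in_def using fin sub by (intro sum_mono card_mono) auto
  finally show ?thesis using out by simp
qed

lemma two_neighbours:
  assumes "2 \<le> deg_in E S u"
  obtains a b where "a \<in> S" "b \<in> S" "a \<noteq> b" "E u a" "E u b"
proof -
  obtain xs where "distinct xs" "length xs = 2" "set xs \<subseteq> {w \<in> S. E u w}"
    using assms distinct_list_in unfolding deg_in_def by metis
  moreover from this(2) obtain a b where "xs = [a, b]" by (auto simp: length_Suc_conv numeral_eq_Suc)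
  ultimately show thesis using that[of a b] by auto
qed

text \<open>In such a graph all neighbours of a vertex of degree 3 are leaves.\<close>

lemma deg_sum_no_path4:
  assumes fin: "finite S" and sym: "\<And>u v. E u v \<Longrightarrow> E v u" and irr: "\<And>u. \<not> E u u"
    and d3: "\<And>u. u \<in> S \<Longrightarrow> deg_in E S u \<le> 3"
    and no: "\<And>p1 p2 p3 p4. {p1, p2, p3, p4} \<subseteq> S \<Longrightarrow> distinct [p1, p2, p3, p4] \<Longrightarrow>
      E p1 p2 \<Longrightarrow> E p2 p3 \<Longrightarrow> E p3 p4 \<Longrightarrow> False"
  shows "(\<Sum>u\<in>S. deg_in E S u) \<le> 2 * card S"
proof -
  define T where "T = {u \<in> S. deg_in E S u = 3}"
  define U where "U = {u \<in> S. deg_in E S u = 1}"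
  have leaf: "\<exists>a. a \<in> S \<and> E u a \<and> {w \<in> S. E a w} = {u}" if "u \<in> T" for u
  proof -
    have u: "u \<in> S" "card {w \<in> S. E u w} = 3" using that unfolding T_def deg_in_def by auto
    then obtain a b c where abc: "{w \<in> S. E u w} = {a, b, c}" "distinct [a, b, c]"
      by (auto simp: card_3_iff)
    then have m: "a \<in> S" "b \<in> S" "c \<in> S" "E u a" "E u b" "E u c" by blast+
    have ne: "u \<noteq> a" "u \<noteq> b" "u \<noteq> c" using m irr by metis+
    have "y = u" if y: "y \<in> S" "E a y" for y
    proof (rule ccontr)
      assume "y \<noteq> u"
      have "y \<noteq> a" using y irr by metis
      \<comment> \<open>A further neighbour \<open>y\<close> of \<open>a\<close> would start the
        path \<open>y\<close>, \<open>a\<close>, \<open>u\<close>, \<open>b'\<close>.\<close>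
      obtain b' where "b' \<in> {b, c}" "b' \<noteq> y" using abc(2) by auto
      then show False using no[of y a u b'] m u y ne abc(2) sym \<open>y \<noteq> u\<close> \<open>y \<noteq> a\<close> by auto
    qed
    then have "{w \<in> S. E a w} = {u}" using m u sym by blast
    then show ?thesis using m by blast
  qed
  then obtain \<phi> where \<phi>: "\<And>u. u \<in> T \<Longrightarrow> \<phi> u \<in> S \<and> E u (\<phi> u) \<and> {w \<in> S. E (\<phi> u) w} = {u}" by metis
  have "inj_on \<phi> T" by (rule inj_onI) (metis \<phi> singleton_inject)
  moreover have "\<phi> ` T \<subseteq> U"
  proof
    fix a assume "a \<in> \<phi> ` T"
    then obtain u where u: "u \<in> T" "a = \<phi> u" by blast
    show "a \<in> U" unfolding U_def deg_in_def using \<phi>[OF u(1)] u(2) by simp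
  qed
  moreover have "finite U" "finite T" unfolding U_def T_def using fin by auto
  ultimately have "card T \<le> card U" by (metis card_inj_on_le)
  \<comment> \<open>A vertex of degree 3 exceeds 2 by one, and the injection \<phi> gives it a leaf
    of its own that falls short by one.\<close>
  have "(\<Sum>u\<in>S. deg_in E S u) + card U \<le> 2 * card S + card T"
  proof -
    have "(\<Sum>u\<in>S. deg_in E S u + (if u \<in> U then 1 else 0)) \<le> (\<Sum>u\<in>S. 2 + (if u \<in> T then 1 else 0))"
    proof (rule sum_mono)
      fix u assume u: "u \<in> S"
      have "deg_in E S u = 0 \<or> deg_in E S u = 1 \<or> deg_in E S u = 2 \<or> deg_in E S u = 3"
        using d3[OF u] by linarith
      then show "deg_in E S u + (if u \<in> U then 1 else 0) \<le> 2 + (if u \<in> T then 1 else 0)"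
        using u unfolding U_def T_def by auto
    qed
    moreover have "S \<inter> U = U" "S \<inter> T = T" unfolding U_def T_def by auto
    ultimately show ?thesis using fin unfolding sum.distrib by (simp add: sum.If_cases)
  qed
  then show ?thesis using \<open>card T \<le> card U\<close> by linarith
qed

lemma deg_sum_one_edge:
  assumes fin: "finite B" and irr: "\<And>u. \<not> E u u"
    and one: "\<And>a b a' b'. a \<in> B \<Longrightarrow> b \<in> B \<Longrightarrow> E a b \<Longrightarrow> a' \<in> B \<Longrightarrow> b' \<in> B \<Longrightarrow> E a' b' \<Longrightarrow> {a, b} = {a', b'}"
  shows "(\<Sum>u\<in>B. deg_in E B u) \<le> 2"
proof (cases "\<exists>a\<in>B. \<exists>b\<in>B. E a b")
  case True
  then obtain a b where ab: "a \<in> B" "b \<in> B" "E a b" by blast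
  have d1: "deg_in E B u \<le> 1" if u: "u \<in> B" for u
  proof -
    have "w = w'" if "w \<in> {w \<in> B. E u w}" "w' \<in> {w \<in> B. E u w}" for w w'
      using one[of u w u w'] that u by (auto simp: doubleton_eq_iff)
    moreover have "finite {w \<in> B. E u w}" using fin by simp
    ultimately show ?thesis unfolding deg_in_def by (auto simp: card_le_Suc0_iff_eq)
  qed
  have "(\<Sum>u\<in>B. deg_in E B u) = (\<Sum>u\<in>{a, b}. deg_in E B u)"
  proof (rule sum.mono_neutral_right[OF fin])
    show "{a, b} \<subseteq> B" using ab by simp
    show "\<forall>i\<in>B - {a, b}. deg_in E B i = 0"
    proof
      fix u assume u: "u \<in> B - {a, b}"
      have "\<not> E u w" if "w \<in> B" for w using one[of u w a b] ab u that by auto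
      then have "{w \<in> B. E u w} = {}" by blast
      then show "deg_in E B u = 0" unfolding deg_in_def by (simp only: card.empty)
    qed
  qed
  also have "\<dots> = deg_in E B a + deg_in E B b" using ab(3) irr by (cases "a = b") auto
  also have "\<dots> \<le> 2" using d1[OF ab(1)] d1[OF ab(2)] by linarith
  finally show ?thesis .
next
  case False
  have "deg_in E B u = 0" if "u \<in> B" for u
  proof -
    have "{w \<in> B. E u w} = {}" using False that by blast
    then show ?thesis unfolding deg_in_def by (simp only: card.empty)
  qed
  then show ?thesis by simp
qed

text \<open>The arithmetic shared by the two path arguments below: \<open>s\<close> is a degree sum,
  \<open>t\<close> bounds the average degree on the surviving set, and \<open>m\<close> is the price
  of each deleted vertex.\<close>

lemma chain_bound:
  fixes s b c c' c1 c2 c3 t m p :: nat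
  assumes "s \<le> b + m * c1" "b \<le> t * c'" "c' \<le> c" "c1 \<le> c2 + c3" "c3 \<le> p"
  shows "s \<le> t * c + m * (c2 + p)"
proof -
  have "m * c1 \<le> m * (c2 + p)" using assms(4,5) by (intro mult_left_mono) auto
  moreover have "t * c' \<le> t * c" using assms(3) by simp
  ultimately show ?thesis using assms(1,2) by linarith
qed

text \<open>The outcome of stability with \<delta> = 1/1000, and the spectral lower bound with
  99/100 in place of a margin tending to 1. The assumptions are symmetric in \<open>L\<close> and
  \<open>R\<close>, so \<open>swap\<close> yields every result for the other side.\<close>

locale near_join =
  fixes k n :: nat and E :: "nat \<Rightarrow> nat \<Rightarrow> bool" and x :: "nat \<Rightarrow> real" and r :: real and L R :: "nat set"
  assumes k: "k \<in> {4, 5}" and G: "graph_on n E" and free: "\<not> contains_wheel n E (2 * k)"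
    and n: "1000000 \<le> real n"
    and x_lo: "\<And>i. i < n \<Longrightarrow> 999 / 1000 \<le> x i" and x_up: "\<And>i. i < n \<Longrightarrow> x i \<le> 1"
    and eig: "\<And>i. i < n \<Longrightarrow> sum x {j. E i j} = r * x i"
    and r: "\<bar>r - n / 2\<bar> \<le> n / 1000"
    and low: "(real n)\<^sup>2 / 4 + 99 / 100 \<le> r\<^sup>2 - (real k - 1) * r"
    and LR: "L \<union> R = {..<n}" "L \<inter> R = {}"
    and cL: "\<bar>card L - n / 2\<bar> \<le> n / 1000" and cR: "\<bar>card R - n / 2\<bar> \<le> n / 1000"
    and nonL: "\<And>v. v \<in> L \<Longrightarrow> card {u \<in> R. \<not> E v u} \<le> n / 1000"
    and nonR: "\<And>v. v \<in> R \<Longrightarrow> card {u \<in> L. \<not> E v u} \<le> n / 1000"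
begin

lemma swap: "near_join k n E x r R L"
  by unfold_locales (use k G free n x_lo x_up eig r low LR cL cR nonL nonR in auto)

lemma sym: "E u v \<longleftrightarrow> E v u" using graph_onD(4)[OF G] by blast

lemma irrefl: "\<not> E u u" using graph_onD(3)[OF G] by blast

lemma fin: "finite L" "finite R" using LR(1) by (metis finite_Un finite_lessThan)+

lemma in_n: "v \<in> L \<Longrightarrow> v < n" "v \<in> R \<Longrightarrow> v < n" using LR by auto

lemma card_LR: "real (card L) + card R = n"
proof -
  have "card (L \<union> R) = card L + card R" using fin LR by (intro card_Un_disjoint) auto
  then show ?thesis using LR by (metis card_lessThan of_nat_add)
qed

definition common :: "nat set \<Rightarrow> nat set" where
  "common T = {u \<in> R. \<forall>t\<in>T. E t u}"

text \<open>The 6 leaves room for a vertex together with up to \<open>k \<le> 5\<close> of its inner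
  neighbours.\<close>

lemma common_miss:
  assumes "T \<subseteq> L" "finite T" "card T \<le> 6"
  shows "card (R - common T) \<le> 6 * (n / 1000)"
proof -
  have "R - common T \<subseteq> (\<Union>t\<in>T. {u \<in> R. \<not> E t u})" unfolding common_def by blast
  then have "card (R - common T) \<le> card (\<Union>t\<in>T. {u \<in> R. \<not> E t u})"
    using assms fin by (intro card_mono) auto
  also have "real \<dots> \<le> real 6 * (n / 1000)"
    by (rule card_UN_le_mult[OF assms(2,3)]) (use assms(1) nonL in auto)
  finally show ?thesis by simp
qed

lemma common_card:
  assumes "T \<subseteq> L" "finite T" "card T \<le> 6"
  shows "20 \<le> card (common T)"
proof -
  have sub: "common T \<subseteq> R" unfolding common_def by blast
  have "card R = card (common T) + card (R - common T)"
    using card_Un_disjoint[of "common T" "R - common T"] sub fin finite_subset[OF sub]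
    by (metis Diff_disjoint Un_Diff_cancel Un_absorb1 finite_Diff)
  then have "20 \<le> real (card (common T))"
    using common_miss[OF assms] cR n unfolding abs_le_iff by linarith
  then show ?thesis by simp
qed

text \<open>\<open>k\<close> inner neighbours of \<open>v\<close> and the vertices of
  \<open>R\<close> seen by all of them and by \<open>v\<close> would span a complete bipartite graph
  in the neighbourhood of \<open>v\<close>.\<close>

lemma deg_le: "v \<in> L \<Longrightarrow> deg_in E L v \<le> k - 1"
proof (rule ccontr)
  assume v: "v \<in> L" and "\<not> deg_in E L v \<le> k - 1"
  then have "k \<le> card {u \<in> L. E v u}" unfolding deg_in_def by simp
  then obtain T where T: "T \<subseteq> {u \<in> L. E v u}" "card T = k" "finite T"
    using obtain_subset_with_card_n by metis
  have "card (insert v T) \<le> 6" using T k by (auto simp: card_insert_if)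
  then have "20 \<le> card (common (insert v T))" using T v by (intro common_card) auto
  then have kB: "k \<le> card (common (insert v T))" using k by auto
  have "contains_wheel n E (2 * k)"
  proof (rule complete_bipartite_nbhd_wheel[OF G k _ kB])
    show "k \<le> card T" using T by simp
    show "E a b" if "a \<in> T" "b \<in> common (insert v T)" for a b using that unfolding common_def by simp
    show "E v a" if "a \<in> T \<union> common (insert v T)" for a using that T unfolding common_def by auto
  qed
  then show False using free by simp
qed

section \<open>The eigenvalue equation summed over one side\<close>

lemma weighted_degree:
  assumes "A \<subseteq> {..<n}"
  shows "r * sum x A = (\<Sum>i<n. deg_in E A i * x i)"
proof -
  have fA: "finite A" using assms finite_subset by blast
  have "r * sum x A = (\<Sum>v\<in>A. sum x {j. E v j})"
    using assms by (simp add: sum_distrib_left eig subset_iff)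
  also have "\<dots> = (\<Sum>v\<in>A. \<Sum>j<n. if E v j then x j else 0)"
  proof (rule sum.cong[OF refl])
    fix v
    have "{j. E v j} = {..<n} \<inter> {j. E v j}" by (auto dest: graph_onD[OF G])
    then have "sum x {j. E v j} = sum x ({..<n} \<inter> {j. E v j})" by simp
    then show "sum x {j. E v j} = (\<Sum>j<n. if E v j then x j else 0)"
      by (simp add: sum.inter_restrict)
  qed
  also have "\<dots> = (\<Sum>j<n. \<Sum>v\<in>A. if E v j then x j else 0)" by (rule sum.swap)
  also have "\<dots> = (\<Sum>j<n. deg_in E A j * x j)"
  proof (rule sum.cong[OF refl])
    fix j
    have "A \<inter> {v. E v j} = {u \<in> A. E j u}" using sym by auto
    then show "(\<Sum>v\<in>A. if E v j then x j else 0) = deg_in E A j * x j"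
      using fA unfolding deg_in_def by (simp add: sum.If_cases)
  qed
  finally show ?thesis .
qed

definition miss :: "nat \<Rightarrow> nat set \<Rightarrow> nat" where
  "miss v S = card {u \<in> S. \<not> E v u}"

lemma deg_in_miss: "finite S \<Longrightarrow> real (deg_in E S v) = card S - real (miss v S)"
  using card_split[of S "E v"] unfolding deg_in_def miss_def by linarith

text \<open>The complete join between the sides is the main term; inner degrees and missing cross
  edges appear as corrections.\<close>

lemma side_equation:
  "r * sum x L = (\<Sum>v\<in>L. deg_in E L v * x v) + card L * sum x R - (\<Sum>u\<in>R. miss u L * x u)"
proof -
  have "r * sum x L = (\<Sum>i<n. deg_in E L i * x i)" using LR by (intro weighted_degree) auto
  also have "\<dots> = (\<Sum>i\<in>L. deg_in E L i * x i) + (\<Sum>i\<in>R. deg_in E L i * x i)"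
    unfolding LR(1)[symmetric] using fin LR(2) by (rule sum.union_disjoint)
  also have "(\<Sum>i\<in>R. deg_in E L i * x i) = card L * sum x R - (\<Sum>u\<in>R. miss u L * x u)"
    by (simp add: deg_in_miss[OF fin(1)] left_diff_distrib sum_subtractf sum_distrib_left)
  finally show ?thesis by simp
qed

lemma x_nonneg: "i < n \<Longrightarrow> 0 \<le> x i" using x_lo[of i] by linarith

lemma weighted_bounds:
  fixes f :: "nat \<Rightarrow> nat"
  assumes "A \<subseteq> {..<n}"
  shows "999 / 1000 * (\<Sum>i\<in>A. f i) \<le> (\<Sum>i\<in>A. f i * x i)" "(\<Sum>i\<in>A. f i * x i) \<le> (\<Sum>i\<in>A. f i)"
proof -
  have "999 / 1000 * real (f i) \<le> f i * x i" if "i \<in> A" for i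
    using mult_left_mono[OF x_lo[of i], of "real (f i)"] that assms by auto
  then show "999 / 1000 * (\<Sum>i\<in>A. f i) \<le> (\<Sum>i\<in>A. f i * x i)"
    unfolding of_nat_sum sum_distrib_left by (intro sum_mono) auto
  have "f i * x i \<le> real (f i)" if "i \<in> A" for i
    using mult_left_mono[OF x_up[of i], of "real (f i)"] that assms by auto
  then show "(\<Sum>i\<in>A. f i * x i) \<le> (\<Sum>i\<in>A. f i)"
    unfolding of_nat_sum by (intro sum_mono) auto
qed

lemma weight_L: "999 / 1000 * card L \<le> sum x L" "sum x L \<le> card L"
  using weighted_bounds[of L "\<lambda>_. 1"] LR by auto

lemma miss_nonneg: "0 \<le> (\<Sum>u\<in>R. miss u L * x u)"
  using in_n x_nonneg by (intro sum_nonneg) auto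

lemma card_mult: "real (card L) * card R = (real n)\<^sup>2 / 4 - (card L - n / 2)\<^sup>2"
proof -
  have R: "real (card R) = real n - card L" using card_LR by linarith
  show ?thesis unfolding R by (simp add: power2_eq_square field_simps)
qed

lemma r_pos: "0 < r" using r n unfolding abs_le_iff by linarith

text \<open>Multiplying the two side equations, with inner degrees replaced by \<open>a\<close> and
  \<open>b\<close>, gives \<open>(r - a) * (r - b) \<le> card L * card R\<close>. For
  \<open>a + b = k - 1\<close> this is incompatible with \<open>low\<close>.\<close>

lemma max_degree_bound:
  assumes a: "\<And>v. v \<in> L \<Longrightarrow> deg_in E L v \<le> a" and b: "\<And>v. v \<in> R \<Longrightarrow> deg_in E R v \<le> b"
  shows "a + b \<noteq> k - 1 \<or> a * b = 0"
proof (rule ccontr)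
  interpret sw: near_join k n E x r R L by (rule swap)
  assume "\<not> ?thesis"
  then have ab: "a + b = k - 1" "a * b \<noteq> 0" by auto
  have XL: "0 < sum x L" and XR: "0 < sum x R"
    using weight_L sw.weight_L cL cR n unfolding abs_le_iff by linarith+
  have "(\<Sum>v\<in>L. deg_in E L v * x v) \<le> (\<Sum>v\<in>L. real a * x v)"
    using a in_n x_nonneg by (intro sum_mono mult_right_mono) auto
  then have "r * sum x L \<le> a * sum x L + card L * sum x R"
    using side_equation miss_nonneg by (simp add: sum_distrib_left)
  then have 1: "(r - a) * sum x L \<le> card L * sum x R" by (simp add: algebra_simps)
  have "(\<Sum>v\<in>R. deg_in E R v * x v) \<le> (\<Sum>v\<in>R. real b * x v)"
    using b in_n x_nonneg by (intro sum_mono mult_right_mono) auto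
  then have "r * sum x R \<le> b * sum x R + card R * sum x L"
    using sw.side_equation sw.miss_nonneg by (simp add: sum_distrib_left)
  then have 2: "(r - b) * sum x R \<le> card R * sum x L" by (simp add: algebra_simps)
  have "real (a + b) \<le> 4" using ab k by auto
  then have rb: "0 \<le> r - b" using r n unfolding abs_le_iff by simp
  have "((r - a) * sum x L) * ((r - b) * sum x R) \<le> (card L * sum x R) * (card R * sum x L)"
  proof (rule mult_mono[OF 1 2])
    show "0 \<le> card L * sum x R" using XR by simp
    show "0 \<le> (r - b) * sum x R" using XR rb by simp
  qed
  then have "((r - a) * (r - b)) * (sum x L * sum x R) \<le> (real (card L) * card R) * (sum x L * sum x R)"
    by (simp only: mult_ac)
  then have "(r - a) * (r - b) \<le> real (card L) * card R"
    using XL XR by (simp add: mult_le_cancel_right)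
  also have "\<dots> \<le> (real n)\<^sup>2 / 4" unfolding card_mult by simp
  finally have "r\<^sup>2 - real (a + b) * r + real (a * b) \<le> (real n)\<^sup>2 / 4"
    by (simp add: algebra_simps power2_eq_square)
  moreover have "real (a + b) = real k - 1" using ab(1) k by auto
  moreover have "1 \<le> real (a * b)" using ab(2) by (metis One_nat_def Suc_leI gr0I of_nat_1 of_nat_le_iff)
  ultimately show False using low by simp
qed

text \<open>Inserting the equation of \<open>R\<close> into that of \<open>L\<close> bounds the
  excess of \<open>r\<^sup>2\<close> over \<open>card L * card R\<close>, which is at least
  \<open>(real k - 1) * r\<close> by \<open>low\<close>, by the inner degree sums. As
  \<open>r\<close>, \<open>card L\<close> and \<open>sum x L\<close> are all near
  \<open>n / 2\<close>, the average inner degrees add up to nearly \<open>k - 1\<close> or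
  more.\<close>

lemma degree_sum_lower:
  "(real k - 1) * (49 / 100 * n) \<le> real (\<Sum>v\<in>L. deg_in E L v) + real (\<Sum>v\<in>R. deg_in E R v)"
proof -
  interpret sw: near_join k n E x r R L by (rule swap)
  define P where "P = real (\<Sum>v\<in>L. deg_in E L v)"
  define Q where "Q = real (\<Sum>v\<in>R. deg_in E R v)"
  have sub: "L \<subseteq> {..<n}" "R \<subseteq> {..<n}" using LR by auto
  have P0: "0 \<le> P" "0 \<le> Q" unfolding P_def Q_def by (simp_all add: sum_nonneg)
  have "r * sum x L \<le> P + card L * sum x R"
    using side_equation miss_nonneg weighted_bounds(2)[OF sub(1), of "deg_in E L"] unfolding P_def by linarith
  from mult_left_mono[OF this, of r]
  have 1: "r * (r * sum x L) \<le> r * P + card L * (r * sum x R)" using r_pos by (simp add: algebra_simps)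
  have "r * sum x R \<le> Q + card R * sum x L"
    using sw.side_equation sw.miss_nonneg weighted_bounds(2)[OF sub(2), of "deg_in E R"] unfolding Q_def by linarith
  from mult_left_mono[OF this, of "real (card L)"]
  have "card L * (r * sum x R) \<le> card L * Q + (real (card L) * card R) * sum x L"
    by (simp add: algebra_simps)
  with 1 have 2: "(r\<^sup>2 - real (card L) * card R) * sum x L \<le> r * P + card L * Q"
    by (simp add: algebra_simps power2_eq_square)
  have "real (card L) * card R \<le> (real n)\<^sup>2 / 4" unfolding card_mult by simp
  then have "(real k - 1) * r \<le> r\<^sup>2 - real (card L) * card R" using low by linarith
  moreover have XL: "498 / 1000 * n \<le> sum x L" using weight_L(1) cL n unfolding abs_le_iff by linarith
  ultimately have "((real k - 1) * r) * (498 / 1000 * n) \<le> (r\<^sup>2 - real (card L) * card R) * sum x L"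
    using k r_pos by (intro mult_mono) auto
  then have 3: "((real k - 1) * r) * (498 / 1000 * n) \<le> r * P + card L * Q" using 2 by linarith
  have "r * P + card L * Q \<le> (502 / 1000 * n) * P + (502 / 1000 * n) * Q"
    using r cL P0 n unfolding abs_le_iff by (intro add_mono mult_right_mono) auto
  moreover have "((real k - 1) * (498 / 1000 * n)) * (498 / 1000 * n) \<le> ((real k - 1) * r) * (498 / 1000 * n)"
    using r n k unfolding abs_le_iff by (intro mult_right_mono mult_left_mono) auto
  ultimately have "((real k - 1) * (498 / 1000 * n)) * (498 / 1000 * n)
      \<le> (502 / 1000 * n) * P + (502 / 1000 * n) * Q"
    using 3 by linarith
  moreover have "((real k - 1) * (498 / 1000 * n)) * (498 / 1000 * n)
      = ((real k - 1) * (498 / 1000 * 498 / 1000 * n)) * n" by simp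
  moreover have "(502 / 1000 * n) * P + (502 / 1000 * n) * Q = (502 / 1000 * (P + Q)) * n"
    by (simp add: algebra_simps)
  ultimately have "((real k - 1) * (498 / 1000 * 498 / 1000 * n)) * n \<le> (502 / 1000 * (P + Q)) * n"
    by (simp only:)
  then have "(real k - 1) * (498 / 1000 * 498 / 1000 * n) \<le> 502 / 1000 * (P + Q)"
    using n by (simp add: mult_le_cancel_right)
  moreover have "0 \<le> (real k - 1) * n" using k by auto
  ultimately have "(real k - 1) * (49 / 100 * n) \<le> P + Q" by (simp add: algebra_simps)
  then show ?thesis unfolding P_def Q_def .
qed

section \<open>Consequences of a vertex of large inner degree for the opposite side\<close>

lemma full_degree_one_edge:
  assumes v: "v \<in> L" "deg_in E L v = k - 1"
    and B: "B = common (insert v {u \<in> L. E v u})"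
    and e: "a \<in> B" "b \<in> B" "E a b" "a' \<in> B" "b' \<in> B" "E a' b'"
  shows "{a, b} = {a', b'}"
proof (rule ccontr)
  assume ne: "{a, b} \<noteq> {a', b'}"
  let ?T = "{u \<in> L. E v u}"
  have "card ?T = k - 1" using v unfolding deg_in_def by simp
  moreover have "card (insert v ?T) \<le> 6" using calculation k fin by (auto simp: card_insert_if)
  then have "20 \<le> card B" unfolding B using v fin by (intro common_card) auto
  then have "k + 1 \<le> card B" using k by auto
  ultimately have "contains_wheel n E (2 * k)"
  proof (rule two_edges_wheel[OF G k])
    show "E t b" if "t \<in> ?T" "b \<in> B" for t b using that unfolding B common_def by auto
    show "E v a" if "a \<in> ?T \<union> B" for a using that unfolding B common_def by auto
  qed (use e ne in auto)
  then show False using free by simp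
qed

text \<open>The common neighbourhood \<open>B\<close> spans at most one edge, and the at most
  \<open>6 * (n / 1000)\<close> vertices of \<open>R\<close> outside it cost at most 8 each.\<close>

lemma full_degree_opposite_sum:
  assumes v: "v \<in> L" "deg_in E L v = k - 1"
  shows "real (\<Sum>u\<in>R. deg_in E R u) \<le> n / 20"
proof -
  interpret sw: near_join k n E x r R L by (rule swap)
  let ?T = "insert v {u \<in> L. E v u}"
  define B where "B = common ?T"
  have sub: "B \<subseteq> R" unfolding B_def common_def by blast
  have "(\<Sum>u\<in>B. deg_in E B u) \<le> 2"
  proof (rule deg_sum_one_edge)
    show "finite B" using sub fin finite_subset by blast
  qed (rule irrefl, rule full_degree_one_edge[OF v B_def])
  moreover have "(\<Sum>u\<in>R. deg_in E R u) \<le> (\<Sum>u\<in>B. deg_in E B u) + 2 * 4 * card (R - B)"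
  proof (rule deg_sum_le[OF fin(2) sub sym])
    show "deg_in E R u \<le> 4" if "u \<in> R" for u using sw.deg_le[OF that] k by auto
  qed
  moreover have "real (card (R - B)) \<le> 6 * (n / 1000)"
    unfolding B_def using v k fin by (intro common_miss) (auto simp: card_insert_if deg_in_def)
  ultimately have "real (\<Sum>u\<in>R. deg_in E R u) \<le> 2 + 8 * (6 * (n / 1000))" by linarith
  then show ?thesis using n by linarith
qed

text \<open>The common neighbours of \<open>v\<close> and \<open>k - 2\<close> of its inner
  neighbours contain no two disjoint paths on three vertices. Deleting one such path leaves maximum
  degree 1; \<open>n / 20\<close> pays for all deleted vertices.\<close>

lemma two_path3_opposite_sum:
  assumes v: "v \<in> L" "k - 2 \<le> deg_in E L v"
  shows "real (\<Sum>u\<in>R. deg_in E R u) \<le> card R + n / 20"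
proof -
  interpret sw: near_join k n E x r R L by (rule swap)
  obtain T where T: "T \<subseteq> {u \<in> L. E v u}" "card T = k - 2" "finite T"
    using v(2) obtain_subset_with_card_n unfolding deg_in_def by metis
  let ?T = "insert v T"
  define B where "B = common ?T"
  have sub: "B \<subseteq> R" unfolding B_def common_def by blast
  have fB: "finite B" using sub fin finite_subset by blast
  have T6: "?T \<subseteq> L" "finite ?T" "card ?T \<le> 6" using T v k by (auto simp: card_insert_if)
  have cB: "7 \<le> card B" using common_card[OF T6] unfolding B_def by simp
  have mB: "real (card (R - B)) \<le> 6 * (n / 1000)" using common_miss[OF T6] unfolding B_def by simp
  have no: False if "distinct [p1, p2, p3, q1, q2, q3]" "{p1, p2, p3, q1, q2, q3} \<subseteq> B"
    "E p1 p2" "E p2 p3" "E q1 q2" "E q2 q3" for p1 p2 p3 q1 q2 q3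
  proof -
    have "contains_wheel n E (2 * k)"
    proof (rule two_paths3_wheel[OF G k T(2) cB _ _ that])
      show "E t b" if "t \<in> T" "b \<in> B" for t b using that unfolding B_def common_def by auto
      show "E v a" if "a \<in> T \<union> B" for a using that T unfolding B_def common_def by auto
    qed
    then show False using free by simp
  qed
  obtain B' where B': "B' \<subseteq> B" "card (B - B') \<le> 3" "\<And>u. u \<in> B' \<Longrightarrow> deg_in E B' u \<le> 1"
  proof (cases "\<exists>p\<in>B. 2 \<le> deg_in E B p")
    case True
    then obtain p a b where p: "p \<in> B" "a \<in> B" "b \<in> B" "a \<noteq> b" "E p a" "E p b"
      by (metis two_neighbours)
    have "deg_in E (B - {a, p, b}) u \<le> 1" if u: "u \<in> B - {a, p, b}" for u
    proof (rule ccontr)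
      assume "\<not> ?thesis"
      then have "2 \<le> deg_in E (B - {a, p, b}) u" by simp
      then obtain c d where c: "c \<in> B - {a, p, b}" "d \<in> B - {a, p, b}" "c \<noteq> d" "E u c" "E u d"
        by (rule two_neighbours)
      show False
      proof (rule no[of a p b c u d])
        show "distinct [a, p, b, c, u, d]" using p c u irrefl by auto
        show "{a, p, b, c, u, d} \<subseteq> B" using p c u by auto
      qed (use p c sym in blast)+
    qed
    moreover have "card (B - (B - {a, p, b})) \<le> 3"
    proof -
      have "card (B - (B - {a, p, b})) \<le> card {a, p, b}" by (intro card_mono) auto
      also have "\<dots> \<le> 3" by (simp add: card_insert_if)
      finally show ?thesis .
    qed
    ultimately show thesis using that[of "B - {a, p, b}"] by auto
  next
    case False
    then show thesis using that[of B] by fastforce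
  qed
  have A: "(\<Sum>u\<in>R. deg_in E R u) \<le> (\<Sum>u\<in>B'. deg_in E B' u) + 2 * 4 * card (R - B')"
  proof (rule deg_sum_le[OF fin(2) _ sym])
    show "B' \<subseteq> R" using B' sub by blast
    show "deg_in E R u \<le> 4" if "u \<in> R" for u using sw.deg_le[OF that] k by auto
  qed
  have 1: "(\<Sum>u\<in>B'. deg_in E B' u) \<le> 1 * card B'"
    using sum_bounded_above[of B' "deg_in E B'" 1] B'(3) by simp
  have 2: "card B' \<le> card R" using B' sub fin by (intro card_mono) auto
  have 3: "card (R - B') \<le> card (R - B) + card (B - B')"
  proof -
    have "R - B' = (R - B) \<union> (B - B')" using B' sub by blast
    then show ?thesis by (metis card_Un_le)
  qed
  have "real (\<Sum>u\<in>R. deg_in E R u) \<le> real (1 * card R + 2 * 4 * (card (R - B) + 3))"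
    using chain_bound[OF A 1 2 3 B'(2)] by (simp only: of_nat_le_iff)
  then show ?thesis using mB n by simp
qed

text \<open>As before with paths on four vertices: once one is deleted, none is left, and then
  degrees of at most 3 have average at most 2.\<close>

lemma two_path4_opposite_sum:
  assumes k5: "k = 5" and v: "v \<in> L" "2 \<le> deg_in E L v" and d3: "\<And>u. u \<in> R \<Longrightarrow> deg_in E R u \<le> 3"
  shows "real (\<Sum>u\<in>R. deg_in E R u) \<le> 2 * card R + n / 20"
proof -
  obtain T where T: "T \<subseteq> {u \<in> L. E v u}" "card T = 2" "finite T"
    using v(2) obtain_subset_with_card_n unfolding deg_in_def by metis
  let ?T = "insert v T"
  define B where "B = common ?T"
  have sub: "B \<subseteq> R" unfolding B_def common_def by blast
  have fB: "finite B" using sub fin finite_subset by blast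
  have T6: "?T \<subseteq> L" "finite ?T" "card ?T \<le> 6" using T v by (auto simp: card_insert_if)
  have mB: "real (card (R - B)) \<le> 6 * (n / 1000)" using common_miss[OF T6] unfolding B_def by simp
  have no: False if "distinct [p1, p2, p3, p4, q1, q2, q3, q4]" "{p1, p2, p3, p4, q1, q2, q3, q4} \<subseteq> B"
    "E p1 p2" "E p2 p3" "E p3 p4" "E q1 q2" "E q2 q3" "E q3 q4" for p1 p2 p3 p4 q1 q2 q3 q4
  proof -
    have "contains_wheel n E 10"
    proof (rule two_paths4_wheel[OF G T(2) _ _ that])
      show "E t b" if "t \<in> T" "b \<in> B" for t b using that unfolding B_def common_def by auto
      show "E v a" if "a \<in> T \<union> B" for a using that T unfolding B_def common_def by auto
    qed
    then show False using free k5 by simp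
  qed
  define path4 where "path4 S p1 p2 p3 p4 \<longleftrightarrow> {p1, p2, p3, p4} \<subseteq> S \<and> distinct [p1, p2, p3, p4] \<and>
    E p1 p2 \<and> E p2 p3 \<and> E p3 p4" for S p1 p2 p3 p4
  obtain B' where B': "B' \<subseteq> B" "card (B - B') \<le> 4" "\<And>p1 p2 p3 p4. \<not> path4 B' p1 p2 p3 p4"
  proof (cases "\<exists>p1 p2 p3 p4. path4 B p1 p2 p3 p4")
    case True
    then obtain p1 p2 p3 p4 where p: "path4 B p1 p2 p3 p4" by blast
    let ?P = "{p1, p2, p3, p4}"
    have "\<not> path4 (B - ?P) q1 q2 q3 q4" for q1 q2 q3 q4
    proof
      assume q: "path4 (B - ?P) q1 q2 q3 q4"
      show False
      proof (rule no[of p1 p2 p3 p4 q1 q2 q3 q4])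
        show "distinct [p1, p2, p3, p4, q1, q2, q3, q4]" using p q unfolding path4_def by auto
        show "{p1, p2, p3, p4, q1, q2, q3, q4} \<subseteq> B" using p q unfolding path4_def by auto
      qed (use p q in \<open>auto simp: path4_def\<close>)
    qed
    moreover have "card (B - (B - ?P)) \<le> 4"
    proof -
      have "card (B - (B - ?P)) \<le> card ?P" by (intro card_mono) auto
      also have "\<dots> \<le> 4" by (simp add: card_insert_if)
      finally show ?thesis .
    qed
    ultimately show thesis using that[of "B - ?P"] by blast
  next
    case False
    then show thesis using that[of B] by simp
  qed
  have fB': "finite B'" using B'(1) fB finite_subset by blast
  have A: "(\<Sum>u\<in>R. deg_in E R u) \<le> (\<Sum>u\<in>B'. deg_in E B' u) + 2 * 3 * card (R - B')"
    by (rule deg_sum_le[OF fin(2) _ sym d3]) (use B' sub in auto)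
  have 1: "(\<Sum>u\<in>B'. deg_in E B' u) \<le> 2 * card B'"
  proof (rule deg_sum_no_path4[OF fB'])
    show "deg_in E B' u \<le> 3" if "u \<in> B'" for u
    proof -
      have "deg_in E B' u \<le> deg_in E R u"
        unfolding deg_in_def using fin B'(1) sub by (intro card_mono) auto
      also have "\<dots> \<le> 3" using that B'(1) sub by (intro d3) auto
      finally show ?thesis .
    qed
    show "E v u" if "E u v" for u v using that sym by blast
    show False if "{p1, p2, p3, p4} \<subseteq> B'" "distinct [p1, p2, p3, p4]" "E p1 p2" "E p2 p3" "E p3 p4"
      for p1 p2 p3 p4 using that B'(3)[of p1 p2 p3 p4] unfolding path4_def by blast
  qed (rule irrefl)
  have 2: "card B' \<le> card R" using B' sub fin by (intro card_mono) auto
  have 3: "card (R - B') \<le> card (R - B) + card (B - B')"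
  proof -
    have "R - B' = (R - B) \<union> (B - B')" using B' sub by blast
    then show ?thesis by (metis card_Un_le)
  qed
  have "real (\<Sum>u\<in>R. deg_in E R u) \<le> real (2 * card R + 2 * 3 * (card (R - B) + 4))"
    using chain_bound[OF A 1 2 3 B'(2)] by (simp only: of_nat_le_iff)
  then show ?thesis using mB n by simp
qed

text \<open>If both sides have vertices of sufficient inner degree, the path bounds contradict
  \<open>degree_sum_lower\<close>. Otherwise the degree bounds are (1,2) for \<open>k = 4\<close>,
  or (3,1) or (2,2) for \<open>k = 5\<close>, up to exchanging sides, and
  \<open>max_degree_bound\<close> applies.\<close>

lemma full_degree_vertex:
  "(\<exists>v\<in>L. deg_in E L v = k - 1) \<or> (\<exists>v\<in>R. deg_in E R v = k - 1)"
proof (rule ccontr)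
  interpret sw: near_join k n E x r R L by (rule swap)
  assume none: "\<not> ?thesis"
  have L: "deg_in E L v \<le> k - 2" if "v \<in> L" for v
  proof -
    have "deg_in E L v \<noteq> k - 1" using none that by blast
    then show ?thesis using deg_le[OF that] by linarith
  qed
  have R: "deg_in E R v \<le> k - 2" if "v \<in> R" for v
  proof -
    have "deg_in E R v \<noteq> k - 1" using none that by blast
    then show ?thesis using sw.deg_le[OF that] by linarith
  qed
  note bnd = cL cR n degree_sum_lower
  from k consider "k = 4" | "k = 5" by auto
  then show False
  proof cases
    case 1
    show False
    proof (cases "(\<exists>v\<in>L. 2 \<le> deg_in E L v) \<and> (\<exists>v\<in>R. 2 \<le> deg_in E R v)")
      case True
      then obtain v w where vw: "v \<in> L" "2 \<le> deg_in E L v" "w \<in> R" "2 \<le> deg_in E R w" by blast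
      have "k - 2 \<le> deg_in E L v" "k - 2 \<le> deg_in E R w" using vw 1 by simp_all
      \<comment> \<open>The total inner degree is at most 1.1 \<open>n\<close>, short of the
        required 1.47 \<open>n\<close>.\<close>
      from two_path3_opposite_sum[OF vw(1) this(1)] sw.two_path3_opposite_sum[OF vw(3) this(2)]
      show False using bnd 1 unfolding abs_le_iff by simp
    next
      case False
      then consider "\<forall>v\<in>L. \<not> 2 \<le> deg_in E L v" | "\<forall>v\<in>R. \<not> 2 \<le> deg_in E R v" by blast
      then show False
      proof cases
        case 1
        then have "deg_in E L v \<le> 1" if "v \<in> L" for v using that by force
        then show False using max_degree_bound[of 1 2] R \<open>k = 4\<close> by simp
      next
        case 2
        then have "deg_in E R v \<le> 1" if "v \<in> R" for v using that by force
        then show False using max_degree_bound[of 2 1] L \<open>k = 4\<close> by simp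
      qed
    qed
  next
    case 2
    have L3: "deg_in E L v \<le> 3" if "v \<in> L" for v using L[OF that] 2 by simp
    have R3: "deg_in E R v \<le> 3" if "v \<in> R" for v using R[OF that] 2 by simp
    consider v where "v \<in> L" "3 \<le> deg_in E L v" | v where "v \<in> R" "3 \<le> deg_in E R v"
      | "\<forall>v\<in>L. \<not> 3 \<le> deg_in E L v" "\<forall>v\<in>R. \<not> 3 \<le> deg_in E R v" by blast
    then show False
    proof cases
      case (1 v)
      have "k - 2 \<le> deg_in E L v" using 1 2 by simp
      note a = two_path3_opposite_sum[OF 1(1) this]
      show False
      proof (cases "\<exists>w\<in>R. 2 \<le> deg_in E R w")
        case True
        then obtain w where w: "w \<in> R" "2 \<le> deg_in E R w" by blast
        \<comment> \<open>The total is at most about 1.6 \<open>n\<close>, short of the required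
          1.96 \<open>n\<close>.\<close>
        from sw.two_path4_opposite_sum[OF 2 w L3] a show False using bnd 2 unfolding abs_le_iff by simp
      next
        case False
        have "deg_in E R w \<le> 1" if "w \<in> R" for w
        proof -
          have "\<not> 2 \<le> deg_in E R w" using False that by blast
          then show ?thesis by linarith
        qed
        then show False using max_degree_bound[of 3 1] L3 2 by simp
      qed
    next
      case (2 v)
      have "k - 2 \<le> deg_in E R v" using 2 \<open>k = 5\<close> by simp
      note a = sw.two_path3_opposite_sum[OF 2(1) this]
      show False
      proof (cases "\<exists>w\<in>L. 2 \<le> deg_in E L w")
        case True
        then obtain w where w: "w \<in> L" "2 \<le> deg_in E L w" by blast
        from two_path4_opposite_sum[OF \<open>k = 5\<close> w R3] a show False using bnd \<open>k = 5\<close> unfolding abs_le_iff by simp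
      next
        case False
        have "deg_in E L w \<le> 1" if "w \<in> L" for w
        proof -
          have "\<not> 2 \<le> deg_in E L w" using False that by blast
          then show ?thesis by linarith
        qed
        then show False using max_degree_bound[of 1 3] R3 \<open>k = 5\<close> by simp
      qed
    next
      case 3
      then have "deg_in E L v \<le> 2" if "v \<in> L" for v using that by force
      moreover have "deg_in E R v \<le> 2" if "v \<in> R" for v using 3 that by force
      ultimately show False using max_degree_bound[of 2 2] 2 by simp
    qed
  qed
qed

section \<open>Second order analysis and the exact structure\<close>

lemma defect_inequality:
  defines "M \<equiv> \<Sum>v\<in>L. miss v R" and "D \<equiv> \<Sum>v\<in>L. k - 1 - deg_in E L v"
  shows "(card L - n / 2)\<^sup>2 + 99 / 100 * (2 * M + D) + 99 / 100 \<le> 1000 / 999 * real (\<Sum>u\<in>R. deg_in E R u)"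
proof -
  interpret sw: near_join k n E x r R L by (rule swap)
  define Q where "Q = real (\<Sum>u\<in>R. deg_in E R u)"
  have sub: "L \<subseteq> {..<n}" "R \<subseteq> {..<n}" using LR by auto
  have M': "M = (\<Sum>u\<in>R. miss u L)"
    unfolding M_def miss_def using sum_card_swap[OF fin, of "\<lambda>v u. \<not> E v u"] sym by simp
  have km: "real (k - 1) = real k - 1" using k by auto
  define X where "X = sum x L"
  define DX where "DX = (\<Sum>v\<in>L. (k - 1 - deg_in E L v) * x v)"
  define mR where "mR = (\<Sum>u\<in>R. miss u L * x u)"
  define mL where "mL = (\<Sum>v\<in>L. miss v R * x v)"
  define QX where "QX = (\<Sum>u\<in>R. deg_in E R u * x u)"
  \<comment> \<open>The truncated subtraction is exact by \<open>deg_le\<close>.\<close>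
  have "deg_in E L v * x v = (real k - 1) * x v - real (k - 1 - deg_in E L v) * x v" if "v \<in> L" for v
    using deg_le[OF that] km by (simp add: of_nat_diff algebra_simps)
  then have "(\<Sum>v\<in>L. deg_in E L v * x v) = (real k - 1) * X - DX"
    unfolding X_def DX_def sum_distrib_left sum_subtractf[symmetric] by (rule sum.cong[OF refl])
  then have e1: "r * X = (real k - 1) * X - DX + card L * sum x R - mR"
    using side_equation unfolding X_def mR_def by linarith
  have e2: "r * sum x R = QX + card R * X - mL"
    using sw.side_equation unfolding X_def mL_def QX_def sw.miss_def miss_def by linarith
  \<comment> \<open>Inserting one side equation into the other now keeps every error term. A missing
    cross edge lowers both equations, whence \<open>2 * M\<close> in the conclusion, while a missing
    inner degree lowers only that of \<open>L\<close>.\<close>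
  have "(r\<^sup>2 - (real k - 1) * r) * X = r * (r * X - (real k - 1) * X)"
    by (simp add: power2_eq_square algebra_simps)
  also have "\<dots> = card L * (r * sum x R) - r * DX - r * mR"
    unfolding e1 by (simp add: algebra_simps)
  also have "\<dots> = (real (card L) * card R) * X + card L * QX - card L * mL - r * DX - r * mR"
    unfolding e2 by (simp add: algebra_simps)
  finally have eq: "(r\<^sup>2 - (real k - 1) * r) * X =
    (real (card L) * card R) * X + card L * QX - card L * mL - r * DX - r * mR" .
  have X0: "0 < X" "card L \<le> 1000 / 999 * X" "X \<le> card L"
    using weight_L cL n unfolding X_def abs_le_iff by linarith+
  have rX: "995 / 1000 * X \<le> r" using X0 cL r n unfolding abs_le_iff by linarith
  have QX: "0 \<le> QX" "QX \<le> Q"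
    using weighted_bounds[OF sub(2), of "deg_in E R"] unfolding QX_def Q_def
    by (auto intro: order_trans[rotated] simp: sum_nonneg)
  have lo: "999 / 1000 * M \<le> mL" "999 / 1000 * M \<le> mR" "999 / 1000 * D \<le> DX"
    using weighted_bounds(1)[OF sub(1), of "\<lambda>v. miss v R"] weighted_bounds(1)[OF sub(2), of "\<lambda>u. miss u L"]
      weighted_bounds(1)[OF sub(1), of "\<lambda>v. k - 1 - deg_in E L v"]
    unfolding mL_def mR_def DX_def M'[symmetric] unfolding M_def D_def by auto
  \<comment> \<open>\<open>X\<close>, \<open>card L\<close> and \<open>r\<close> agree up to factors
    near 1, which the constants 99/100 and 1000/999 absorb when \<open>X\<close> is
    cancelled.\<close>
  have a1: "card L * QX \<le> (1000 / 999 * X) * Q" using X0 QX by (intro mult_mono) auto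
  have a2: "X * (999 / 1000 * M) \<le> card L * mL" using X0 lo by (intro mult_mono) auto
  have a3: "(995 / 1000 * X) * (999 / 1000 * D) \<le> r * DX" using X0 rX r_pos lo by (intro mult_mono) auto
  have a4: "(995 / 1000 * X) * (999 / 1000 * M) \<le> r * mR" using X0 rX r_pos lo by (intro mult_mono) auto
  have a5: "0 \<le> X * M" "0 \<le> X * D" using X0 by auto
  have b: "(1000 / 999 * X) * Q = 1000 / 999 * (X * Q)" "X * (999 / 1000 * M) = 999 / 1000 * (X * M)"
    "(995 / 1000 * X) * (999 / 1000 * D) = 994005 / 1000000 * (X * D)"
    "(995 / 1000 * X) * (999 / 1000 * M) = 994005 / 1000000 * (X * M)" by simp_all
  have c: "(real (card L) * card R + 1000 / 999 * Q - 99 / 100 * (2 * M + D)) * X =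
    (real (card L) * card R) * X + 1000 / 999 * (X * Q) - 198 / 100 * (X * M) - 99 / 100 * (X * D)"
    by (simp add: algebra_simps)
  have "(r\<^sup>2 - (real k - 1) * r) * X \<le>
    (real (card L) * card R + 1000 / 999 * Q - 99 / 100 * (2 * M + D)) * X"
    unfolding eq c using a1 a2 a3 a4 a5 unfolding b by argo
  then have "r\<^sup>2 - (real k - 1) * r \<le> real (card L) * card R + 1000 / 999 * Q - 99 / 100 * (2 * M + D)"
    using X0 by (simp add: mult_le_cancel_right)
  moreover have "real (2 * M + D) = 2 * real M + real D" by simp
  ultimately have "(card L - n / 2)\<^sup>2 + 99 / 100 * (2 * M + D) + 99 / 100 \<le> 1000 / 999 * Q"
    using low unfolding card_mult by argo
  then show ?thesis unfolding Q_def by simp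
qed

text \<open>The first bound on the defects is only linear in \<open>n\<close>, but it suffices to
  find one vertex untouched by them. Around it \<open>R\<close> has at most one edge, and fed back
  into the defect inequality this leaves only bounded slack.\<close>

lemma extremal_structure:
  assumes v0: "v0 \<in> L" "deg_in E L v0 = k - 1"
  shows "\<forall>u\<in>L. \<forall>v\<in>R. E u v" "in_U_family k E L" "card (edges_in E R) = 1" "\<bar>card L - n / 2\<bar> \<le> 1"
proof -
  define M where "M = (\<Sum>v\<in>L. miss v R)"
  define D where "D = (\<Sum>v\<in>L. k - 1 - deg_in E L v)"
  define Q where "Q = (\<Sum>u\<in>R. deg_in E R u)"
  note ineq = defect_inequality[folded M_def D_def Q_def]
  have "real Q \<le> n / 20" using full_degree_opposite_sum[OF v0] unfolding Q_def .
  moreover have "0 \<le> (card L - n / 2)\<^sup>2" by simp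
  ultimately have small: "2 * real M + D \<le> 6 / 100 * n" using ineq n by argo
  define W where "W = {v \<in> L. miss v R \<noteq> 0}"
  define W' where "W' = {v \<in> L. deg_in E L v \<noteq> k - 1}"
  have finW: "finite W" "finite W'" unfolding W_def W'_def using fin by auto
  have cW: "card W \<le> M"
  proof -
    have "card W = (\<Sum>v\<in>W. 1)" by simp
    also have "\<dots> \<le> (\<Sum>v\<in>W. miss v R)" by (rule sum_mono) (auto simp: W_def)
    also have "\<dots> \<le> M" unfolding M_def using fin by (intro sum_mono2) (auto simp: W_def)
    finally show ?thesis .
  qed
  have cW': "card W' \<le> D"
  proof -
    have "1 \<le> k - 1 - deg_in E L v" if "v \<in> W'" for v
      using that deg_le[of v] unfolding W'_def by auto
    then have "(\<Sum>v\<in>W'. 1) \<le> (\<Sum>v\<in>W'. k - 1 - deg_in E L v)" by (rule sum_mono)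
    also have "\<dots> \<le> D" unfolding D_def using fin by (intro sum_mono2) (auto simp: W'_def)
    finally show ?thesis by simp
  qed
  \<comment> \<open>A vertex of \<open>L\<close> outside \<open>W\<close>, \<open>W'\<close> and
    \<open>N\<close> has full inner degree, and neither it nor an inner neighbour misses a vertex of
    \<open>R\<close>. The three sets have at most \<open>5 * M + D\<close> elements.\<close>
  define N where "N = (\<Union>w\<in>W. {u \<in> L. E w u})"
  have "real (card N) \<le> real M * 4" unfolding N_def
  proof (rule card_UN_le_mult[OF finW(1) cW])
    fix w assume "w \<in> W"
    then show "real (card {u \<in> L. E w u}) \<le> 4" using deg_le[of w] k unfolding W_def deg_in_def by auto
  qed simp
  moreover have "card (W \<union> W' \<union> N) \<le> card W + card W' + card N"
    using card_Un_le[of "W \<union> W'" N] card_Un_le[of W W'] by linarith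
  ultimately have lt: "real (card (W \<union> W' \<union> N)) < card L"
    using cW cW' small cL n unfolding abs_le_iff by linarith
  have "finite (W \<union> W' \<union> N)" using finW fin unfolding N_def by auto
  then have "\<not> L \<subseteq> W \<union> W' \<union> N" using lt card_mono[of "W \<union> W' \<union> N" L] by auto
  then obtain v where v: "v \<in> L" "v \<notin> W" "v \<notin> W'" "v \<notin> N" by blast
  have dv: "deg_in E L v = k - 1" using v unfolding W'_def by blast
  have full: "E t u" if "t \<in> L" "t \<notin> W" "u \<in> R" for t u
  proof -
    have "card {u \<in> R. \<not> E t u} = 0" using that unfolding W_def miss_def by auto
    then show ?thesis using that fin by auto
  qed
  have "R = common (insert v {u \<in> L. E v u})"
  proof -
    have "t \<notin> W" if "t \<in> L" "E v t" for t using that v sym unfolding N_def by blast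
    then show ?thesis unfolding common_def using full v by auto
  qed
  note one = full_degree_one_edge[OF v(1) dv this]
  have "Q \<le> 2" unfolding Q_def by (rule deg_sum_one_edge[OF fin(2)]) (rule irrefl, rule one)
  then have Q2: "real Q \<le> 2" by simp
  have nonneg: "0 \<le> real M" "0 \<le> real D" "0 \<le> (card L - n / 2)\<^sup>2" by simp_all
  \<comment> \<open>With \<open>Q \<le> 2\<close> the right side of \<open>ineq\<close> is at most
    2000/999, while \<open>M \<ge> 1\<close> or \<open>D \<ge> 2\<close> makes the left side at
    least 2.97.\<close>
  have M0: "M = 0"
  proof (rule ccontr)
    assume "M \<noteq> 0"
    then have "1 \<le> real M" by simp
    then show False using ineq Q2 nonneg by argo
  qed
  have D1: "D \<le> 1"
  proof (rule ccontr)
    assume "\<not> D \<le> 1"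
    then have "2 \<le> real D" by simp
    then show False using ineq Q2 nonneg by argo
  qed
  have "W = {}" using cW M0 finW by simp
  then show join: "\<forall>u\<in>L. \<forall>v\<in>R. E u v" using full by blast
  have "Q \<noteq> 0"
  proof
    assume "Q = 0"
    then have "real Q = 0" by simp
    then show False using ineq nonneg by argo
  qed
  then obtain a where a: "a \<in> R" "deg_in E R a \<noteq> 0" unfolding Q_def by (meson sum.neutral)
  then have "{w \<in> R. E a w} \<noteq> {}" unfolding deg_in_def by (metis card.empty)
  then obtain b where ab: "b \<in> R" "E a b" by blast
  have "edges_in E R = {{a, b}}"
    unfolding edges_in_def using one[OF _ _ _ a(1) ab] a(1) ab by blast
  then show "card (edges_in E R) = 1" by simp
  show "\<bar>card L - n / 2\<bar> \<le> 1"
  proof (rule ccontr)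
    \<comment> \<open>\<open>card L - n / 2\<close> is half of the integer \<open>t\<close>, so
      exceeding 1 in absolute value means reaching 3/2; then \<open>9 / 4 + 99 / 100\<close> is too
      large for \<open>ineq\<close>.\<close>
    define t where "t = 2 * int (card L) - int n"
    have t: "real_of_int t = 2 * (card L - n / 2)" unfolding t_def by simp
    assume "\<not> \<bar>card L - n / 2\<bar> \<le> 1"
    then have "2 < real_of_int \<bar>t\<bar>" unfolding of_int_abs t abs_mult by simp
    then have "3 \<le> \<bar>t\<bar>" by linarith
    then have "3 \<le> real_of_int \<bar>t\<bar>" by linarith
    then have "3 / 2 \<le> \<bar>card L - n / 2\<bar>" unfolding of_int_abs t abs_mult by simp
    then have "(3 / 2)\<^sup>2 \<le> \<bar>card L - n / 2\<bar>\<^sup>2" by (rule power_mono) simp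
    then have "9 / 4 \<le> (card L - n / 2)\<^sup>2" by (simp add: power_divide)
    then show False using ineq Q2 nonneg by argo
  qed
  have "regular_on E L (k - 1) \<or> nearly_regular_on E L (k - 1)"
  proof (cases "D = 0")
    case True
    then have "k - 1 - deg_in E L v = 0" if "v \<in> L" for v using that fin unfolding D_def by simp
    then have "deg_in E L v = k - 1" if "v \<in> L" for v using deg_le[OF that] that by (metis diff_is_0_eq le_antisym)
    then show ?thesis unfolding regular_on_def by blast
  next
    case False
    then have "D = Suc 0" using D1 by simp
    then have "\<exists>w\<in>L. k - 1 - deg_in E L w = Suc 0 \<and> (\<forall>v\<in>L. w \<noteq> v \<longrightarrow> k - 1 - deg_in E L v = 0)"
      unfolding D_def by (simp only: sum_eq_Suc0_iff[OF fin(1)])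
    then obtain w where w: "w \<in> L" "k - 1 - deg_in E L w = Suc 0"
      "\<And>v. v \<in> L \<Longrightarrow> w \<noteq> v \<Longrightarrow> k - 1 - deg_in E L v = 0" by blast
    have "deg_in E L w = k - 1 - 1" using w(2) by linarith
    moreover have "deg_in E L v = k - 1" if "v \<in> L - {w}" for v
    proof -
      have "k - 1 - deg_in E L v = 0" using w(3) that by blast
      moreover have "deg_in E L v \<le> k - 1" using deg_le that by blast
      ultimately show ?thesis by linarith
    qed
    ultimately show ?thesis unfolding nearly_regular_on_def using w(1) by blast
  qed
  moreover have "\<not> has_path_on E L (2 * k - 1)"
  proof
    assume p: "has_path_on E L (2 * k - 1)"
    \<comment> \<open>The end \<open>b\<close> of the edge in \<open>R\<close> closes the path to a
      cycle of length \<open>2 * k\<close>, and the end \<open>a\<close> is the hub.\<close>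
    have "E b s" "E a s" if "s \<in> L" for s using join that a(1) ab(1) sym by blast+
    moreover have "b \<notin> L" "0 < 2 * k - 1" using ab LR(2) k by auto
    ultimately have "contains_wheel n E (2 * k - 1 + 1)"
      using path_plus_vertex_wheel[OF G p, of b a] ab(2) by blast
    then show False using free k by auto
  qed
  ultimately show "in_U_family k E L" unfolding in_U_family_def by blast
qed

end

theorem theorem1p3:
  fixes k :: nat
  assumes "k \<in> {4, 5}"
  shows "\<exists>n0. \<forall>n\<ge>n0. \<forall>E. SPEX_wheel k n E \<longrightarrow>
    (\<exists>(s::real) L R. \<bar>s\<bar> \<le> 1 \<and> L \<union> R = {0..<n} \<and> L \<inter> R = {} \<and>
       real (card L) = real n / 2 + s \<and> real (card R) = real n / 2 - s \<and>
       (\<forall>u\<in>L. \<forall>v\<in>R. E u v) \<and>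
       in_U_family k E L \<and>
       card (edges_in E R) = 1)"
proof -
  obtain n1 where n1: "\<forall>n\<ge>n1. \<forall>E. SPEX_wheel k n E \<longrightarrow> (\<exists>x L R.
    (\<forall>i<n. 1 - 1 / 1000 \<le> x i \<and> x i \<le> 1 \<and> sum x {j. E i j} = spectral_radius n E * x i) \<and>
    \<bar>spectral_radius n E - n / 2\<bar> \<le> 1 / 1000 * n \<and> L \<union> R = {..<n} \<and> L \<inter> R = {} \<and>
    \<bar>card L - n / 2\<bar> \<le> 1 / 1000 * n \<and> \<bar>card R - n / 2\<bar> \<le> 1 / 1000 * n \<and>
    (\<forall>v\<in>L. card {u \<in> R. \<not> E v u} \<le> 1 / 1000 * n) \<and> (\<forall>v\<in>R. card {u \<in> L. \<not> E v u} \<le> 1 / 1000 * n))"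
    using spex_stability[OF assms, of "1 / 1000"] by auto
  show ?thesis
  proof (intro exI[of _ "max n1 1000000"] allI impI)
    fix n E assume n: "max n1 1000000 \<le> n" and S: "SPEX_wheel k n E"
    let ?r = "spectral_radius n E"
    have "n1 \<le> n" using n by simp
    from mp[OF spec[OF mp[OF spec[OF n1] this]] S]
    obtain x L R where x: "\<forall>i<n. 1 - 1 / 1000 \<le> x i \<and> x i \<le> 1 \<and> sum x {j. E i j} = ?r * x i"
      and r: "\<bar>?r - n / 2\<bar> \<le> 1 / 1000 * n" and LR: "L \<union> R = {..<n}" "L \<inter> R = {}"
      and c: "\<bar>card L - n / 2\<bar> \<le> 1 / 1000 * n" "\<bar>card R - n / 2\<bar> \<le> 1 / 1000 * n"
      and non: "\<forall>v\<in>L. card {u \<in> R. \<not> E v u} \<le> 1 / 1000 * n" "\<forall>v\<in>R. card {u \<in> L. \<not> E v u} \<le> 1 / 1000 * n"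
      by blast
    have n6: "1000000 \<le> real n" using n by simp
    have "26 \<le> n" using n by simp
    note lower = spex_spectral_lower[OF S assms \<open>26 \<le> n\<close>]
    \<comment> \<open>The edge term is at least 1.99, and the parity loss of 1 leaves the 99/100 of
      the locale.\<close>
    have "199 / 100 * ?r \<le> real n - 2" using r n6 unfolding abs_le_iff by linarith
    then have "199 / 100 \<le> (real n - 2) / ?r" using lower(1) by (simp add: pos_le_divide_eq)
    then have low: "(real n)\<^sup>2 / 4 + 99 / 100 \<le> ?r\<^sup>2 - (real k - 1) * ?r" using lower(2) by linarith
    interpret near_join k n E x ?r L R
      using S assms n6 x r LR c non low unfolding SPEX_wheel_def odd_wheel_free_def
      by unfold_locales auto
    \<comment> \<open>Stated for an arbitrary ordered pair of sides, since the vertex of full inner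
      degree may lie in \<open>L\<close> or in \<open>R\<close>.\<close>
    have goal: "\<exists>(s::real) L R. \<bar>s\<bar> \<le> 1 \<and> L \<union> R = {0..<n} \<and> L \<inter> R = {} \<and>
       real (card L) = real n / 2 + s \<and> real (card R) = real n / 2 - s \<and>
       (\<forall>u\<in>L. \<forall>v\<in>R. E u v) \<and> in_U_family k E L \<and> card (edges_in E R) = 1"
      if "near_join k n E x ?r A B" and full: "\<exists>v\<in>A. deg_in E A v = k - 1" for A B
    proof -
      interpret J: near_join k n E x ?r A B by (rule that(1))
      from full obtain v where v: "v \<in> A" "deg_in E A v = k - 1" by blast
      have "A \<union> B = {0..<n}" using J.LR(1) by (simp add: lessThan_atLeast0)
      moreover have "real (card B) = real n / 2 - (card A - n / 2)" using J.card_LR by simp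
      ultimately show ?thesis using J.extremal_structure[OF v] J.LR(2)
        by - (rule exI[of _ "card A - n / 2"], rule exI[of _ A], rule exI[of _ B], simp)
    qed
    show "\<exists>(s::real) L R. \<bar>s\<bar> \<le> 1 \<and> L \<union> R = {0..<n} \<and> L \<inter> R = {} \<and>
       real (card L) = real n / 2 + s \<and> real (card R) = real n / 2 - s \<and>
       (\<forall>u\<in>L. \<forall>v\<in>R. E u v) \<and> in_U_family k E L \<and> card (edges_in E R) = 1"
      using full_degree_vertex goal[OF near_join_axioms] goal[OF swap] by blast
  qed
qed

end
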